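(* For each $k\ge0$ there exists a constant $D_k$ such that, for every continuous symmetric $W:(0,\infty)^2\to\mathbb{R}$ with $0\le W\le1$ and $W(\lambda x,\lambda y)=W(x,y)$ for all $x,y,\lambda>0$, and every $0\le\varepsilon\le1$, each self-similar profile $G_\varepsilon$ with unit mass for the kernel $K_\varepsilon=2+\varepsilon W$ satisfies $$\|G_\varepsilon-G_0\|_{L^1_k}\le D_k\,\varepsilon,$$ where $G_0(x)=e^{-x}$.
   Context: For $k\ge0$, $\|f\|_{L^1_k}=\int_0^\infty|f(x)|(1+x)^k\,dx$. For a bounded symmetric kernel $K$ on $(0,\infty)^2$ put $$\mathcal C_K(f,f)(x)=\tfrac12\int_0^xK(x-y,y)f(x-y)f(y)\,dy-f(x)\int_0^\infty K(x,y)f(y)\,dy,\qquad (S_th)(x)=e^{2t}h(e^tx).$$ A self-similar profile with unit mass for $K$ is a nonnegative $G\in L^1_1$ with $\int_0^\infty xG(x)\,dx=1$ which is a stationary mild solution of $\partial_tf=\mathcal C_K(f,f)+2f+x\partial_xf$, i.e. $G=S_tG+\int_0^tS_{t-s}\mathcal C_K(G,G)\,ds$ for all $t\ge0$. For $K=2$ the unique such profile is $G_0(x)=e^{-x}$. *)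

theory Defs
  imports "HOL-Analysis.Analysis"
begin

text \<open>
  Functions on the half-line \<open>(0,\<infinity>)\<close> are total functions on \<^typ>\<open>real\<close> whose values
  outside \<open>(0,\<infinity>)\<close> are irrelevant. Elements of the weighted spaces \<open>L\<^sup>1\<^sub>k\<close> are
  represented by Lebesgue measurable functions; all notions below are invariant under changes on
  null sets. The norm takes values in \<^typ>\<open>ennreal\<close>, so that a bound on it includes finiteness.
\<close>

definition L1_norm :: "real \<Rightarrow> (real \<Rightarrow> real) \<Rightarrow> ennreal" where
  "L1_norm k f = (\<integral>\<^sup>+ x\<in>{0<..}. ennreal (\<bar>f x\<bar> * (1 + x) powr k) \<partial>lebesgue)"

definition in_L1 :: "real \<Rightarrow> (real \<Rightarrow> real) \<Rightarrow> bool" where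
  "in_L1 k f \<longleftrightarrow> set_borel_measurable lebesgue {0<..} f \<and> L1_norm k f < \<infinity>"

text \<open>
  For a bounded measurable \<open>K\<close> and integrable \<open>f\<close> both integrals converge absolutely for almost every
  \<open>x > 0\<close>, so the convention that a divergent Bochner integral is \<open>0\<close> only matters on a null set.
\<close>

definition coag :: "(real \<Rightarrow> real \<Rightarrow> real) \<Rightarrow> (real \<Rightarrow> real) \<Rightarrow> real \<Rightarrow> real" where
  "coag K f x =
     1/2 * (LINT y:{0<..<x}|lebesgue. K (x - y) y * f (x - y) * f y)
     - f x * (LINT y:{0<..}|lebesgue. K x y * f y)"

definition dilation :: "real \<Rightarrow> (real \<Rightarrow> real) \<Rightarrow> real \<Rightarrow> real" where
  "dilation t h x = exp (2 * t) * h (exp t * x)"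

text \<open>
  The mild equation is an identity in \<open>L\<^sup>1\<close>, hence holds for almost every \<open>x\<close>, with a null set
  that may depend on \<open>t\<close>. The \<open>L\<^sup>1\<close>-valued time integral is evaluated at \<open>x\<close> as a scalar integral;
  for bounded measurable \<open>K\<close> and \<open>G \<in> L\<^sup>1\<^sub>1\<close> it converges absolutely for almost every \<open>x\<close> by
  Fubini's theorem.
\<close>

definition stationary_mild_solution :: "(real \<Rightarrow> real \<Rightarrow> real) \<Rightarrow> (real \<Rightarrow> real) \<Rightarrow> bool" where
  "stationary_mild_solution K G \<longleftrightarrow>
     (\<forall>t\<ge>0. AE x in lebesgue. x > 0 \<longrightarrow>
        G x = dilation t G x + (LINT s:{0..t}|lebesgue. dilation (t - s) (coag K G) x))"

definition self_similar_profile :: "(real \<Rightarrow> real \<Rightarrow> real) \<Rightarrow> (real \<Rightarrow> real) \<Rightarrow> bool" where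
  "self_similar_profile K G \<longleftrightarrow>
     in_L1 1 G \<and>
     (AE x in lebesgue. x > 0 \<longrightarrow> G x \<ge> 0) \<and>
     (LINT x:{0<..}|lebesgue. x * G x) = 1 \<and>
     stationary_mild_solution K G"

end

theory Submission
  imports Defs "HOL-Real_Asymp.Real_Asymp"
begin

text \<open>
  Everything rests on the tail \<open>N(x) = \<integral>\<^sub>x\<^sup>\<infinity> G\<close> of a profile \<open>G\<close>. Testing the stationary equation with
  \<open>u \<mapsto> max 0 (u - x)\<close> gives
  \<open>x N(x) = \<integral>\<integral> K(a,b) G(a) G(b) (max 0 (a+b-x) - max 0 (a-x) - max 0 (b-x)) da db / 2\<close>. The bracket is
  nonnegative, and for \<open>K = 2\<close> the right-hand side is the convolution \<open>N * N\<close>. As \<open>K\<close> lies between \<open>2\<close> and \<open>2 + \<epsilon>\<close>,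
  the decreasing function \<open>N\<close>, which has integral one, satisfies \<open>N * N \<le> x N \<le> (1 + \<epsilon>/2) (N * N)\<close>
  (\<open>near_exponential_N\<close>). For \<open>\<epsilon> = 0\<close> this forces \<open>N(x) = exp (- x)\<close>, and the problem becomes a stability
  question about a scalar convolution inequality in which the kernel no longer appears.

  The stability of that inequality (\<open>near_exponential_stable\<close>) is first shown without a rate. The moments of \<open>N\<close> are
  at most \<open>j! (3/2)\<^sup>j\<close>, so \<open>N\<close> decays exponentially, uniformly in \<open>\<epsilon> \<le> 1\<close>. Its Laplace transform \<open>P\<close> satisfies
  \<open>P\<^sup>2 \<le> - P' \<le> (1 + \<epsilon>/2) P\<^sup>2\<close>, hence is within \<open>\<epsilon>\<close> of \<open>1 / (1 + z)\<close>; Weierstrass approximation in the variable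
  \<open>exp (- x)\<close> and monotonicity turn this into uniform closeness (\<open>weighted_close\<close>). The rate comes from the
  linearization. With \<open>n = N - exp (- x)\<close> and \<open>W\<close> the convolution of \<open>n\<close> with \<open>exp (- x)\<close>, one has \<open>W' = n - W\<close>, and
  \<open>x n - 2 W\<close> differs from zero only by \<open>n * n\<close> and a term of size \<open>\<epsilon>\<close>. This is a first-order differential
  equation for \<open>W\<close>, solved explicitly; its one-dimensional kernel, due to scaling, is excluded by the
  vanishing integral of \<open>W\<close>. Thus \<open>n\<close> is bounded by its square plus \<open>\<epsilon>\<close> in the norm
  \<open>sup exp (x/2) \<bar>n(x)\<bar>\<close> (\<open>bootstrap\<close>), and the qualitative closeness absorbs the square.

  To pass to the density, test with the indicator of \<open>u > x\<close>: up to terms of size \<open>\<epsilon>\<close> that are controlled both near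
  zero and at infinity, \<open>x G = G * N\<close> (\<open>density_error\<close>). Subtracting the same equation for
  \<open>exp (- x)\<close> leaves only terms that contain \<open>n\<close>, because convolution with \<open>exp (- x)\<close> smooths
  \<open>g = G - exp (- x)\<close> (\<open>density_difference\<close>). This bounds \<open>x g\<close> by \<open>\<epsilon> exp (- x/4)\<close>, which suffices away from
  zero. Near zero, let \<open>d\<close> be the primitive of \<open>g\<close>; then \<open>q = x g - d\<close> is of order \<open>\<epsilon> x (G + 1)\<close>
  (\<open>near_bound\<close>), and since \<open>(d/x)' = q/x\<^sup>2\<close>, both \<open>d/x\<close> and \<open>g\<close> have integrals of order \<open>\<epsilon>\<close>
  (\<open>near_integral\<close>). When \<open>\<epsilon>\<close> is not small, exponential moments of \<open>G\<close> suffice (\<open>crude_bound\<close>).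

  Finally, the mild equation at \<open>t = m ln 2\<close> says that \<open>x\<^sup>2 G - \<integral>\<^sub>x\<^sup>\<infinity> u C(u) du\<close>, with \<open>C\<close> the coagulation term, is
  invariant under dilation by \<open>2\<^sup>m\<close>. As this quantity is small on average at infinity, it is zero
  (\<open>scaling_invariant_zero\<close>), and this is the form of the equation used above.
\<close>

section \<open>Convolution inequalities for the tail\<close>

definition conv :: "(real \<Rightarrow> real) \<Rightarrow> (real \<Rightarrow> real) \<Rightarrow> real \<Rightarrow> real" where
  "conv f g x = integral {0..x} (\<lambda>y. f (x - y) * g y)"

text \<open>
  Tonelli and the translation \<open>x \<mapsto> x + y\<close>; with \<open>\<phi>\<close> a power or an exponential the right-hand
  side splits, which is how moments and Laplace transforms of a convolution are computed below.
\<close>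

lemma nn_integral_convolution:
  fixes f g \<phi> :: "real \<Rightarrow> ennreal"
  assumes [measurable]: "f \<in> borel_measurable borel" "g \<in> borel_measurable borel" "\<phi> \<in> borel_measurable borel"
  shows "(\<integral>\<^sup>+x. \<phi> x * (\<integral>\<^sup>+y. f (x - y) * g y \<partial>lborel) \<partial>lborel) =
    (\<integral>\<^sup>+y. (\<integral>\<^sup>+x. \<phi> (x + y) * f x \<partial>lborel) * g y \<partial>lborel)"
proof -
  have "(\<integral>\<^sup>+x. \<phi> x * (\<integral>\<^sup>+y. f (x - y) * g y \<partial>lborel) \<partial>lborel) =
      (\<integral>\<^sup>+x. (\<integral>\<^sup>+y. \<phi> x * (f (x - y) * g y) \<partial>lborel) \<partial>lborel)"
    by (subst nn_integral_cmult) auto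
  also have "\<dots> = (\<integral>\<^sup>+y. (\<integral>\<^sup>+x. \<phi> x * (f (x - y) * g y) \<partial>lborel) \<partial>lborel)"
    by (rule lborel_pair.Fubini') measurable
  also have "\<dots> = (\<integral>\<^sup>+y. (\<integral>\<^sup>+x. \<phi> (x + y) * f x \<partial>lborel) * g y \<partial>lborel)"
  proof (intro nn_integral_cong)
    fix y :: real
    have "(\<integral>\<^sup>+x. \<phi> x * (f (x - y) * g y) \<partial>lborel) = (\<integral>\<^sup>+x. \<phi> x * f (x - y) \<partial>lborel) * g y"
      by (subst nn_integral_multc[symmetric]) (auto simp: mult_ac)
    also have "(\<integral>\<^sup>+x. \<phi> x * f (x - y) \<partial>lborel) = (\<integral>\<^sup>+x. \<phi> (x + y) * f x \<partial>lborel)"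
      by (subst nn_integral_real_affine[where c=1 and t=y]) (auto simp: add.commute)
    finally show "(\<integral>\<^sup>+x. \<phi> x * (f (x - y) * g y) \<partial>lborel) = (\<integral>\<^sup>+x. \<phi> (x + y) * f x \<partial>lborel) * g y" .
  qed
  finally show ?thesis .
qed

text \<open>
  The conditions that the tail \<open>N(x) = \<integral>\<^sub>x\<^sup>\<infinity> G\<close> of a self-similar profile satisfies. The exact equation
  \<open>x N = N * N\<close> has the solutions \<open>exp (- \<lambda> x)\<close>, and total mass one selects \<open>\<lambda> = 1\<close>.
\<close>

locale near_exponential =
  fixes N :: "real \<Rightarrow> real" and \<epsilon> :: real
  assumes cont: "continuous_on {0..} N"
    and dec: "\<And>x y. 0 \<le> x \<Longrightarrow> x \<le> y \<Longrightarrow> N y \<le> N x"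
    and nonneg: "\<And>x. 0 \<le> x \<Longrightarrow> 0 \<le> N x"
    and mass: "(\<integral>\<^sup>+x. ennreal (N x) * indicator {0..} x \<partial>lborel) = 1"
    and eps: "0 \<le> \<epsilon>" "\<epsilon> \<le> 1"
    and lower: "\<And>x. 0 \<le> x \<Longrightarrow> conv N N x \<le> x * N x"
    and upper: "\<And>x. 0 \<le> x \<Longrightarrow> x * N x \<le> (1 + \<epsilon> / 2) * conv N N x"
begin

text \<open>
  The extension of \<open>N\<close> by zero, so that convolutions become integrals over the whole line.
\<close>

definition Ne :: "real \<Rightarrow> ennreal" where
  "Ne x = ennreal (N x) * indicator {0..} x"

lemma Ne_meas[measurable]: "Ne \<in> borel_measurable borel"
proof -
  have "(\<lambda>x. indicator {0..} x *\<^sub>R N x) \<in> borel_measurable borel"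
    using cont by (intro borel_measurable_continuous_on_indicator) auto
  moreover have "Ne = (\<lambda>x. ennreal (indicator {0..} x *\<^sub>R N x))"
    by (auto simp: Ne_def fun_eq_iff split: split_indicator)
  ultimately show ?thesis by simp
qed

lemma conv_cont: "continuous_on {0..x} (\<lambda>y. N (x - y) * N y)"
  by (intro continuous_on_mult continuous_on_compose2[OF cont] continuous_on_subset[OF cont] continuous_intros) auto

lemma conv_nonneg: "0 \<le> conv N N x"
  unfolding conv_def
  by (intro integral_nonneg integrable_continuous_interval conv_cont) (auto intro!: mult_nonneg_nonneg nonneg)

lemma nn_conv: "(\<integral>\<^sup>+y. Ne (x - y) * Ne y \<partial>lborel) = ennreal (conv N N x) * indicator {0..} x"
proof (cases "0 \<le> x")
  case True
  have "((\<lambda>y. N (x - y) * N y) has_integral conv N N x) {0..x}"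
    unfolding conv_def by (intro integrable_integral integrable_continuous_interval conv_cont)
  then have "(\<integral>\<^sup>+y. ennreal (N (x - y) * N y) * indicator {0..x} y \<partial>lborel) = ennreal (conv N N x)"
    by (rule nn_integral_has_integral_lebesgue'[rotated]) (auto intro!: mult_nonneg_nonneg nonneg)
  moreover have "ennreal (N (x - y) * N y) * indicator {0..x} y = Ne (x - y) * Ne y" for y
    by (auto simp: Ne_def ennreal_mult nonneg split: split_indicator)
  ultimately show ?thesis using True by simp
next
  case False
  then have "(\<lambda>y. Ne (x - y) * Ne y) = (\<lambda>y. 0)" by (auto simp: Ne_def fun_eq_iff split: split_indicator)
  with False show ?thesis by simp
qed

text \<open>
  Monotonicity gives \<open>x N(x)\<^sup>2 \<le> (N * N)(x)\<close>, and the right-hand side is at most \<open>x N(x)\<close>.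
\<close>

lemma le_one: assumes "0 \<le> x" shows "N x \<le> 1"
proof -
  have pos: "N x \<le> 1" if x: "0 < x" for x
  proof -
    have "x * (N x * N x) = integral {0..x} (\<lambda>y. N x * N x)" using x by (simp add: mult_ac)
    also have "\<dots> \<le> conv N N x"
      unfolding conv_def
      by (intro integral_le integrable_continuous_interval conv_cont continuous_intros)
         (auto intro!: mult_mono dec nonneg)
    also have "\<dots> \<le> x * N x" using x by (intro lower) auto
    finally have "x * (N x * N x) \<le> x * N x" .
    then have le: "N x * N x \<le> N x" by (rule mult_left_le_imp_le) (rule x)
    show "N x \<le> 1"
    proof (rule ccontr)
      assume "\<not> N x \<le> 1"
      then have "N x * 1 < N x * N x" by (intro mult_strict_left_mono) auto
      then show False using le by simp
    qed
  qed
  have "(N \<longlongrightarrow> N 0) (at 0 within {0..})" using cont by (auto simp: continuous_on_def)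
  then have "(N \<longlongrightarrow> N 0) (at_right 0)" by (rule tendsto_within_subset) auto
  then have "N 0 \<le> 1"
    by (rule tendsto_upperbound) (auto intro!: eventually_at_rightI[of 0 1] pos)
  with pos assms show ?thesis by (cases "x = 0") auto
qed

definition moment :: "nat \<Rightarrow> ennreal" where
  "moment j = (\<integral>\<^sup>+x. ennreal (x ^ j) * Ne x \<partial>lborel)"

lemma moment_0: "moment 0 = 1"
  using mass by (simp add: moment_def Ne_def)

text \<open>
  The two-sided inequality in the form in which it enters integrals against a nonnegative weight.
\<close>

lemma mult_N_le:
  assumes "\<And>x. 0 \<le> x \<Longrightarrow> 0 \<le> f x"
  shows "ennreal (f x) * (ennreal x * Ne x) \<le> ennreal (1 + \<epsilon>/2) * (ennreal (f x) * (\<integral>\<^sup>+y. Ne (x - y) * Ne y \<partial>lborel))"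
    and "ennreal (f x) * (\<integral>\<^sup>+y. Ne (x - y) * Ne y \<partial>lborel) \<le> ennreal (f x) * (ennreal x * Ne x)"
proof -
  show "ennreal (f x) * (\<integral>\<^sup>+y. Ne (x - y) * Ne y \<partial>lborel) \<le> ennreal (f x) * (ennreal x * Ne x)"
    unfolding nn_conv unfolding Ne_def using lower[of x]
    by (auto simp: ennreal_mult[symmetric] nonneg intro!: mult_left_mono ennreal_leI split: split_indicator)
  have "ennreal x * Ne x \<le> ennreal (1 + \<epsilon>/2) * (\<integral>\<^sup>+y. Ne (x - y) * Ne y \<partial>lborel)"
  proof (cases "0 \<le> x")
    case True
    then have "ennreal x * Ne x = ennreal (x * N x)" by (simp add: Ne_def ennreal_mult nonneg)
    also have "\<dots> \<le> ennreal ((1 + \<epsilon> / 2) * conv N N x)" using True by (intro ennreal_leI upper)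
    also have "\<dots> = ennreal (1 + \<epsilon>/2) * ennreal (conv N N x)"
      using eps by (intro ennreal_mult conv_nonneg) auto
    finally show ?thesis using True unfolding nn_conv by simp
  qed (auto simp: Ne_def)
  then have "ennreal (f x) * (ennreal x * Ne x) \<le> ennreal (f x) * (ennreal (1 + \<epsilon>/2) * (\<integral>\<^sup>+y. Ne (x - y) * Ne y \<partial>lborel))"
    by (intro mult_left_mono) auto
  then show "ennreal (f x) * (ennreal x * Ne x) \<le> ennreal (1 + \<epsilon>/2) * (ennreal (f x) * (\<integral>\<^sup>+y. Ne (x - y) * Ne y \<partial>lborel))"
    by (simp add: mult_ac)
qed

text \<open>
  The upper inequality trades one power of \<open>x\<close> for a convolution, whose moments are binomial
  sums of lower moments. Hence all moments are finite as soon as the mass is.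
\<close>

lemma moment_Suc: "moment (Suc j) \<le> ennreal (3/2) * (\<Sum>i\<le>j. of_nat (j choose i) * moment i * moment (j - i))"
proof -
  have "moment (Suc j) = (\<integral>\<^sup>+x. ennreal (x^j) * (ennreal x * Ne x) \<partial>lborel)"
    unfolding moment_def
    by (intro nn_integral_cong) (auto simp: Ne_def ennreal_mult mult_ac split: split_indicator)
  also have "\<dots> \<le> (\<integral>\<^sup>+x. ennreal (1 + \<epsilon>/2) * (ennreal (x^j) * (\<integral>\<^sup>+y. Ne (x - y) * Ne y \<partial>lborel)) \<partial>lborel)"
    by (intro nn_integral_mono mult_N_le) auto
  also have "\<dots> = ennreal (1 + \<epsilon>/2) * (\<integral>\<^sup>+x. ennreal (x^j) * (\<integral>\<^sup>+y. Ne (x - y) * Ne y \<partial>lborel) \<partial>lborel)"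
    by (subst nn_integral_cmult) auto
  also have "\<dots> \<le> ennreal (3/2) * (\<integral>\<^sup>+x. ennreal (x^j) * (\<integral>\<^sup>+y. Ne (x - y) * Ne y \<partial>lborel) \<partial>lborel)"
    using eps by (intro mult_right_mono ennreal_leI) auto
  also have "(\<integral>\<^sup>+x. ennreal (x^j) * (\<integral>\<^sup>+y. Ne (x - y) * Ne y \<partial>lborel) \<partial>lborel) =
      (\<integral>\<^sup>+y. (\<integral>\<^sup>+x. ennreal ((x + y)^j) * Ne x \<partial>lborel) * Ne y \<partial>lborel)"
    by (rule nn_integral_convolution) auto
  also have "\<dots> = (\<integral>\<^sup>+y. (\<integral>\<^sup>+x. (\<Sum>i\<le>j. of_nat (j choose i) * ennreal (x^i) * ennreal (y^(j-i)) * Ne x) \<partial>lborel) * Ne y \<partial>lborel)"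
  proof (intro nn_integral_cong)
    fix y :: real
    have "ennreal ((x + y)^j) * Ne x = (\<Sum>i\<le>j. of_nat (j choose i) * ennreal (x^i) * ennreal (y^(j-i)) * Ne x)"
      if "0 \<le> y" for x
    proof (cases "0 \<le> x")
      case True
      then have "ennreal ((x + y)^j) = (ennreal x + ennreal y)^j"
        using that by (simp add: ennreal_power[symmetric])
      also have "\<dots> = (\<Sum>i\<le>j. of_nat (j choose i) * ennreal (x^i) * ennreal (y^(j-i)))"
        by (subst binomial_ring) (use that True in \<open>simp add: ennreal_power\<close>)
      finally show ?thesis by (simp add: sum_distrib_right)
    qed (auto simp: Ne_def)
    then show "(\<integral>\<^sup>+x. ennreal ((x + y)^j) * Ne x \<partial>lborel) * Ne y =
       (\<integral>\<^sup>+x. (\<Sum>i\<le>j. of_nat (j choose i) * ennreal (x^i) * ennreal (y^(j-i)) * Ne x) \<partial>lborel) * Ne y"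
      by (cases "0 \<le> y") (auto simp: Ne_def)
  qed
  also have "\<dots> = (\<integral>\<^sup>+y. (\<Sum>i\<le>j. of_nat (j choose i) * moment i * (ennreal (y^(j-i)) * Ne y)) \<partial>lborel)"
  proof (intro nn_integral_cong)
    fix y :: real
    have "(\<integral>\<^sup>+x. of_nat (j choose i) * ennreal (x^i) * ennreal (y^(j-i)) * Ne x \<partial>lborel) =
        of_nat (j choose i) * ennreal (y^(j-i)) * moment i" for i
      unfolding moment_def by (subst nn_integral_cmult[symmetric]) (auto simp: mult_ac)
    then show "(\<integral>\<^sup>+x. (\<Sum>i\<le>j. of_nat (j choose i) * ennreal (x^i) * ennreal (y^(j-i)) * Ne x) \<partial>lborel) * Ne y
      = (\<Sum>i\<le>j. of_nat (j choose i) * moment i * (ennreal (y^(j-i)) * Ne y))"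
      by (subst nn_integral_sum) (auto simp: sum_distrib_left mult_ac)
  qed
  also have "\<dots> = (\<Sum>i\<le>j. of_nat (j choose i) * moment i * moment (j - i))"
    by (subst nn_integral_sum) (auto simp: moment_def nn_integral_cmult)
  finally show ?thesis .
qed

text \<open>
  All \<open>j + 1\<close> terms of the binomial sum contribute equally, so the recursion is solved exactly by
  \<open>j! (3/2)\<^sup>j\<close>, the moments of an exponential law.
\<close>

lemma moment_le: "moment j \<le> ennreal (fact j * (3/2)^j)"
proof (induction j rule: less_induct)
  case (less j)
  show ?case
  proof (cases j)
    case 0 then show ?thesis by (simp add: moment_0)
  next
    case (Suc m)
    have "moment (Suc m) \<le> ennreal (3/2) * (\<Sum>i\<le>m. of_nat (m choose i) * moment i * moment (m - i))"
      by (rule moment_Suc)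
    also have "\<dots> \<le> ennreal (3/2) * (\<Sum>i\<le>m. of_nat (m choose i) * ennreal (fact i * (3/2)^i) * ennreal (fact (m-i) * (3/2)^(m-i)))"
      using Suc by (intro mult_left_mono sum_mono mult_mono less.IH) auto
    also have "\<dots> = ennreal (3/2) * (\<Sum>i\<le>m. ennreal (fact m * (3/2)^m))"
    proof (intro arg_cong2[where f="(*)"] sum.cong refl)
      fix i assume i: "i \<in> {..m}"
      have e: "real (m choose i) * (fact i * (3/2)^i) * (fact (m-i) * (3/2)^(m-i)) = fact m * (3/2)^m"
      proof -
        have "fact m = (fact i * fact (m - i) * real (m choose i) :: real)"
          using binomial_fact_lemma[of i m] i by (metis atMost_iff of_nat_fact of_nat_mult)
        moreover have "(3/2::real)^m = (3/2)^i * (3/2)^(m-i)" using i by (simp add: power_add[symmetric])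
        ultimately show ?thesis by simp
      qed
      show "of_nat (m choose i) * ennreal (fact i * (3/2)^i) * ennreal (fact (m-i) * (3/2)^(m-i)) = ennreal (fact m * (3/2)^m)"
        unfolding e[symmetric]
        by (simp add: ennreal_mult[symmetric] ennreal_of_nat_eq_real_of_nat)
    qed
    also have "\<dots> = ennreal (3/2 * (real (Suc m) * (fact m * (3/2)^m)))"
      by (simp only: sum_constant card_atMost ennreal_of_nat_eq_real_of_nat)
         (subst ennreal_mult[symmetric]; simp)+
    also have "3/2 * (real (Suc m) * (fact m * (3/2)^m)) = fact j * (3/2)^j"
      using Suc by (simp add: algebra_simps)
    finally show ?thesis using Suc by simp
  qed
qed

text \<open>
  The exponential series converges for rates below \<open>2/3\<close>. The rate \<open>3/5\<close> leaves a margin over the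
  rate \<open>1/2\<close> that is used as a weight later on.
\<close>

lemma exp_moment: "(\<integral>\<^sup>+x. ennreal (exp (3/5 * x)) * Ne x \<partial>lborel) \<le> 10"
proof -
  have "(\<integral>\<^sup>+x. ennreal (exp (3/5 * x)) * Ne x \<partial>lborel) =
      (\<integral>\<^sup>+x. (\<Sum>j. ennreal ((3/5)^j / fact j) * (ennreal (x^j) * Ne x)) \<partial>lborel)"
  proof (intro nn_integral_cong)
    fix x :: real
    have "(\<Sum>j. ennreal ((3/5)^j / fact j) * ennreal (x^j)) = ennreal (exp (3/5*x))" if "0 \<le> x"
    proof -
      have "(\<lambda>j. (3/5*x)^j /\<^sub>R fact j) sums exp (3/5*x)" by (rule exp_converges)
      then have "(\<Sum>j. ennreal ((3/5*x)^j /\<^sub>R fact j)) = ennreal (exp (3/5*x))"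
        using that by (intro suminf_ennreal_eq) auto
      moreover have "ennreal ((3/5*x)^j /\<^sub>R fact j) = ennreal ((3/5)^j / fact j) * ennreal (x^j)" for j
        using that by (simp add: ennreal_mult[symmetric] field_simps)
      ultimately show ?thesis by simp
    qed
    then show "ennreal (exp (3/5 * x)) * Ne x = (\<Sum>j. ennreal ((3/5)^j / fact j) * (ennreal (x^j) * Ne x))"
      by (cases "0 \<le> x") (auto simp: Ne_def ennreal_suminf_multc mult.assoc[symmetric])
  qed
  also have "\<dots> = (\<Sum>j. ennreal ((3/5)^j / fact j) * moment j)"
    unfolding moment_def by (subst nn_integral_suminf) (auto simp: nn_integral_cmult)
  also have "\<dots> \<le> (\<Sum>j. ennreal ((9/10)^j))"
  proof (intro suminf_le summableI)
    fix j
    have "ennreal ((3/5)^j / fact j) * moment j \<le> ennreal ((3/5)^j / fact j) * ennreal (fact j * (3/2)^j)"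
      by (intro mult_left_mono moment_le) auto
    also have "\<dots> = ennreal ((9/10)^j)"
      by (simp add: ennreal_mult[symmetric] power_mult_distrib[symmetric])
    finally show "ennreal ((3/5)^j / fact j) * moment j \<le> ennreal ((9/10)^j)" .
  qed
  also have "\<dots> = ennreal (1 / (1 - 9/10))"
    by (intro suminf_ennreal_eq geometric_sums) auto
  finally show ?thesis by simp
qed

text \<open>
  Monotonicity turns the integral bound on the window from \<open>x - 1\<close> to \<open>x\<close> into a pointwise one.
\<close>

lemma exp_bound: assumes "0 \<le> x" shows "N x \<le> 20 * exp (- (3/5 * x))"
proof (cases "x \<le> 1")
  case True
  have "exp (3/5 * x) \<le> exp 1" using True assms by simp
  also have "\<dots> \<le> 3" by (rule exp_le)
  finally have "1 \<le> 20 * exp (- (3/5*x))" by (simp add: exp_minus field_simps)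
  with le_one[OF assms] show ?thesis by simp
next
  case False
  have "ennreal (N x * exp (3/5 * (x - 1))) = (\<integral>\<^sup>+y. ennreal (N x * exp (3/5 * (x - 1))) * indicator {x-1..x} y \<partial>lborel)"
    by (subst nn_integral_cmult_indicator) auto
  also have "\<dots> \<le> (\<integral>\<^sup>+y. ennreal (exp (3/5 * y)) * Ne y \<partial>lborel)"
  proof (intro nn_integral_mono)
    fix y
    show "ennreal (N x * exp (3/5 * (x - 1))) * indicator {x-1..x} y \<le> ennreal (exp (3/5 * y)) * Ne y"
    proof (cases "y \<in> {x-1..x}")
      case True
      have "N x * exp (3/5 * (x - 1)) \<le> N y * exp (3/5 * y)"
        using True False by (intro mult_mono dec nonneg) auto
      then show ?thesis using True False
        by (auto simp: Ne_def ennreal_mult[symmetric] nonneg mult_ac intro!: ennreal_leI)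
    qed auto
  qed
  also have "\<dots> \<le> ennreal 10" using exp_moment by simp
  finally have "N x * exp (3/5 * (x - 1)) \<le> 10" by (subst (asm) ennreal_le_iff) auto
  then have "N x * exp (3/5 * (x - 1)) * (exp (3/5) * exp (- (3/5*x))) \<le> 10 * (exp (3/5) * exp (- (3/5*x)))"
    by (rule mult_right_mono) simp
  moreover have "exp (3/5 * (x - 1)) * (exp (3/5) * exp (- (3/5*x))) = 1"
    by (simp add: exp_add[symmetric] algebra_simps diff_divide_distrib)
  ultimately have "N x \<le> 10 * exp (3/5) * exp (- (3/5*x))"
    by (simp only: mult.assoc mult_1_right)
  also have "exp (3/5) \<le> (2::real)"
  proof -
    have "exp (3/5::real) ^ 5 = exp 3" by (simp add: exp_of_nat_mult[symmetric])
    also have "\<dots> = exp 1 ^ 3" by (simp add: exp_of_nat_mult[symmetric])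
    also have "\<dots> \<le> 3 ^ 3" by (intro power_mono exp_le) auto
    also have "\<dots> \<le> (2::real)^5" by simp
    finally show ?thesis by (rule power_le_imp_le_base[of _ 4, simplified]) simp
  qed
  then have "10 * exp (3/5) * exp (- (3/5*x)) \<le> 20 * exp (- (3/5*x))" by simp
  finally show ?thesis .
qed

end

section \<open>The Laplace transform of the tail\<close>

context near_exponential begin

text \<open>
  The Laplace transform of \<open>N\<close>, and \<open>P\<close> its real-valued version.
\<close>

definition L :: "real \<Rightarrow> ennreal" where
  "L z = (\<integral>\<^sup>+x. ennreal (exp (- z * x)) * Ne x \<partial>lborel)"

definition P :: "real \<Rightarrow> real" where "P z = enn2real (L z)"

lemma L_0: "L 0 = 1" using mass by (simp add: L_def Ne_def)

lemma L_le_1: assumes "0 \<le> z" shows "L z \<le> 1"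
proof -
  have "L z \<le> L 0"
    unfolding L_def
  proof (intro nn_integral_mono)
    fix x show "ennreal (exp (- z * x)) * Ne x \<le> ennreal (exp (- 0 * x)) * Ne x"
    proof (cases "0 \<le> x")
      case True
      then show ?thesis using assms by (intro mult_right_mono ennreal_leI) auto
    qed (auto simp: Ne_def)
  qed
  then show ?thesis by (simp add: L_0)
qed

lemma L_P: assumes "0 \<le> z" shows "L z = ennreal (P z)"
  unfolding P_def using le_less_trans[OF L_le_1[OF assms] ennreal_one_less_top] by simp

lemma P_nonneg: "0 \<le> P z" by (simp add: P_def)

lemma P_le_1: "0 \<le> z \<Longrightarrow> P z \<le> 1"
  using L_le_1[of z] L_P[of z] by simp

lemma P_0: "P 0 = 1" by (simp add: P_def L_0)

lemma L_conv: assumes "0 \<le> z"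
  shows "(\<integral>\<^sup>+x. ennreal (exp (- z * x)) * (\<integral>\<^sup>+y. Ne (x - y) * Ne y \<partial>lborel) \<partial>lborel) = ennreal ((P z)\<^sup>2)"
proof -
  have "(\<integral>\<^sup>+x. ennreal (exp (- z * x)) * (\<integral>\<^sup>+y. Ne (x - y) * Ne y \<partial>lborel) \<partial>lborel)
     = (\<integral>\<^sup>+y. (\<integral>\<^sup>+x. ennreal (exp (- z * (x + y))) * Ne x \<partial>lborel) * Ne y \<partial>lborel)"
    by (rule nn_integral_convolution) auto
  also have "\<dots> = (\<integral>\<^sup>+y. L z * (ennreal (exp (- z * y)) * Ne y) \<partial>lborel)"
  proof (intro nn_integral_cong)
    fix y
    have "ennreal (exp (- z * (x + y))) * Ne x = ennreal (exp (- z * y)) * (ennreal (exp (- z * x)) * Ne x)" for x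
    proof -
      have "exp (- z * (x + y)) = exp (- z * y) * exp (- z * x)" by (simp add: exp_add[symmetric] algebra_simps)
      then show ?thesis by (simp add: ennreal_mult mult_ac)
    qed
    then have "(\<integral>\<^sup>+x. ennreal (exp (- z * (x + y))) * Ne x \<partial>lborel) = ennreal (exp (- z * y)) * L z"
      unfolding L_def by (simp add: nn_integral_cmult)
    then show "(\<integral>\<^sup>+x. ennreal (exp (- z * (x + y))) * Ne x \<partial>lborel) * Ne y = L z * (ennreal (exp (- z * y)) * Ne y)"
      by (simp add: mult_ac)
  qed
  also have "\<dots> = L z * L z"
    by (subst nn_integral_cmult) (auto simp: L_def)
  finally show ?thesis
    by (simp add: L_P[OF assms] power2_eq_square ennreal_mult P_nonneg)
qed

text \<open>
  A discrete form of \<open>P\<^sup>2 \<le> - P' \<le> (1 + \<epsilon>/2) P\<^sup>2\<close>, where \<open>- P'\<close> is the transform of \<open>x N\<close> and \<open>P\<^sup>2\<close> that of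
  \<open>N * N\<close>. The convexity estimate \<open>1 + h x \<le> exp (h x)\<close> replaces differentiation under the integral.
\<close>

lemma P_step:
  assumes z: "0 \<le> z" and h: "0 \<le> h"
  shows "P (z + h) + h * (P (z + h))\<^sup>2 \<le> P z"
    and "P z \<le> P (z + h) + h * (1 + \<epsilon>/2) * (P z)\<^sup>2"
proof -
  have zh: "0 \<le> z + h" using z h by simp
  have "ennreal (P (z + h) + h * (P (z + h))\<^sup>2) = L (z + h) + ennreal h * ennreal ((P (z + h))\<^sup>2)"
    using h by (simp add: L_P[OF zh] P_nonneg ennreal_mult)
  also have "\<dots> = (\<integral>\<^sup>+x. ennreal (exp (- (z + h) * x)) * Ne x +
      ennreal h * (ennreal (exp (- (z + h) * x)) * (\<integral>\<^sup>+y. Ne (x - y) * Ne y \<partial>lborel)) \<partial>lborel)"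
    unfolding L_conv[OF zh, symmetric] L_def
    by (subst nn_integral_add) (auto simp: nn_integral_cmult)
  also have "\<dots> \<le> L z"
    unfolding L_def
  proof (intro nn_integral_mono)
    fix x :: real
    have "ennreal (exp (- (z + h) * x)) * Ne x +
        ennreal h * (ennreal (exp (- (z + h) * x)) * (\<integral>\<^sup>+y. Ne (x - y) * Ne y \<partial>lborel)) \<le>
      ennreal (exp (- (z + h) * x)) * Ne x + ennreal h * (ennreal (exp (- (z + h) * x)) * (ennreal x * Ne x))"
      by (intro add_left_mono mult_left_mono mult_N_le) auto
    also have "\<dots> \<le> ennreal (exp (- z * x)) * Ne x"
    proof (cases "0 \<le> x")
      case True
      have "exp (- (z + h) * x) * (1 + h * x) \<le> exp (- (z + h) * x) * exp (h * x)"
        by (intro mult_left_mono exp_ge_add_one_self) auto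
      also have "\<dots> = exp (- z * x)" by (simp add: exp_add[symmetric] algebra_simps)
      finally have *: "exp (- (z + h) * x) + h * (exp (- (z + h) * x) * x) \<le> exp (- z * x)" by (simp add: algebra_simps)
      have "ennreal (exp (- (z + h) * x)) * Ne x + ennreal h * (ennreal (exp (- (z + h) * x)) * (ennreal x * Ne x))
         = ennreal (exp (- (z + h) * x) + h * (exp (- (z + h) * x) * x)) * Ne x"
        using True h by (subst ennreal_plus) (auto simp: ennreal_mult distrib_right distrib_left mult_ac)
      also have "\<dots> \<le> ennreal (exp (- z * x)) * Ne x" by (intro mult_right_mono ennreal_leI *) auto
      finally show ?thesis .
    qed (auto simp: Ne_def)
    finally show "ennreal (exp (- (z + h) * x)) * Ne x +
        ennreal h * (ennreal (exp (- (z + h) * x)) * (\<integral>\<^sup>+y. Ne (x - y) * Ne y \<partial>lborel)) \<le> ennreal (exp (- z * x)) * Ne x" .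
  qed
  finally show "P (z + h) + h * (P (z + h))\<^sup>2 \<le> P z"
    by (simp add: L_P[OF z] P_nonneg)
  have "L z \<le> (\<integral>\<^sup>+x. ennreal (exp (- (z + h) * x)) * Ne x +
      ennreal (h * (1 + \<epsilon>/2)) * (ennreal (exp (- z * x)) * (\<integral>\<^sup>+y. Ne (x - y) * Ne y \<partial>lborel)) \<partial>lborel)"
    unfolding L_def
  proof (intro nn_integral_mono)
    fix x :: real
    have "ennreal (exp (- z * x)) * Ne x \<le> ennreal (exp (- (z + h) * x)) * Ne x +
       ennreal h * (ennreal (exp (- z * x)) * (ennreal x * Ne x))"
    proof (cases "0 \<le> x")
      case True
      have "exp (- z * x) * (1 - h * x) \<le> exp (- z * x) * exp (- h * x)"
        using exp_ge_add_one_self[of "- h * x"] by (intro mult_left_mono) auto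
      also have "\<dots> = exp (- (z + h) * x)" by (simp add: exp_add[symmetric] algebra_simps)
      finally have *: "exp (- z * x) \<le> exp (- (z + h) * x) + h * (exp (- z * x) * x)" by (simp add: algebra_simps)
      have "ennreal (exp (- z * x)) * Ne x \<le> ennreal (exp (- (z + h) * x) + h * (exp (- z * x) * x)) * Ne x"
        by (intro mult_right_mono ennreal_leI *) auto
      also have "\<dots> = ennreal (exp (- (z + h) * x)) * Ne x + ennreal h * (ennreal (exp (- z * x)) * (ennreal x * Ne x))"
        using True h by (subst ennreal_plus) (auto simp: ennreal_mult distrib_right distrib_left mult_ac)
      finally show ?thesis .
    qed (auto simp: Ne_def)
    also have "\<dots> \<le> ennreal (exp (- (z + h) * x)) * Ne x +
       ennreal h * (ennreal (1 + \<epsilon>/2) * (ennreal (exp (- z * x)) * (\<integral>\<^sup>+y. Ne (x - y) * Ne y \<partial>lborel)))"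
      by (intro add_left_mono mult_left_mono mult_N_le) auto
    also have "\<dots> = ennreal (exp (- (z + h) * x)) * Ne x +
      ennreal (h * (1 + \<epsilon>/2)) * (ennreal (exp (- z * x)) * (\<integral>\<^sup>+y. Ne (x - y) * Ne y \<partial>lborel))"
    proof -
      have "ennreal (h * (1 + \<epsilon>/2)) = ennreal h * ennreal (1 + \<epsilon>/2)" using h eps by (intro ennreal_mult) auto
      then show ?thesis by (simp only: mult.assoc)
    qed
    finally show "ennreal (exp (- z * x)) * Ne x \<le> ennreal (exp (- (z + h) * x)) * Ne x +
      ennreal (h * (1 + \<epsilon>/2)) * (ennreal (exp (- z * x)) * (\<integral>\<^sup>+y. Ne (x - y) * Ne y \<partial>lborel))" .
  qed
  also have "\<dots> = L (z + h) + ennreal (h * (1 + \<epsilon>/2)) * ennreal ((P z)\<^sup>2)"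
    unfolding L_conv[OF z, symmetric] L_def
    by (subst nn_integral_add) (auto simp: nn_integral_cmult)
  also have "\<dots> = ennreal (P (z + h)) + ennreal (h * (1 + \<epsilon>/2) * (P z)\<^sup>2)"
    unfolding L_P[OF zh] using h eps by (subst ennreal_mult[symmetric]) auto
  also have "\<dots> = ennreal (P (z + h) + h * (1 + \<epsilon>/2) * (P z)\<^sup>2)"
    using h eps by (intro ennreal_plus[symmetric] P_nonneg) auto
  finally have "ennreal (P z) \<le> ennreal (P (z + h) + h * (1 + \<epsilon>/2) * (P z)\<^sup>2)" by (simp only: L_P[OF z])
  then show "P z \<le> P (z + h) + h * (1 + \<epsilon>/2) * (P z)\<^sup>2"
    by (subst (asm) ennreal_le_iff) (use h eps P_nonneg in auto)
qed

text \<open>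
  In terms of \<open>1/P\<close> the differential inequality says that the slope lies between \<open>1\<close> and
  \<open>1 + \<epsilon>/2\<close>. Summing over a mesh of width \<open>h\<close> gives this up to factors that tend to one with \<open>h\<close>.
\<close>

lemma inverse_P_telescope:
  assumes h: "0 \<le> h" "h * (1 + \<epsilon>/2) < 1"
  defines "c \<equiv> 1 + \<epsilon>/2"
  shows "0 < P (real i * h) \<and> 1 + real i * h * (1 - h * c) \<le> 1 / P (real i * h) \<and>
    1 / P (real i * h) \<le> 1 + real i * h * c / (1 - h * c)"
proof (induction i)
  case 0 then show ?case by (simp add: P_0)
next
  case (Suc i)
  define p where "p = P (real i * h)"
  define q where "q = P (real i * h + h)"
  have c: "1 \<le> c" using eps by (simp add: c_def)
  have z: "0 \<le> real i * h" using h by simp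
  have p: "0 < p" "p \<le> 1" using Suc P_le_1[OF z] by (auto simp: p_def)
  have s1: "q + h * q\<^sup>2 \<le> p" and s2: "p \<le> q + h * c * p\<^sup>2"
    using P_step[OF z h(1)] by (auto simp: p_def q_def c_def)
  have hc: "0 \<le> h * c" "h * c < 1" using h c by (auto simp: c_def)
  have "h * c * p\<^sup>2 \<le> h * c * p"
    using p hc by (intro mult_left_mono) (auto simp: power2_eq_square)
  with s2 have q1: "p * (1 - h * c) \<le> q" by (simp add: algebra_simps)
  have q: "0 < q" using p hc by (intro less_le_trans[OF mult_pos_pos q1]) auto
  have "1 / q - 1 / p = (p - q) / (p * q)" using p q by (simp add: field_simps)
  moreover have "h * (1 - h * c) \<le> (p - q) / (p * q)"
  proof -
    have "h * (1 - h * c) * (p * q) = h * q * (p * (1 - h * c))" by (simp add: algebra_simps)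
    also have "\<dots> \<le> h * q * q" using q1 q h by (intro mult_left_mono) auto
    also have "\<dots> \<le> p - q" using s1 by (simp add: power2_eq_square algebra_simps)
    finally show ?thesis using p q by (simp add: pos_le_divide_eq)
  qed
  moreover have "(p - q) / (p * q) \<le> h * c / (1 - h * c)"
  proof -
    have "(p - q) * (1 - h * c) \<le> h * c * p\<^sup>2 * (1 - h * c)"
      using s2 hc by (intro mult_right_mono) auto
    also have "\<dots> = h * c * p * (p * (1 - h * c))" by (simp add: power2_eq_square algebra_simps)
    also have "\<dots> \<le> h * c * p * q" using q1 hc p by (intro mult_left_mono) auto
    finally have "p - q \<le> h * c * p * q / (1 - h * c)" using hc by (subst pos_le_divide_eq) auto
    also have "\<dots> = h * c / (1 - h * c) * (p * q)" by simp
    finally show ?thesis using p q by (subst pos_divide_le_eq) auto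
  qed
  ultimately have "h * (1 - h * c) \<le> 1 / q - 1 / p" "1 / q - 1 / p \<le> h * c / (1 - h * c)" by auto
  moreover have "real (Suc i) * h * c / (1 - h * c) = real i * h * c / (1 - h * c) + h * c / (1 - h * c)"
    by (simp add: algebra_simps add_divide_distrib)
  moreover have "real (Suc i) * h * (1 - h * c) = real i * h * (1 - h * c) + h * (1 - h * c)"
    by (simp add: algebra_simps)
  moreover have "real (Suc i) * h = real i * h + h" by (simp add: algebra_simps)
  ultimately show ?case using Suc q unfolding p_def q_def by auto
qed

text \<open>
  The limit of vanishing mesh width, with \<open>z\<close> divided into \<open>m\<close> equal steps.
\<close>

lemma P_bounds:
  assumes z: "0 \<le> z"
  shows "1 / (1 + (1 + \<epsilon>/2) * z) \<le> P z" "P z \<le> 1 / (1 + z)"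
proof -
  define c where "c = 1 + \<epsilon>/2"
  have c: "1 \<le> c" using eps by (simp add: c_def)
  have ev: "\<forall>\<^sub>F m in sequentially. 0 < P z \<and> 1 + z * (1 - z / real m * c) \<le> 1 / P z \<and>
      1 / P z \<le> 1 + z * c / (1 - z / real m * c)"
  proof -
    have "(\<lambda>m. z / real m * c) \<longlonglongrightarrow> 0" by real_asymp
    then have "\<forall>\<^sub>F m in sequentially. z / real m * c < 1" by (rule order_tendstoD) simp
    then show ?thesis using eventually_gt_at_top[of 0]
    proof eventually_elim
      case (elim m)
      then show ?case using inverse_P_telescope[of "z / real m" m] z by (simp add: c_def)
    qed
  qed
  have pos: "0 < P z" using eventually_happens[OF ev] by auto
  have "(\<lambda>m. 1 + z * (1 - z / real m * c)) \<longlonglongrightarrow> 1 + z * (1 - 0)" by real_asymp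
  then have "1 + z \<le> 1 / P z"
    using ev by (intro tendsto_upperbound[where F=sequentially and f="\<lambda>m. 1 + z * (1 - z / real m * c)"]) (auto elim: eventually_mono)
  then show "P z \<le> 1 / (1 + z)" using pos z by (simp add: field_simps)
  have "(\<lambda>m. 1 + z * c / (1 - z / real m * c)) \<longlonglongrightarrow> 1 + z * c / (1 - 0)" by real_asymp
  then have "1 / P z \<le> 1 + z * c"
    using ev by (intro tendsto_lowerbound[where F=sequentially and f="\<lambda>m. 1 + z * c / (1 - z / real m * c)"]) (auto elim: eventually_mono)
  then show "1 / (1 + (1 + \<epsilon>/2) * z) \<le> P z"
  proof -
    have "1 \<le> (1 + z * c) * P z" using \<open>1 / P z \<le> 1 + z * c\<close> pos by (simp add: pos_divide_le_eq)
    moreover have "0 < 1 + z * c" using z c by (simp add: add_pos_nonneg)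
    ultimately show ?thesis unfolding c_def[symmetric] by (simp add: pos_divide_le_eq mult_ac)
  qed
qed

lemma P_close: assumes z: "0 \<le> z" shows "\<bar>P z - 1 / (1 + z)\<bar> \<le> \<epsilon>"
proof -
  define c where "c = 1 + \<epsilon>/2"
  have c: "1 \<le> c" using eps by (simp add: c_def)
  have cz: "0 < 1 + c * z" using c z by (simp add: add_pos_nonneg)
  have "1 / (1 + z) - 1 / (1 + c * z) = (c - 1) * (z / ((1 + z) * (1 + c * z)))"
    using z cz by (simp add: field_simps)
  also have "\<dots> \<le> (c - 1) * 1"
  proof (intro mult_left_mono)
    have "z \<le> 1 + z" by simp
    also have "\<dots> \<le> (1 + z) * (1 + c * z)" using z c by simp
    finally show "z / ((1 + z) * (1 + c * z)) \<le> 1" using z cz by (simp add: divide_le_eq)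
  qed (use c in auto)
  finally show ?thesis using P_bounds[OF z] eps unfolding c_def by (auto simp: abs_le_iff)
qed

text \<open>
  The functional \<open>f \<mapsto> \<integral>\<^sub>0\<^sup>\<infinity> N(x) exp (- x) f(exp (- x)) dx\<close>. It evaluates polynomials by values of the Laplace
  transform at positive integers; the factor \<open>exp (- x)\<close> is the Jacobian of the substitution
  \<open>u = exp (- x)\<close>, which maps the half-line to the unit interval.
\<close>

definition F :: "(real \<Rightarrow> real) \<Rightarrow> real" where
  "F f = (\<integral>x. indicator {0..} x * (N x * exp (- x) * f (exp (- x))) \<partial>lborel)"

lemma integrable_N: "integrable lborel (\<lambda>x. indicator {0..} x * N x)"
proof -
  have "(\<lambda>x. indicator {0..} x *\<^sub>R N x) \<in> borel_measurable borel"
    using cont by (intro borel_measurable_continuous_on_indicator) auto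
  then have m: "(\<lambda>x. indicator {0..} x * N x) \<in> borel_measurable borel" by simp
  have "(\<integral>\<^sup>+x. ennreal (indicator {0..} x * N x) \<partial>lborel) = (\<integral>\<^sup>+x. ennreal (N x) * indicator {0..} x \<partial>lborel)"
    by (intro nn_integral_cong) (auto split: split_indicator)
  then have "(\<integral>\<^sup>+x. ennreal (indicator {0..} x * N x) \<partial>lborel) < \<infinity>" using mass by simp
  with m show ?thesis
    by (intro integrableI_nonneg) (auto split: split_indicator simp: nonneg)
qed

lemma F_integrable:
  assumes f: "continuous_on {0..1} f"
  shows "integrable lborel (\<lambda>x. indicator {0..} x * (N x * exp (- x) * f (exp (- x))))"
proof -
  have "compact (f ` {0..1})" by (intro compact_continuous_image f) auto
  then have "bounded (f ` {0..1})" by (rule compact_imp_bounded)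
  then obtain M where "\<forall>v\<in>f ` {0..1}. norm v \<le> M" unfolding bounded_iff by blast
  then have M: "\<And>u. u \<in> {0..1} \<Longrightarrow> \<bar>f u\<bar> \<le> M" by auto
  have "continuous_on {0..} (\<lambda>x. N x * exp (- x) * f (exp (- x)))"
    by (intro continuous_on_mult cont continuous_on_compose2[OF f] continuous_intros) auto
  then have "(\<lambda>x. indicator {0..} x *\<^sub>R (N x * exp (- x) * f (exp (- x)))) \<in> borel_measurable borel"
    by (intro borel_measurable_continuous_on_indicator) auto
  then have m: "(\<lambda>x. indicator {0..} x * (N x * exp (- x) * f (exp (- x)))) \<in> borel_measurable lborel" by simp
  show ?thesis
  proof (rule Bochner_Integration.integrable_bound[OF _ m])
    show "integrable lborel (\<lambda>x. M * (indicator {0..} x * N x))" using integrable_N by simp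
    have "\<bar>N x * exp (- x) * f (exp (- x))\<bar> \<le> \<bar>M * N x\<bar>" if "0 \<le> x" for x
    proof -
      have "\<bar>f (exp (- x))\<bar> \<le> M" using that by (intro M) auto
      then have "N x * exp (- x) * \<bar>f (exp (- x))\<bar> \<le> N x * 1 * M"
        using that by (intro mult_mono nonneg) (auto simp: nonneg)
      also have "\<dots> \<le> \<bar>M * N x\<bar>" by (simp only: mult_1_right mult.commute[of M] abs_ge_self)
      finally show ?thesis using nonneg[OF that] by (simp add: abs_mult)
    qed
    then show "AE x in lborel. norm (indicator {0..} x * (N x * exp (- x) * f (exp (- x)))) \<le> norm (M * (indicator {0..} x * N x))"
      by (intro AE_I2) (auto split: split_indicator)
  qed
qed

lemma F_monomial: "F (\<lambda>u. u ^ i) = P (real i + 1)"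
proof -
  have "F (\<lambda>u. u ^ i) = enn2real (\<integral>\<^sup>+x. ennreal (indicator {0..} x * (N x * exp (- x) * exp (- x) ^ i)) \<partial>lborel)"
    unfolding F_def by (intro integral_eq_nn_integral borel_measurable_integrable F_integrable continuous_intros AE_I2)
      (auto split: split_indicator simp: nonneg)
  also have "(\<integral>\<^sup>+x. ennreal (indicator {0..} x * (N x * exp (- x) * exp (- x) ^ i)) \<partial>lborel) = L (real i + 1)"
    unfolding L_def
  proof (intro nn_integral_cong)
    fix x :: real
    have "exp (- x) * exp (- x) ^ i = exp (- (real i + 1) * x)"
      by (simp add: exp_of_nat_mult[symmetric] exp_add[symmetric] algebra_simps)
    then have "N x * exp (- x) * exp (- x) ^ i = exp (- (real i + 1) * x) * N x" by (metis mult.assoc mult.commute)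
    then show "ennreal (indicator {0..} x * (N x * exp (- x) * exp (- x) ^ i)) = ennreal (exp (- (real i + 1) * x)) * Ne x"
    proof (cases "0 \<le> x")
      case True
      have "ennreal (indicator {0..} x * (N x * exp (- x) * exp (- x) ^ i)) = ennreal (exp (- (real i + 1) * x) * N x)"
        using True by (simp only: \<open>N x * exp (- x) * exp (- x) ^ i = _\<close> indicator_simps atLeast_iff mult_1)
      then show ?thesis using True by (simp add: Ne_def ennreal_mult nonneg)
    qed (simp add: Ne_def)
  qed
  finally show ?thesis by (simp add: P_def)
qed

lemma F_poly: "F (\<lambda>u. \<Sum>i\<le>k. a i * u ^ i) = (\<Sum>i\<le>k. a i * P (real i + 1))"
proof -
  have "F (\<lambda>u. \<Sum>i\<le>k. a i * u ^ i) = (\<integral>x. (\<Sum>i\<le>k. a i * (indicator {0..} x * (N x * exp (- x) * exp (- x) ^ i))) \<partial>lborel)"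
    unfolding F_def by (intro Bochner_Integration.integral_cong) (auto simp: sum_distrib_left mult_ac)
  also have "\<dots> = (\<Sum>i\<le>k. a i * F (\<lambda>u. u ^ i))"
    unfolding F_def
    by (subst Bochner_Integration.integral_sum)
       (auto intro!: integrable_mult_right F_integrable continuous_intros)
  finally show ?thesis by (simp add: F_monomial)
qed

lemma integral_N: "(\<integral>x. indicator {0..} x * N x \<partial>lborel) = 1"
proof -
  have "(\<integral>x. indicator {0..} x * N x \<partial>lborel) = enn2real (\<integral>\<^sup>+x. ennreal (indicator {0..} x * N x) \<partial>lborel)"
    using integrable_N by (intro integral_eq_nn_integral) (auto split: split_indicator simp: nonneg)
  also have "(\<integral>\<^sup>+x. ennreal (indicator {0..} x * N x) \<partial>lborel) = (\<integral>\<^sup>+x. ennreal (N x) * indicator {0..} x \<partial>lborel)"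
    by (intro nn_integral_cong) (auto split: split_indicator)
  finally show ?thesis using mass by simp
qed

text \<open>
  The functional has norm at most one because \<open>N\<close> has unit mass.
\<close>

lemma F_diff:
  assumes f: "continuous_on {0..1} f" and g: "continuous_on {0..1} g"
    and le: "\<And>u. u \<in> {0..1} \<Longrightarrow> \<bar>f u - g u\<bar> \<le> \<eta>"
  shows "\<bar>F f - F g\<bar> \<le> \<eta>"
proof -
  have "0 \<le> \<eta>" using le[of 0] by auto
  have eq: "F f - F g = (\<integral>x. indicator {0..} x * (N x * exp (- x) * f (exp (- x))) - indicator {0..} x * (N x * exp (- x) * g (exp (- x))) \<partial>lborel)"
    unfolding F_def by (intro Bochner_Integration.integral_diff[symmetric] F_integrable f g)
  have "\<bar>F f - F g\<bar> \<le> (\<integral>x. \<eta> * (indicator {0..} x * N x) \<partial>lborel)"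
    unfolding eq
  proof (rule integral_abs_bound_integral)
    show "integrable lborel (\<lambda>x. \<eta> * (indicator {0..} x * N x))" using integrable_N by simp
    fix x :: real
    have "\<bar>N x * exp (- x) * f (exp (- x)) - N x * exp (- x) * g (exp (- x))\<bar> \<le> \<eta> * N x" if "0 \<le> x"
    proof -
      have "\<bar>N x * exp (- x) * f (exp (- x)) - N x * exp (- x) * g (exp (- x))\<bar> = N x * (exp (- x) * \<bar>f (exp (- x)) - g (exp (- x))\<bar>)"
        using nonneg[OF that] by (simp add: abs_mult right_diff_distrib[symmetric])
      also have "\<dots> \<le> N x * (1 * \<eta>)"
        using that nonneg by (intro mult_left_mono mult_mono le) auto
      finally show ?thesis by (simp add: mult_ac)
    qed
    then show "\<bar>indicator {0..} x * (N x * exp (- x) * f (exp (- x))) - indicator {0..} x * (N x * exp (- x) * g (exp (- x)))\<bar> \<le> \<eta> * (indicator {0..} x * N x)"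
      by (auto split: split_indicator)
  qed (intro Bochner_Integration.integrable_diff F_integrable f g)
  also have "\<dots> = \<eta> * (\<integral>x. indicator {0..} x * N x \<partial>lborel)" by simp
  also have "\<dots> = \<eta>" by (simp add: integral_N)
  finally show ?thesis .
qed

end

lemma conv_exp_exp: assumes "0 \<le> x" shows "conv (\<lambda>x. exp (- x)) (\<lambda>x. exp (- x)) x = x * exp (- x)"
proof -
  have "conv (\<lambda>x. exp (- x)) (\<lambda>x. exp (- x)) x = integral {0..x} (\<lambda>y. exp (- x))"
    unfolding conv_def by (intro integral_cong) (simp add: exp_add[symmetric])
  then show ?thesis using assms by simp
qed

text \<open>
  The limit object belongs to the class with \<open>\<epsilon> = 0\<close>, so everything proved for \<open>N\<close> also holds for it.
\<close>

lemma near_exponential_exp: "near_exponential (\<lambda>x. exp (- x)) 0"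
proof
  show "(\<integral>\<^sup>+x. ennreal (exp (- x)) * indicator {0..} x \<partial>lborel) = 1"
    using nn_integral_has_integral_lebesgue'[OF _ has_integral_exp_minus_to_infinity[of 1 0]] by simp
qed (auto simp: conv_exp_exp intro!: continuous_intros)

lemma polynomial_close:
  assumes "near_exponential N \<epsilon>"
  shows "\<bar>near_exponential.F N (\<lambda>u. \<Sum>i\<le>k. a i * u ^ i) - near_exponential.F (\<lambda>x. exp (- x)) (\<lambda>u. \<Sum>i\<le>k. a i * u ^ i)\<bar>
    \<le> \<epsilon> * (\<Sum>i\<le>k. \<bar>a i\<bar>)"
proof -
  interpret near_exponential N \<epsilon> by fact
  interpret E: near_exponential "\<lambda>x. exp (- x)" 0 by (rule near_exponential_exp)
  have "\<bar>F (\<lambda>u. \<Sum>i\<le>k. a i * u ^ i) - E.F (\<lambda>u. \<Sum>i\<le>k. a i * u ^ i)\<bar> = \<bar>\<Sum>i\<le>k. a i * (P (real i + 1) - E.P (real i + 1))\<bar>"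
    by (simp only: F_poly E.F_poly right_diff_distrib sum_subtractf)
  also have "\<dots> \<le> (\<Sum>i\<le>k. \<bar>a i\<bar> * \<epsilon>)"
  proof (intro sum_abs[THEN order_trans] sum_mono)
    fix i
    have "\<bar>P (real i + 1) - E.P (real i + 1)\<bar> \<le> \<epsilon>"
      using P_close[of "real i + 1"] E.P_close[of "real i + 1"] by auto
    then show "\<bar>a i * (P (real i + 1) - E.P (real i + 1))\<bar> \<le> \<bar>a i\<bar> * \<epsilon>"
      by (simp add: abs_mult mult_left_mono)
  qed
  finally show ?thesis by (simp add: sum_distrib_left mult_ac)
qed

text \<open>
  Laplace transforms at the integers determine \<open>F\<close> on polynomials up to \<open>\<epsilon>\<close> times the size of the
  coefficients; Weierstrass approximation extends this to continuous test functions at the price of a rate.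
  The threshold depends on the test function but not on \<open>N\<close>.
\<close>

lemma test_function_close:
  assumes f: "continuous_on {0..1} f" and \<eta>: "0 < \<eta>"
  shows "\<exists>e>0. \<forall>N \<epsilon>. near_exponential N \<epsilon> \<longrightarrow> \<epsilon> \<le> e \<longrightarrow>
    \<bar>near_exponential.F N f - near_exponential.F (\<lambda>x. exp (- x)) f\<bar> \<le> \<eta>"
proof -
  obtain g where g: "real_polynomial_function g" "\<And>u. u \<in> {0..1} \<Longrightarrow> \<bar>f u - g u\<bar> < \<eta>/3"
    using Stone_Weierstrass_real_polynomial_function[of "{0..1}" f "\<eta>/3"] f \<eta> by auto
  then obtain a k where ak: "g = (\<lambda>u. \<Sum>i\<le>k. a i * u ^ i)"
    by (auto simp: real_polynomial_function_iff_sum)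
  define A where "A = (\<Sum>i\<le>k. \<bar>a i\<bar>)"
  have A: "0 \<le> A" by (auto simp: A_def intro: sum_nonneg)
  have gc: "continuous_on {0..1} g" unfolding ak by (intro continuous_intros)
  define e where "e = \<eta> / (3 * (A + 1))"
  have e: "0 < e" using \<eta> A by (simp add: e_def)
  have eA: "e * A \<le> \<eta>/3"
  proof -
    have "e * A \<le> e * (A + 1)" using e by simp
    also have "\<dots> = \<eta>/3" using A by (simp add: e_def field_simps)
    finally show ?thesis .
  qed
  show ?thesis
  proof (intro exI[of _ e] conjI e allI impI)
    fix N \<epsilon> assume N: "near_exponential N \<epsilon>" and "\<epsilon> \<le> e"
    interpret near_exponential N \<epsilon> by fact
    interpret E: near_exponential "\<lambda>x. exp (- x)" 0 by (rule near_exponential_exp)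
    have "\<bar>F g - E.F g\<bar> \<le> \<epsilon> * A" unfolding ak A_def by (rule polynomial_close[OF N])
    also have "\<dots> \<le> e * A" using \<open>\<epsilon> \<le> e\<close> A by (intro mult_right_mono)
    finally have "\<bar>F g - E.F g\<bar> \<le> \<eta>/3" using eA by simp
    moreover have "\<bar>F f - F g\<bar> \<le> \<eta>/3" "\<bar>E.F f - E.F g\<bar> \<le> \<eta>/3"
      by (rule F_diff E.F_diff; use f gc g(2) in \<open>auto intro: less_imp_le\<close>)+
    ultimately show "\<bar>F f - E.F f\<bar> \<le> \<eta>" by linarith
  qed
qed

section \<open>From weak to uniform closeness\<close>

text \<open>
  In the variable \<open>u = exp (- x)\<close> the bump \<open>(u - exp (- q)) (exp (- p) - u)\<close>, cut off at zero, is supported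
  exactly where \<open>p < x < q\<close>.
\<close>

lemma test_function_exists:
  fixes p q :: real
  assumes pq: "0 \<le> p" "p < q"
  obtains f :: "real \<Rightarrow> real" where "continuous_on {0..1} f" "\<And>u. 0 \<le> f u"
    "\<And>x. f (exp (- x)) \<noteq> 0 \<Longrightarrow> p < x \<and> x < q"
    "0 < (\<integral>x. indicator {0..} x * (exp (- x) * f (exp (- x))) \<partial>lborel)"
    "integrable lborel (\<lambda>x. indicator {0..} x * (exp (- x) * f (exp (- x))))"
proof
  define \<alpha> \<beta> where "\<alpha> = exp (- q)" and "\<beta> = exp (- p)"
  define f :: "real \<Rightarrow> real" where "f u = max 0 ((u - \<alpha>) * (\<beta> - u))" for u
  show c: "continuous_on {0..1} f" unfolding f_def by (intro continuous_intros)
  show "0 \<le> f u" for u by (simp add: f_def)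
  show supp: "p < x \<and> x < q" if "f (exp (- x)) \<noteq> 0" for x
  proof -
    have "0 < (exp (- x) - \<alpha>) * (\<beta> - exp (- x))" 
      by (rule ccontr) (use that in \<open>simp add: f_def max_absorb1 not_less\<close>)
    moreover have "\<alpha> < \<beta>" using pq by (simp add: \<alpha>_def \<beta>_def)
    ultimately have "\<alpha> < exp (- x)" "exp (- x) < \<beta>" by (auto simp: zero_less_mult_iff)
    then show ?thesis by (auto simp: \<alpha>_def \<beta>_def)
  qed
  have i: "integrable lborel (\<lambda>x. indicator {p..q} x * (exp (- x) * f (exp (- x))))"
    using borel_integrable_atLeastAtMost'[of p q "\<lambda>x. exp (- x) * f (exp (- x))"] pq
    unfolding set_integrable_def f_def by (simp add: continuous_intros)
  have eq: "(\<lambda>x. indicator {0..} x * (exp (- x) * f (exp (- x)))) = (\<lambda>x. indicator {p..q} x * (exp (- x) * f (exp (- x))))"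
    using supp pq by (force simp: fun_eq_iff split: split_indicator)
  show ii: "integrable lborel (\<lambda>x. indicator {0..} x * (exp (- x) * f (exp (- x))))" unfolding eq by (rule i)
  \<comment> \<open>On the middle third of the window the bump is bounded below by \<open>\<kappa>\<close>.\<close>
  define r s where "r = (2 * p + q) / 3" and "s = (p + 2 * q) / 3"
  have rs: "p < r" "r < s" "s < q" using pq by (auto simp: r_def s_def field_simps)
  define \<kappa> where "\<kappa> = exp (- q) * ((exp (- s) - \<alpha>) * (\<beta> - exp (- r)))"
  have \<kappa>: "0 < \<kappa>" using rs by (simp add: \<kappa>_def \<alpha>_def \<beta>_def)
  have "0 < \<kappa> * (s - r)" using \<kappa> rs by simp
  also have "\<dots> = (\<integral>x. \<kappa> * indicator {r..s} x \<partial>lborel)" using rs by simp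
  also have "\<dots> \<le> (\<integral>x. indicator {0..} x * (exp (- x) * f (exp (- x))) \<partial>lborel)"
  proof (rule integral_mono[OF _ ii])
    fix x :: real
    show "\<kappa> * indicator {r..s} x \<le> indicator {0..} x * (exp (- x) * f (exp (- x)))"
    proof (cases "x \<in> {r..s}")
      case True
      have "\<kappa> \<le> exp (- x) * ((exp (- x) - \<alpha>) * (\<beta> - exp (- x)))"
        unfolding \<kappa>_def using True rs by (intro mult_mono mult_nonneg_nonneg) (auto simp: \<alpha>_def \<beta>_def)
      also have "\<dots> \<le> exp (- x) * f (exp (- x))" by (simp add: f_def)
      finally show ?thesis using True rs pq by simp
    qed (auto simp: f_def)
  qed (use rs in \<open>auto intro!: integrable_mult_right integrable_real_indicator\<close>)
  finally show "0 < (\<integral>x. indicator {0..} x * (exp (- x) * f (exp (- x))) \<partial>lborel)" .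
qed

text \<open>
  For a bump supported in the window between \<open>p\<close> and \<open>q\<close>, monotonicity compares the functional with the values
  of \<open>N\<close> at the ends of the window.
\<close>

lemma (in near_exponential) F_between:
  assumes pq: "0 \<le> p" "p < q" and f: "continuous_on {0..1} f" "\<And>u. 0 \<le> f u"
    and supp: "\<And>x. f (exp (- x)) \<noteq> 0 \<Longrightarrow> p < x \<and> x < q"
    and int: "integrable lborel (\<lambda>x. indicator {0..} x * (exp (- x) * f (exp (- x))))"
  shows "N q * (\<integral>x. indicator {0..} x * (exp (- x) * f (exp (- x))) \<partial>lborel) \<le> F f"
    and "F f \<le> N p * (\<integral>x. indicator {0..} x * (exp (- x) * f (exp (- x))) \<partial>lborel)"
proof -
  have 1: "N q * (indicator {0..} x * (exp (- x) * f (exp (- x)))) \<le> indicator {0..} x * (N x * exp (- x) * f (exp (- x)))"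
   and 2: "indicator {0..} x * (N x * exp (- x) * f (exp (- x))) \<le> N p * (indicator {0..} x * (exp (- x) * f (exp (- x))))" for x
  proof -
    consider "f (exp (- x)) = 0" | "p < x" "x < q" using supp by blast
    then have "N q * (indicator {0..} x * (exp (- x) * f (exp (- x)))) \<le> indicator {0..} x * (N x * exp (- x) * f (exp (- x))) \<and>
      indicator {0..} x * (N x * exp (- x) * f (exp (- x))) \<le> N p * (indicator {0..} x * (exp (- x) * f (exp (- x))))"
    proof cases
      case 2
      have "N q * (exp (- x) * f (exp (- x))) \<le> N x * (exp (- x) * f (exp (- x)))"
       "N x * (exp (- x) * f (exp (- x))) \<le> N p * (exp (- x) * f (exp (- x)))"
        using 2 pq f by (auto intro!: mult_right_mono dec)
      then show ?thesis using 2 pq by (simp add: mult_ac)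
    qed auto
    then show "N q * (indicator {0..} x * (exp (- x) * f (exp (- x)))) \<le> indicator {0..} x * (N x * exp (- x) * f (exp (- x)))"
      "indicator {0..} x * (N x * exp (- x) * f (exp (- x))) \<le> N p * (indicator {0..} x * (exp (- x) * f (exp (- x))))" by auto
  qed
  show "N q * (\<integral>x. indicator {0..} x * (exp (- x) * f (exp (- x))) \<partial>lborel) \<le> F f"
    unfolding F_def
    by (subst integral_mult_right_zero[symmetric], intro integral_mono F_integrable f integrable_mult_right int 1)
  show "F f \<le> N p * (\<integral>x. indicator {0..} x * (exp (- x) * f (exp (- x))) \<partial>lborel)"
    unfolding F_def
    by (subst integral_mult_right_zero[symmetric], intro integral_mono F_integrable f integrable_mult_right int 2)
qed

text \<open>
  Weak closeness gives pointwise information only across a window, for functions that are monotone.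
\<close>

lemma interval_close:
  assumes pq: "0 \<le> p" "p < q" and \<eta>: "0 < \<eta>"
  shows "\<exists>e>0. \<forall>N \<epsilon>. near_exponential N \<epsilon> \<longrightarrow> \<epsilon> \<le> e \<longrightarrow> N q \<le> exp (- p) + \<eta> \<and> exp (- q) - \<eta> \<le> N p"
proof -
  obtain f where f: "continuous_on {0..1} f" "\<And>u. 0 \<le> f u" "\<And>x. f (exp (- x)) \<noteq> 0 \<Longrightarrow> p < x \<and> x < q"
    "0 < (\<integral>x. indicator {0..} x * (exp (- x) * f (exp (- x))) \<partial>lborel)"
    "integrable lborel (\<lambda>x. indicator {0..} x * (exp (- x) * f (exp (- x))))"
    using test_function_exists[OF pq] by blast
  define J where "J = (\<integral>x. indicator {0..} x * (exp (- x) * f (exp (- x))) \<partial>lborel)"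
  have J: "0 < J" using f(4) by (simp add: J_def)
  from test_function_close[OF f(1), of "\<eta> * J"] \<eta> J obtain e where e: "e > 0"
    "\<And>N \<epsilon>. near_exponential N \<epsilon> \<Longrightarrow> \<epsilon> \<le> e \<Longrightarrow>
    \<bar>near_exponential.F N f - near_exponential.F (\<lambda>x. exp (- x)) f\<bar> \<le> \<eta> * J" by auto
  interpret E: near_exponential "\<lambda>x. exp (- x)" 0 by (rule near_exponential_exp)
  show ?thesis
  proof (intro exI[of _ e] conjI e(1) allI impI)
    fix N \<epsilon> assume N: "near_exponential N \<epsilon>" and le: "\<epsilon> \<le> e"
    interpret near_exponential N \<epsilon> by fact
    note b = F_between[OF pq f(1,2,3,5), folded J_def] E.F_between[OF pq f(1,2,3,5), folded J_def] e(2)[OF N le]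
    have "N q * J \<le> (exp (- p) + \<eta>) * J" using b by (simp add: algebra_simps abs_le_iff)
    then show "N q \<le> exp (- p) + \<eta>" using J by simp
    have "(exp (- q) - \<eta>) * J \<le> N p * J" using b by (simp add: algebra_simps abs_le_iff)
    then show "exp (- q) - \<eta> \<le> N p" using J by simp
  qed
qed

lemma exp_minus_diff_le: fixes x y :: real assumes "0 \<le> x" "x \<le> y" shows "exp (- x) - exp (- y) \<le> y - x"
proof -
  have "exp (- x) - exp (- y) = exp (- x) * (1 - exp (- (y - x)))" by (simp add: algebra_simps exp_add[symmetric])
  also have "1 - exp (- (y - x)) \<le> y - x" using exp_ge_add_one_self[of "- (y - x)"] by linarith
  then have "exp (- x) * (1 - exp (- (y - x))) \<le> 1 * (y - x)"
    using assms by (intro mult_mono) auto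
  finally show ?thesis by simp
qed

lemma point_close:
  assumes a: "0 < a" and \<eta>: "0 < \<eta>"
  shows "\<exists>e>0. \<forall>N \<epsilon>. near_exponential N \<epsilon> \<longrightarrow> \<epsilon> \<le> e \<longrightarrow> \<bar>N a - exp (- a)\<bar> \<le> \<eta>"
proof -
  \<comment> \<open>The window must stay in the half-line, hence the minimum with \<open>a\<close>.\<close>
  define \<delta> where "\<delta> = min a (\<eta>/2)"
  have \<delta>: "0 < \<delta>" "\<delta> \<le> a" "\<delta> \<le> \<eta>/2" using a \<eta> by (auto simp: \<delta>_def)
  obtain e1 where e1: "e1 > 0" "\<And>N \<epsilon>. near_exponential N \<epsilon> \<Longrightarrow> \<epsilon> \<le> e1 \<Longrightarrow> N a \<le> exp (- (a - \<delta>)) + \<eta>/2"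
    using interval_close[of "a - \<delta>" a "\<eta>/2"] \<delta> \<eta> by auto
  obtain e2 where e2: "e2 > 0" "\<And>N \<epsilon>. near_exponential N \<epsilon> \<Longrightarrow> \<epsilon> \<le> e2 \<Longrightarrow> exp (- (a + \<delta>)) - \<eta>/2 \<le> N a"
    using interval_close[of a "a + \<delta>" "\<eta>/2"] \<delta> \<eta> a by auto
  have "exp (- (a - \<delta>)) - exp (- a) \<le> \<eta>/2" "exp (- a) - exp (- (a + \<delta>)) \<le> \<eta>/2"
    using exp_minus_diff_le[of "a - \<delta>" a] exp_minus_diff_le[of a "a + \<delta>"] \<delta> a by auto
  then show ?thesis
    using e1 e2 by (intro exI[of _ "min e1 e2"]) (force simp: abs_le_iff)
qed

lemma finite_points_close:
  assumes "finite A" and "\<And>a. a \<in> A \<Longrightarrow> 0 < a" and \<eta>: "0 < \<eta>"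
  shows "\<exists>e>0. \<forall>N \<epsilon>. near_exponential N \<epsilon> \<longrightarrow> \<epsilon> \<le> e \<longrightarrow> (\<forall>a\<in>A. \<bar>N a - exp (- a)\<bar> \<le> \<eta>)"
  using assms(1,2)
proof (induction A rule: finite_induct)
  case empty then show ?case by (auto intro: exI[of _ 1])
next
  case (insert a A)
  obtain e1 where e1: "e1 > 0" "\<And>N \<epsilon>. near_exponential N \<epsilon> \<Longrightarrow> \<epsilon> \<le> e1 \<Longrightarrow> (\<forall>a\<in>A. \<bar>N a - exp (- a)\<bar> \<le> \<eta>)"
    using insert by auto
  obtain e2 where e2: "e2 > 0" "\<And>N \<epsilon>. near_exponential N \<epsilon> \<Longrightarrow> \<epsilon> \<le> e2 \<Longrightarrow> \<bar>N a - exp (- a)\<bar> \<le> \<eta>"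
    using point_close[of a \<eta>] insert \<eta> by auto
  show ?case using e1 e2 by (intro exI[of _ "min e1 e2"]) auto
qed

text \<open>
  Closeness at finitely many mesh points spreads to the whole interval because \<open>N\<close> is decreasing and
  \<open>exp (- x)\<close> is Lipschitz. Left of the first mesh point the upper bound is \<open>N \<le> 1\<close>.
\<close>

lemma compact_close:
  assumes X: "0 < X" and \<eta>: "0 < \<eta>"
  shows "\<exists>e>0. \<forall>N \<epsilon>. near_exponential N \<epsilon> \<longrightarrow> \<epsilon> \<le> e \<longrightarrow> (\<forall>x\<in>{0..X}. \<bar>N x - exp (- x)\<bar> \<le> \<eta>)"
proof -
  define \<delta> where "\<delta> = \<eta>/2"
  have \<delta>: "0 < \<delta>" using \<eta> by (simp add: \<delta>_def)
  define A where "A = (\<lambda>i. real (Suc i) * \<delta>) ` {..nat \<lceil>X / \<delta>\<rceil>}"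
  obtain e where e: "e > 0" "\<And>N \<epsilon>. near_exponential N \<epsilon> \<Longrightarrow> \<epsilon> \<le> e \<Longrightarrow> (\<forall>a\<in>A. \<bar>N a - exp (- a)\<bar> \<le> \<delta>)"
    using finite_points_close[of A \<delta>] \<delta> by (force simp: A_def)
  show ?thesis
  proof (intro exI[of _ e] conjI e(1) allI impI ballI)
    fix N \<epsilon> x assume N: "near_exponential N \<epsilon>" "\<epsilon> \<le> e" and x: "x \<in> {0..X}"
    interpret near_exponential N \<epsilon> by fact
    define i where "i = nat \<lfloor>x / \<delta>\<rfloor>"
    have fl: "real i = of_int \<lfloor>x / \<delta>\<rfloor>" using x \<delta> by (simp add: i_def)
    have "real i \<le> x / \<delta>" "x / \<delta> < real i + 1" unfolding fl by linarith+
    then have i: "real i * \<delta> \<le> x" "x < real (Suc i) * \<delta>" using \<delta> by (simp_all add: field_simps)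
    have "x / \<delta> \<le> X / \<delta>" using x \<delta> by (simp add: divide_right_mono)
    then have "\<lfloor>x / \<delta>\<rfloor> \<le> \<lceil>X / \<delta>\<rceil>" by linarith
    then have iA: "i \<le> nat \<lceil>X / \<delta>\<rceil>" by (simp add: i_def)
    then have up: "\<bar>N (real (Suc i) * \<delta>) - exp (- (real (Suc i) * \<delta>))\<bar> \<le> \<delta>"
      using e(2)[OF N] by (auto simp: A_def)
    have "N (real (Suc i) * \<delta>) \<le> N x" using i x by (intro dec) auto
    moreover have "exp (- x) - exp (- (real (Suc i) * \<delta>)) \<le> real (Suc i) * \<delta> - x"
      using i x by (intro exp_minus_diff_le) auto
    moreover have "real (Suc i) * \<delta> - x \<le> \<delta>" using i by (simp add: algebra_simps)
    ultimately have 1: "exp (- x) - N x \<le> \<eta>" using up \<delta>_def by linarith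
    have 2: "N x - exp (- x) \<le> \<eta>"
    proof (cases i)
      case 0
      have "exp (- 0) - exp (- x) \<le> x - 0" using x by (intro exp_minus_diff_le) auto
      then show ?thesis using le_one[of x] x i 0 \<delta> by (simp add: \<delta>_def)
    next
      case (Suc j)
      then have lo: "\<bar>N (real i * \<delta>) - exp (- (real i * \<delta>))\<bar> \<le> \<delta>"
        using e(2)[OF N] iA by (auto simp: A_def)
      have "N x \<le> N (real i * \<delta>)" using i \<delta> by (intro dec) auto
      moreover have "exp (- (real i * \<delta>)) - exp (- x) \<le> x - real i * \<delta>"
        using i \<delta> by (intro exp_minus_diff_le) auto
      moreover have "x - real i * \<delta> \<le> \<delta>" using i by (simp add: algebra_simps)
      ultimately show ?thesis using lo \<delta>_def by linarith
    qed
    show "\<bar>N x - exp (- x)\<bar> \<le> \<eta>" using 1 2 by (simp add: abs_le_iff)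
  qed
qed

text \<open>
  Beyond a fixed point the uniform exponential bounds on \<open>N\<close> and on \<open>exp (- x)\<close> already give the estimate. The
  rate in \<open>\<epsilon>\<close> is not explicit; this is a qualitative statement whose only purpose is to start the
  quantitative bootstrap.
\<close>

lemma weighted_close:
  assumes \<eta>: "0 < \<eta>"
  shows "\<exists>e>0. \<forall>N \<epsilon>. near_exponential N \<epsilon> \<longrightarrow> \<epsilon> \<le> e \<longrightarrow> (\<forall>x\<ge>0. \<bar>N x - exp (- x)\<bar> \<le> \<eta> * exp (- (x / 2)))"
proof -
  have "((\<lambda>x::real. 20 * exp (- (x / 10))) \<longlongrightarrow> 0) at_top" by real_asymp
  then have "\<forall>\<^sub>F x::real in at_top. 20 * exp (- (x / 10)) < \<eta>" using \<eta> by (rule order_tendstoD)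
  then obtain X0 where X0: "\<And>x::real. X0 \<le> x \<Longrightarrow> 20 * exp (- (x / 10)) < \<eta>" by (auto simp: eventually_at_top_linorder)
  define X where "X = max 1 X0"
  have X: "0 < X" by (simp add: X_def)
  obtain e where e: "e > 0" "\<And>N \<epsilon>. near_exponential N \<epsilon> \<Longrightarrow> \<epsilon> \<le> e \<Longrightarrow> (\<forall>x\<in>{0..X}. \<bar>N x - exp (- x)\<bar> \<le> \<eta> * exp (- (X / 2)))"
    using compact_close[OF X, of "\<eta> * exp (- (X / 2))"] \<eta> by auto
  interpret E: near_exponential "\<lambda>x. exp (- x)" 0 by (rule near_exponential_exp)
  show ?thesis
  proof (intro exI[of _ e] conjI e(1) allI impI)
    fix N \<epsilon> and x :: real assume N: "near_exponential N \<epsilon>" "\<epsilon> \<le> e" and x: "0 \<le> x"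
    interpret near_exponential N \<epsilon> by fact
    show "\<bar>N x - exp (- x)\<bar> \<le> \<eta> * exp (- (x / 2))"
    proof (cases "x \<le> X")
      case True
      then have "\<bar>N x - exp (- x)\<bar> \<le> \<eta> * exp (- (X / 2))" using e(2)[OF N] x by auto
      also have "\<dots> \<le> \<eta> * exp (- (x / 2))" using True \<eta> by simp
      finally show ?thesis .
    next
      case False
      have "\<bar>N x - exp (- x)\<bar> \<le> 20 * exp (- (3/5 * x))"
        using exp_bound[OF x] E.exp_bound[OF x] nonneg[OF x] exp_ge_zero[of "- x"] by linarith
      also have "\<dots> = 20 * exp (- (x / 10)) * exp (- (x / 2))" by (simp add: exp_add[symmetric])
      also have "\<dots> \<le> \<eta> * exp (- (x / 2))" using X0[of x] False by (intro mult_right_mono less_imp_le) (auto simp: X_def)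
      finally show ?thesis .
    qed
  qed
qed

section \<open>The linearized equation\<close>

lemma conv_commute:
  assumes "continuous_on {0..} f" "continuous_on {0..} g" "0 \<le> x"
  shows "conv f g x = conv g f x"
proof -
  have c: "continuous_on {0..x} (\<lambda>y. f (x - y) * g y)"
    using assms by (intro continuous_on_mult continuous_on_compose2[OF assms(1)] continuous_on_subset[OF assms(2)] continuous_intros) auto
  have "((\<lambda>y. f (x - y) * g y) has_integral conv f g x) (cbox 0 x)"
    unfolding conv_def cbox_interval by (intro integrable_integral integrable_continuous_interval c)
  from has_integral_affinity[OF this, of "-1" x]
  have "((\<lambda>y. f y * g (x - y)) has_integral conv f g x) ((\<lambda>y. x - y) ` {0..x})"
    by (simp add: image_comp o_def)
  moreover have "(\<lambda>y. x - y) ` {0..x} = {0..x}" using assms(3) by simp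
  ultimately show ?thesis unfolding conv_def by (simp add: integral_unique mult.commute)
qed

text \<open>
  The mean value inequality with a varying bound \<open>g'\<close> on the derivative.
\<close>

lemma abs_diff_le_by_derivative:
  fixes z g :: "real \<Rightarrow> real"
  assumes "a \<le> b"
    and "\<And>x. a \<le> x \<Longrightarrow> x \<le> b \<Longrightarrow> (z has_real_derivative z' x) (at x)"
    and "\<And>x. a \<le> x \<Longrightarrow> x \<le> b \<Longrightarrow> (g has_real_derivative g' x) (at x)"
    and "\<And>x. a \<le> x \<Longrightarrow> x \<le> b \<Longrightarrow> \<bar>z' x\<bar> \<le> g' x"
  shows "\<bar>z b - z a\<bar> \<le> g b - g a"
proof -
  have "g a - z a \<le> g b - z b"
    using assms by (intro DERIV_nonneg_imp_nondecreasing[of a b "\<lambda>x. g x - z x"])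
      (auto intro!: exI derivative_eq_intros simp: abs_le_iff)
  moreover have "g a + z a \<le> g b + z b"
  proof (intro DERIV_nonneg_imp_nondecreasing[of a b "\<lambda>x. g x + z x"] assms)
    fix x assume x: "a \<le> x" "x \<le> b"
    then have "((\<lambda>x. g x + z x) has_real_derivative g' x + z' x) (at x)" "0 \<le> g' x + z' x"
      using assms(2,3,4)[OF x] by (auto intro: DERIV_add simp: abs_le_iff)
    then show "\<exists>y. ((\<lambda>x. g x + z x) has_real_derivative y) (at x) \<and> 0 \<le> y" by blast
  qed
  ultimately show ?thesis by (simp add: abs_le_iff)
qed

context near_exponential begin

text \<open>
  The deviation of the tail from its limit.
\<close>

definition n :: "real \<Rightarrow> real" where "n x = N x - exp (- x)"

lemma n_cont: "continuous_on {0..} n"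
  unfolding n_def by (intro continuous_intros cont)

lemma n_cont': "continuous_on {0..x} n"
  by (rule continuous_on_subset[OF n_cont]) auto

text \<open>
  \<open>W\<close> is the convolution of \<open>n\<close> with \<open>exp (- x)\<close>, written so that it is visibly differentiable
  with \<open>W' = n - W\<close>.
\<close>

definition I :: "real \<Rightarrow> real" where "I x = integral {0..x} (\<lambda>y. exp y * n y)"

definition W :: "real \<Rightarrow> real" where "W x = exp (- x) * I x"

lemma I_deriv: assumes "0 < x" shows "(I has_real_derivative exp x * n x) (at x)"
proof -
  have "continuous_on {0..x+1} (\<lambda>y. exp y * n y)" by (intro continuous_intros n_cont')
  then have "(I has_real_derivative exp x * n x) (at x within {0..x+1})"
    unfolding I_def using assms by (intro integral_has_real_derivative) auto
  moreover have "at x within {0..x+1} = at x" using assms by (intro at_within_interior) auto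
  ultimately show ?thesis by simp
qed

lemma W_deriv: assumes "0 < x" shows "(W has_real_derivative n x - W x) (at x)"
proof -
  have "exp (- x) * exp x = 1" by (simp add: exp_add[symmetric])
  then have "exp (- x) * (exp x * n x) = n x" by (metis mult.assoc mult_1)
  then have "(- exp (- x)) * I x + (exp x * n x) * exp (- x) = n x - W x" by (simp add: W_def mult.commute)
  moreover have "(W has_real_derivative (- exp (- x)) * I x + (exp x * n x) * exp (- x)) (at x)"
    unfolding W_def by (intro DERIV_mult I_deriv[OF assms]) (auto intro!: derivative_eq_intros)
  ultimately show ?thesis by (simp only:)
qed

lemma W_cont: "continuous_on {0..X} W"
  unfolding W_def I_def
  by (intro continuous_intros indefinite_integral_continuous_1 integrable_continuous_interval n_cont')

lemma W_eq: assumes "0 \<le> x" shows "W x = conv (\<lambda>x. exp (- x)) N x - x * exp (- x)"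
proof -
  have "W x = integral {0..x} (\<lambda>y. exp (- x) * (exp y * n y))" by (simp add: W_def I_def)
  also have "\<dots> = integral {0..x} (\<lambda>y. exp (- (x - y)) * N y - exp (- x))"
    by (intro integral_cong) (simp add: n_def algebra_simps exp_add[symmetric] exp_diff)
  also have "\<dots> = conv (\<lambda>x. exp (- x)) N x - x * exp (- x)"
    unfolding conv_def using assms
    by (subst integral_diff) (auto intro!: integrable_continuous_interval continuous_intros continuous_on_subset[OF cont])
  finally show ?thesis .
qed

text \<open>
  The linearization of \<open>x N - N * N\<close> at \<open>exp (- x)\<close>, applied to \<open>n\<close>.
\<close>

definition S :: "real \<Rightarrow> real" where "S x = x * n x - 2 * W x"

text \<open>
  Expanding \<open>n * n\<close>: what the linearization leaves over is quadratic in \<open>n\<close> or of size \<open>\<epsilon>\<close>.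
\<close>

lemma S_eq: assumes x: "0 \<le> x" shows "S x = conv n n x + (x * N x - conv N N x)"
proof -
  have ec: "continuous_on {0..} (\<lambda>x::real. exp (- x))" by (intro continuous_intros)
  have i: "(\<lambda>y. f (x - y) * g y) integrable_on {0..x}" if "continuous_on {0..} f" "continuous_on {0..} g" for f g :: "real \<Rightarrow> real"
    using that by (intro integrable_continuous_interval continuous_on_mult continuous_on_compose2[OF that(1)] continuous_on_subset[OF that(2)] continuous_intros) auto
  let ?E = "\<lambda>x::real. exp (- x)"
  have "conv n n x = integral {0..x} (\<lambda>y. ((N (x - y) * N y - N (x - y) * ?E y) - ?E (x - y) * N y) + ?E (x - y) * ?E y)"
    unfolding conv_def n_def by (intro integral_cong) (simp add: algebra_simps)
  also have "\<dots> = conv N N x - conv N ?E x - conv ?E N x + conv ?E ?E x"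
    unfolding conv_def
    using i[OF cont cont] i[OF cont ec] i[OF ec cont] i[OF ec ec]
    by (subst integral_add integral_diff; (intro integrable_diff)?; simp)+
  finally have "conv n n x = conv N N x - 2 * conv ?E N x + x * exp (- x)"
    using conv_commute[OF cont ec x] conv_exp_exp[OF x] by simp
  then show ?thesis unfolding S_def W_eq[OF x] n_def by (simp add: algebra_simps)
qed

lemma S_bound:
  assumes b: "\<And>x. 0 \<le> x \<Longrightarrow> \<bar>n x\<bar> \<le> \<eta> * exp (- (x / 2))" and x: "0 \<le> x"
  shows "\<bar>S x\<bar> \<le> (\<eta>\<^sup>2 + 10 * \<epsilon>) * (x * exp (- (x / 2)))"
proof -
  have "0 \<le> \<eta>" using b[of 0] by simp
  have "continuous_on {0..x} (\<lambda>y. n (x - y) * n y)"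
    by (intro continuous_on_mult continuous_on_compose2[OF n_cont] n_cont' continuous_intros) auto
  then have i: "(\<lambda>y. n (x - y) * n y) integrable_on {0..x}" by (rule integrable_continuous_interval)
  have "norm (conv n n x) \<le> integral {0..x} (\<lambda>y. \<eta>\<^sup>2 * exp (- (x / 2)))"
    unfolding conv_def
  proof (rule integral_norm_bound_integral[OF i])
    fix y assume y: "y \<in> {0..x}"
    have "\<bar>n (x - y) * n y\<bar> \<le> (\<eta> * exp (- ((x - y) / 2))) * (\<eta> * exp (- (y / 2)))"
      unfolding abs_mult using y \<open>0 \<le> \<eta>\<close> by (intro mult_mono b) auto
    also have "\<dots> = \<eta>\<^sup>2 * (exp (- ((x - y) / 2)) * exp (- (y / 2)))" by (simp add: power2_eq_square)
    also have "exp (- ((x - y) / 2)) * exp (- (y / 2)) = exp (- (x / 2))"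
      by (simp add: exp_add[symmetric] field_simps)
    finally show "norm (n (x - y) * n y) \<le> \<eta>\<^sup>2 * exp (- (x / 2))" by simp
  qed auto
  then have 1: "\<bar>conv n n x\<bar> \<le> \<eta>\<^sup>2 * (x * exp (- (x / 2)))" using x by (simp add: mult_ac)
  have "x * N x - conv N N x \<le> \<epsilon>/2 * conv N N x" using upper[OF x] by (simp add: algebra_simps)
  also have "\<dots> \<le> \<epsilon>/2 * (x * N x)" using lower[OF x] eps by (intro mult_left_mono) auto
  also have "\<dots> \<le> \<epsilon>/2 * (x * (20 * exp (- (x / 2))))"
  proof (intro mult_left_mono)
    have "exp (- (3/5*x)) \<le> exp (- (x / 2))" using x by simp
    then show "N x \<le> 20 * exp (- (x / 2))" using exp_bound[OF x] by linarith
  qed (use x eps in auto)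
  finally have "x * N x - conv N N x \<le> 10 * \<epsilon> * (x * exp (- (x / 2)))" by simp
  with 1 lower[OF x] show ?thesis unfolding S_eq[OF x] by (auto simp: abs_le_iff distrib_right)
qed

lemma integral_N_tendsto: "((\<lambda>X. integral {0..X} N) \<longlongrightarrow> 1) at_top"
proof -
  have "((\<lambda>X. \<integral>x. indicator {..X} x *\<^sub>R (indicator {0..} x * N x) \<partial>lborel) \<longlongrightarrow> (\<integral>x. indicator {0..} x * N x \<partial>lborel)) at_top"
    by (rule tendsto_integral_at_top) (auto simp: integrable_N)
  moreover have "(\<integral>x. indicator {..X} x *\<^sub>R (indicator {0..} x * N x) \<partial>lborel) = integral {0..X} N" for X
  proof -
    have "set_integrable lborel {0..X} N"
      by (rule borel_integrable_atLeastAtMost') (rule continuous_on_subset[OF cont], auto)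
    then have "(LBINT x:{0..X}. N x) = integral {0..X} N" by (rule set_borel_integral_eq_integral)
    moreover have "(\<integral>x. indicator {..X} x *\<^sub>R (indicator {0..} x * N x) \<partial>lborel) = (LBINT x:{0..X}. N x)"
      unfolding set_lebesgue_integral_def by (intro Bochner_Integration.integral_cong) (auto split: split_indicator)
    ultimately show ?thesis by simp
  qed
  ultimately show ?thesis by (simp add: integral_N)
qed

end

context near_exponential begin

interpretation E: near_exponential "\<lambda>x. exp (- x)" 0 by (rule near_exponential_exp)

lemma integral_n_tendsto: "((\<lambda>X. integral {0..X} n) \<longlongrightarrow> 0) at_top"
proof -
  have "((\<lambda>X. integral {0..X} N - integral {0..X} (\<lambda>x. exp (- x))) \<longlongrightarrow> 1 - 1) at_top"
    by (intro tendsto_diff integral_N_tendsto E.integral_N_tendsto)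
  moreover have "integral {0..X} n = integral {0..X} N - integral {0..X} (\<lambda>x. exp (- x))" for X
    unfolding n_def by (intro integral_diff integrable_continuous_interval continuous_on_subset[OF cont] continuous_intros) auto
  ultimately show ?thesis by simp
qed

text \<open>
  Since \<open>n\<close> has total integral zero, so has \<open>W\<close>; this is the normalization that excludes the kernel of the
  linearization, spanned by \<open>W = x\<^sup>2 exp (- x)\<close>, which comes from the scaling \<open>N(x) \<mapsto> N(\<lambda> x)\<close>.
\<close>

lemma W_integral: assumes "0 \<le> X" shows "integral {0..X} W = integral {0..X} n - W X"
proof -
  have "((\<lambda>x. n x - W x) has_integral (W X - W 0)) {0..X}"
    using assms W_deriv by (intro fundamental_theorem_of_calculus_interior W_cont)
     (auto simp: has_real_derivative_iff_has_vector_derivative[symmetric])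
  moreover have "W 0 = 0" by (simp add: W_def I_def)
  ultimately have "integral {0..X} (\<lambda>x. n x - W x) = W X" by (simp add: integral_unique)
  moreover have "integral {0..X} (\<lambda>x. n x - W x) = integral {0..X} n - integral {0..X} W"
    by (intro integral_diff integrable_continuous_interval n_cont' W_cont)
  ultimately show ?thesis by simp
qed

text \<open>
  Substituting \<open>n = W' + W\<close> in \<open>S = x n - 2 W\<close> gives a first-order equation, solved by the integrating factor
  \<open>(W exp x / x\<^sup>2)' = S exp x / x\<^sup>3\<close>. Its solutions are determined up to the kernel \<open>x\<^sup>2 exp (- x)\<close>, here
  parametrized by the value at \<open>1\<close>.
\<close>

lemma W_shape:
  assumes S: "\<And>x. 0 \<le> x \<Longrightarrow> \<bar>S x\<bar> \<le> \<sigma> * (x * exp (- (x / 2)))" and x: "0 < x"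
  shows "\<bar>W x - x\<^sup>2 * exp (- x) * I 1\<bar> \<le> 18 * \<sigma> * (x * exp (- (x / 2)))"
proof -
  have \<sigma>: "0 \<le> \<sigma>" using S[of 1] by (simp add: zero_le_mult_iff) (smt (verit) exp_gt_zero mult_neg_pos)
  define z where "z x = I x / x\<^sup>2" for x
  have zd: "(z has_real_derivative exp x * S x / x ^ 3) (at x)" if "0 < x" for x
  proof -
    have e: "exp x * W x = I x" by (simp add: W_def mult.assoc[symmetric] exp_add[symmetric])
    have "(exp x * n x * x\<^sup>2 - I x * (2 * x)) / (x\<^sup>2 * x\<^sup>2) = exp x * S x / x ^ 3"
      unfolding S_def e[symmetric] using that by (simp add: field_simps power2_eq_square power3_eq_cube)
    then show ?thesis unfolding z_def using that
      by (auto intro!: derivative_eq_intros I_deriv simp: power2_eq_square)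
  qed
  have zb: "\<bar>exp x * S x / x ^ 3\<bar> \<le> \<sigma> * exp (x / 2) / x\<^sup>2" if "0 < x" for x
  proof -
    have "\<bar>exp x * S x / x ^ 3\<bar> = exp x * \<bar>S x\<bar> / x ^ 3" using that by (simp add: abs_mult)
    also have "\<dots> \<le> exp x * (\<sigma> * (x * exp (- (x / 2)))) / x ^ 3"
      using that by (intro divide_right_mono mult_left_mono S) auto
    also have "\<dots> = \<sigma> * (exp x * exp (- (x / 2))) / x\<^sup>2"
      using that by (simp add: power2_eq_square power3_eq_cube)
    also have "exp x * exp (- (x / 2)) = exp (x / 2)" by (simp add: exp_add[symmetric])
    finally show ?thesis .
  qed
  have zz: "\<bar>z x - z 1\<bar> \<le> 18 * \<sigma> * exp (x / 2) / x"
  proof (cases "x \<le> 1")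
    case True
    have "\<bar>z 1 - z x\<bar> \<le> - (3 * \<sigma> / 1) - (- (3 * \<sigma> / x))"
    proof (rule abs_diff_le_by_derivative[OF True zd, where g="\<lambda>x. - (3 * \<sigma> / x)" and g'="\<lambda>x. 3 * \<sigma> / x\<^sup>2"])
      fix y assume y: "x \<le> y" "y \<le> 1"
      show "0 < y" using x y by simp
      then show "((\<lambda>x. - (3 * \<sigma> / x)) has_real_derivative 3 * \<sigma> / y\<^sup>2) (at y)"
        by (auto intro!: derivative_eq_intros simp: power2_eq_square)
      have "exp (y / 2) \<le> exp 1" using y by simp
      also have "\<dots> \<le> 3" by (rule exp_le)
      finally have "\<sigma> * exp (y / 2) / y\<^sup>2 \<le> \<sigma> * 3 / y\<^sup>2" using \<sigma> by (intro divide_right_mono mult_left_mono) auto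
      then show "\<bar>exp y * S y / y ^ 3\<bar> \<le> 3 * \<sigma> / y\<^sup>2" using zb[OF \<open>0 < y\<close>] by (simp only: mult.commute[of 3])
    qed
    also have "\<dots> \<le> 3 * \<sigma> / x" using \<sigma> by simp
    also have "\<dots> \<le> 18 * \<sigma> * exp (x / 2) / x"
      using x \<sigma> one_le_exp_iff[of "x/2"] mult_mono[of "3 * \<sigma>" "18 * \<sigma>" 1 "exp (x/2)"]
      by (intro divide_right_mono) auto
    finally show ?thesis by (simp add: abs_minus_commute)
  next
    case False
    then have "1 \<le> x" by simp
    have "\<bar>z x - z 1\<bar> \<le> 18 * \<sigma> * exp (x / 2) / (x + 2) - 18 * \<sigma> * exp (1 / 2) / (1 + 2)"
    proof (rule abs_diff_le_by_derivative[OF \<open>1 \<le> x\<close> zd, where g="\<lambda>x. 18 * \<sigma> * exp (x / 2) / (x + 2)" and g'="\<lambda>x. 18 * \<sigma> * (exp (x / 2) * (x / 2) / (x + 2)\<^sup>2)"])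
      fix y assume y: "1 \<le> y" "y \<le> x"
      then show "0 < y" by simp
      \<comment> \<open>The shift by two makes this function increasing, whereas \<open>exp (x / 2) / x\<close> decreases up to \<open>x = 2\<close>.\<close>
      show "((\<lambda>x. 18 * \<sigma> * exp (x / 2) / (x + 2)) has_real_derivative 18 * \<sigma> * (exp (y / 2) * (y / 2) / (y + 2)\<^sup>2)) (at y)"
      proof -
        have "((\<lambda>x. 18 * \<sigma> * exp (x / 2) / (x + 2)) has_real_derivative
           (18 * \<sigma> * (exp (y / 2) * (1 / 2)) * (y + 2) - 18 * \<sigma> * exp (y / 2) * 1) / ((y + 2) * (y + 2))) (at y)"
          using y by (intro DERIV_divide) (auto intro!: derivative_eq_intros)
        moreover have "18 * \<sigma> * (exp (y / 2) * (1 / 2)) * (y + 2) - 18 * \<sigma> * exp (y / 2) * 1 = 18 * \<sigma> * (exp (y / 2) * (y / 2))"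
          by (simp add: algebra_simps)
        ultimately show ?thesis by (simp add: power2_eq_square)
      qed
      have "(y + 2)\<^sup>2 \<le> (3 * y)\<^sup>2" using y by (intro power_mono) auto
      also have "\<dots> \<le> 9 * y ^ 3" using y by (simp add: power2_eq_square power3_eq_cube)
      finally have "(1 / y\<^sup>2) \<le> 9 * y / (y + 2)\<^sup>2"
        using y by (simp add: divide_simps power2_eq_square power3_eq_cube mult_ac)
      then have "\<sigma> * exp (y / 2) * (1 / y\<^sup>2) \<le> \<sigma> * exp (y / 2) * (9 * y / (y + 2)\<^sup>2)"
        using \<sigma> by (intro mult_left_mono) auto
      with zb[OF \<open>0 < y\<close>] show "\<bar>exp y * S y / y ^ 3\<bar> \<le> 18 * \<sigma> * (exp (y / 2) * (y / 2) / (y + 2)\<^sup>2)"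
        by (simp add: mult_ac)
    qed
    also have "\<dots> \<le> 18 * \<sigma> * exp (x / 2) / (x + 2)" using \<sigma> by simp
    also have "\<dots> \<le> 18 * \<sigma> * exp (x / 2) / x" using \<sigma> x by (intro divide_left_mono) auto
    finally show ?thesis .
  qed
  have "W x - x\<^sup>2 * exp (- x) * I 1 = x\<^sup>2 * exp (- x) * (z x - z 1)"
    using x by (simp add: W_def z_def algebra_simps)
  also have "\<bar>\<dots>\<bar> \<le> x\<^sup>2 * exp (- x) * (18 * \<sigma> * exp (x / 2) / x)"
    unfolding abs_mult using zz by (intro mult_mono) auto
  also have "\<dots> = 18 * \<sigma> * (x * (exp (- x) * exp (x / 2)))" using x by (simp add: power2_eq_square)
  also have "exp (- x) * exp (x / 2) = exp (- (x / 2))" by (simp add: exp_add[symmetric])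
  finally show ?thesis .
qed

text \<open>
  The free constant is fixed by the vanishing integral of \<open>W\<close>, since the kernel function has integral \<open>2\<close> and
  \<open>x exp (- x/2)\<close> has integral \<open>4\<close>.
\<close>

lemma I_1_bound:
  assumes S: "\<And>x. 0 \<le> x \<Longrightarrow> \<bar>S x\<bar> \<le> \<sigma> * (x * exp (- (x / 2)))"
  shows "\<bar>I 1\<bar> \<le> 36 * \<sigma>"
proof -
  have \<sigma>: "0 \<le> \<sigma>" using S[of 1] by (simp add: zero_le_mult_iff) (smt (verit) exp_gt_zero mult_neg_pos)
  \<comment> \<open>\<open>R X\<close> bounds the contributions to \<open>\<integral>\<^sub>0\<^sup>X W\<close> other than that of the kernel function.\<close>
  define R where "R X = \<bar>integral {0..X} n\<bar> + (X\<^sup>2 * exp (- X) * \<bar>I 1\<bar> + 18 * \<sigma> * (X * exp (- (X / 2)))) + 72 * \<sigma>" for X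
  have key: "\<bar>I 1\<bar> * (2 - (X\<^sup>2 + 2 * X + 2) * exp (- X)) \<le> R X" if X: "0 < X" for X
  proof -
    have hp: "((\<lambda>x. x\<^sup>2 * exp (- x)) has_integral (- (X\<^sup>2 + 2 * X + 2) * exp (- X) - (- (0\<^sup>2 + 2 * 0 + 2) * exp (- 0)))) {0..X}"
      using X by (intro fundamental_theorem_of_calculus)
       (auto intro!: derivative_eq_intros simp: has_real_derivative_iff_has_vector_derivative[symmetric] algebra_simps power2_eq_square)
    have hq: "((\<lambda>x. x * exp (- (x / 2))) has_integral (- (2 * X + 4) * exp (- (X / 2)) - (- (2 * 0 + 4) * exp (- (0 / 2))))) {0..X}"
      using X by (intro fundamental_theorem_of_calculus)
       (auto intro!: derivative_eq_intros simp: has_real_derivative_iff_has_vector_derivative[symmetric] algebra_simps power2_eq_square)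
    define r where "r x = W x - x\<^sup>2 * exp (- x) * I 1" for x
    have rc: "continuous_on {0..X} r" unfolding r_def by (intro continuous_intros W_cont)
    have r0: "r 0 = 0" by (simp add: r_def W_def I_def)
    have rb: "\<bar>r x\<bar> \<le> 18 * \<sigma> * (x * exp (- (x / 2)))" if "0 \<le> x" for x
      using W_shape[OF S, of x] that r0 by (cases "x = 0") (auto simp: r_def)
    have "norm (integral {0..X} r) \<le> integral {0..X} (\<lambda>x. 18 * \<sigma> * (x * exp (- (x / 2))))"
      using rb by (intro integral_norm_bound_integral integrable_continuous_interval rc continuous_intros) auto
    also have "\<dots> = 18 * \<sigma> * (4 - (2 * X + 4) * exp (- (X / 2)))"
    proof -
      have "integral {0..X} (\<lambda>x. x * exp (- (x / 2))) = 4 - (2 * X + 4) * exp (- (X / 2))"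
        using integral_unique[OF hq] by (simp add: algebra_simps)
      then show ?thesis by (simp only: integral_mult_right)
    qed
    also have "\<dots> \<le> 18 * \<sigma> * 4" using X \<sigma> by (intro mult_left_mono) auto
    finally have ir: "\<bar>integral {0..X} r\<bar> \<le> 72 * \<sigma>" by simp
    have "integral {0..X} W = integral {0..X} (\<lambda>x. x\<^sup>2 * exp (- x) * I 1 + r x)" by (simp add: r_def)
    also have "\<dots> = integral {0..X} (\<lambda>x. x\<^sup>2 * exp (- x)) * I 1 + integral {0..X} r"
      by (subst integral_add) (auto intro!: integrable_continuous_interval rc continuous_intros)
    also have "integral {0..X} (\<lambda>x. x\<^sup>2 * exp (- x)) = 2 - (X\<^sup>2 + 2 * X + 2) * exp (- X)"
      using integral_unique[OF hp] by (simp add: algebra_simps)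
    finally have e: "I 1 * (2 - (X\<^sup>2 + 2 * X + 2) * exp (- X)) = integral {0..X} n - W X - integral {0..X} r"
      using W_integral[of X] X by simp
    have "0 \<le> integral {0..X} (\<lambda>x. x\<^sup>2 * exp (- x))"
      by (intro integral_nonneg integrable_continuous_interval continuous_intros) auto
    then have "0 \<le> 2 - (X\<^sup>2 + 2 * X + 2) * exp (- X)" using integral_unique[OF hp] by (simp add: algebra_simps)
    then have "\<bar>I 1\<bar> * (2 - (X\<^sup>2 + 2 * X + 2) * exp (- X)) = \<bar>integral {0..X} n - W X - integral {0..X} r\<bar>"
      using e by (metis abs_mult abs_of_nonneg)
    moreover have "\<bar>W X\<bar> \<le> X\<^sup>2 * exp (- X) * \<bar>I 1\<bar> + 18 * \<sigma> * (X * exp (- (X / 2)))"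
    proof -
      have "W X = X\<^sup>2 * exp (- X) * I 1 + r X" by (simp add: r_def)
      then have "\<bar>W X\<bar> \<le> \<bar>X\<^sup>2 * exp (- X) * I 1\<bar> + \<bar>r X\<bar>" by (metis abs_triangle_ineq)
      with rb[of X] X show ?thesis by (simp add: abs_mult)
    qed
    ultimately show ?thesis using ir unfolding R_def by linarith
  qed
  have "((\<lambda>X. \<bar>I 1\<bar> * (2 - (X\<^sup>2 + 2 * X + 2) * exp (- X))) \<longlongrightarrow> \<bar>I 1\<bar> * (2 - 0)) at_top"
    by (intro tendsto_intros) real_asymp
  moreover have "(R \<longlongrightarrow> \<bar>0\<bar> + (0 * \<bar>I 1\<bar> + 18 * \<sigma> * 0) + 72 * \<sigma>) at_top"
  proof -
    have "((\<lambda>X::real. X\<^sup>2 * exp (- X)) \<longlongrightarrow> 0) at_top" "((\<lambda>X::real. X * exp (- (X / 2))) \<longlongrightarrow> 0) at_top"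
      by real_asymp+
    then show ?thesis unfolding R_def by (intro tendsto_intros integral_n_tendsto)
  qed
  moreover have "\<forall>\<^sub>F X in at_top. \<bar>I 1\<bar> * (2 - (X\<^sup>2 + 2 * X + 2) * exp (- X)) \<le> R X"
    using eventually_gt_at_top[of 0] by eventually_elim (rule key)
  ultimately have "\<bar>I 1\<bar> * (2 - 0) \<le> \<bar>0\<bar> + (0 * \<bar>I 1\<bar> + 18 * \<sigma> * 0) + 72 * \<sigma>"
    by (intro tendsto_le[of at_top]) auto
  then show ?thesis by simp
qed

text \<open>
  The inverse of the linearization is bounded in the norm \<open>sup exp (x/2) \<bar>n(x)\<bar>\<close>.
\<close>

lemma bootstrap:
  assumes b: "\<And>x. 0 \<le> x \<Longrightarrow> \<bar>n x\<bar> \<le> \<eta> * exp (- (x / 2))" and x: "0 \<le> x"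
  shows "\<bar>n x\<bar> \<le> 181 * (\<eta>\<^sup>2 + 10 * \<epsilon>) * exp (- (x / 2))"
proof -
  define \<sigma> where "\<sigma> = \<eta>\<^sup>2 + 10 * \<epsilon>"
  have \<sigma>: "0 \<le> \<sigma>" using eps by (simp add: \<sigma>_def)
  have S: "\<bar>S x\<bar> \<le> \<sigma> * (x * exp (- (x / 2)))" if "0 \<le> x" for x
    unfolding \<sigma>_def by (rule S_bound[OF b that])
  have pos: "\<bar>n x\<bar> \<le> 181 * \<sigma> * exp (- (x / 2))" if x: "0 < x" for x
  proof -
    have "x / 2 \<le> exp (x / 2)" using exp_ge_add_one_self[of "x/2"] by linarith
    then have "x * exp (- (x / 2)) \<le> 2" by (simp add: exp_minus field_simps)
    then have "x * (x * exp (- (x / 2)) * exp (- (x / 2))) \<le> x * (2 * exp (- (x / 2)))"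
      using x by (intro mult_left_mono mult_right_mono) auto
    also have "x * (x * exp (- (x / 2)) * exp (- (x / 2))) = x\<^sup>2 * exp (- x)"
      by (simp add: power2_eq_square mult.assoc exp_add[symmetric])
    finally have xx: "x\<^sup>2 * exp (- x) \<le> 2 * (x * exp (- (x / 2)))" by simp
    have I1: "\<bar>I 1\<bar> \<le> 36 * \<sigma>" by (rule I_1_bound[OF S])
    have e: "x\<^sup>2 * exp (- x) * \<bar>I 1\<bar> \<le> 2 * (x * exp (- (x / 2))) * (36 * \<sigma>)"
      using xx I1 x by (intro mult_mono[OF xx I1]) auto
    have "W x = x\<^sup>2 * exp (- x) * I 1 + (W x - x\<^sup>2 * exp (- x) * I 1)" by simp
    then have "\<bar>W x\<bar> \<le> \<bar>x\<^sup>2 * exp (- x) * I 1\<bar> + \<bar>W x - x\<^sup>2 * exp (- x) * I 1\<bar>"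
      by (metis abs_triangle_ineq)
    also have "\<dots> \<le> 90 * \<sigma> * (x * exp (- (x / 2)))"
      using e W_shape[OF S x] by (simp add: abs_mult mult_ac)
    finally have W: "\<bar>W x\<bar> \<le> 90 * \<sigma> * (x * exp (- (x / 2)))" .
    have "x * \<bar>n x\<bar> = \<bar>S x + 2 * W x\<bar>" using x by (simp add: S_def abs_mult)
    also have "\<dots> \<le> \<sigma> * (x * exp (- (x / 2))) + 2 * (90 * \<sigma> * (x * exp (- (x / 2))))"
      using S[of x] W x by (intro order_trans[OF abs_triangle_ineq] add_mono) (auto simp: abs_mult)
    also have "\<dots> = x * (181 * \<sigma> * exp (- (x / 2)))" by (simp add: algebra_simps)
    finally show ?thesis using x by simp
  qed
  show ?thesis
  proof (cases "x = 0")
    case True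
    have "(n \<longlongrightarrow> n 0) (at 0 within {0..})" using n_cont by (auto simp: continuous_on_def)
    then have "(n \<longlongrightarrow> n 0) (at_right 0)" by (rule tendsto_within_subset) auto
    then have "((\<lambda>x. \<bar>n x\<bar>) \<longlongrightarrow> \<bar>n 0\<bar>) (at_right 0)" by (rule tendsto_rabs)
    then have "\<bar>n 0\<bar> \<le> 181 * \<sigma>"
    proof (rule tendsto_upperbound)
      have "\<bar>n x\<bar> \<le> 181 * \<sigma>" if "0 < x" for x
      proof -
        have "181 * \<sigma> * exp (- (x / 2)) \<le> 181 * \<sigma> * 1" using that \<sigma> by (intro mult_left_mono) auto
        with pos[OF that] show ?thesis by simp
      qed
      then show "\<forall>\<^sub>F x in at_right 0. \<bar>n x\<bar> \<le> 181 * \<sigma>" by (auto intro!: eventually_at_rightI[of 0 1])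
    qed simp
    then show ?thesis using True by (simp add: \<sigma>_def)
  qed (use x pos in \<open>simp add: \<sigma>_def\<close>)
qed

text \<open>
  Once the norm \<open>\<eta>\<close> is at most \<open>1/362\<close>, half of \<open>\<eta>\<close> absorbs the quadratic term in
  \<open>\<eta> \<le> 181 (\<eta>\<^sup>2 + 10 \<epsilon>)\<close>. The norm is realized as the infimum of all admissible bounds.
\<close>

lemma bootstrap_small:
  assumes b: "\<And>x. 0 \<le> x \<Longrightarrow> \<bar>n x\<bar> \<le> 1/362 * exp (- (x / 2))" and x: "0 \<le> x"
  shows "\<bar>n x\<bar> \<le> 3620 * \<epsilon> * exp (- (x / 2))"
proof -
  define A where "A = {\<eta>. 0 \<le> \<eta> \<and> (\<forall>x\<ge>0. \<bar>n x\<bar> * exp (x / 2) \<le> \<eta>)}"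
  have eq: "\<bar>n x\<bar> \<le> \<eta> * exp (- (x / 2)) \<longleftrightarrow> \<bar>n x\<bar> * exp (x / 2) \<le> \<eta>" for x \<eta>
    by (simp add: exp_minus field_simps)
  define \<eta> where "\<eta> = Inf A"
  have m: "1/362 \<in> A" using b by (auto simp: A_def eq[symmetric])
  then have ne: "A \<noteq> {}" by blast
  have bdd: "bdd_below A" unfolding A_def by (rule bdd_belowI[of _ 0]) auto
  have "0 \<le> \<eta>" unfolding \<eta>_def by (intro cInf_greatest[OF ne]) (auto simp: A_def)
  have "\<eta> \<le> 1/362" unfolding \<eta>_def using m bdd by (rule cInf_lower)
  have "\<bar>n x\<bar> * exp (x / 2) \<le> \<eta>" if "0 \<le> x" for x
    unfolding \<eta>_def using that by (intro cInf_greatest[OF ne]) (auto simp: A_def)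
  then have \<eta>b: "\<bar>n x\<bar> \<le> \<eta> * exp (- (x / 2))" if "0 \<le> x" for x using that by (simp add: eq)
  have "181 * (\<eta>\<^sup>2 + 10 * \<epsilon>) \<in> A"
    unfolding A_def eq[symmetric] using bootstrap[OF \<eta>b] eps by (intro CollectI conjI allI impI) auto
  then have "\<eta> \<le> 181 * (\<eta>\<^sup>2 + 10 * \<epsilon>)" unfolding \<eta>_def using bdd by (rule cInf_lower)
  moreover have "\<eta>\<^sup>2 \<le> \<eta> * (1/362)" unfolding power2_eq_square using \<open>\<eta> \<le> 1/362\<close> \<open>0 \<le> \<eta>\<close> by (rule mult_left_mono)
  ultimately have "\<eta> \<le> 3620 * \<epsilon>" by simp
  then show ?thesis using \<eta>b[OF x] by (rule_tac order_trans[OF _ mult_right_mono]) auto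
qed

end

text \<open>
  Qualitative closeness supplies the smallness that makes the bootstrap linear in \<open>\<epsilon>\<close>.
\<close>

theorem near_exponential_stable:
  "\<exists>e>0. \<forall>N \<epsilon>. near_exponential N \<epsilon> \<longrightarrow> \<epsilon> \<le> e \<longrightarrow>
    (\<forall>x\<ge>0. \<bar>N x - exp (- x)\<bar> \<le> 3620 * \<epsilon> * exp (- (x / 2)))"
proof -
  obtain e where e: "e > 0" "\<And>N \<epsilon> x. near_exponential N \<epsilon> \<Longrightarrow> \<epsilon> \<le> e \<Longrightarrow> 0 \<le> x \<Longrightarrow> \<bar>N x - exp (- x)\<bar> \<le> 1/362 * exp (- (x / 2))"
    using weighted_close[of "1/362"] by auto
  show ?thesis
  proof (intro exI[of _ e] conjI e(1) allI impI)
    fix N \<epsilon> and x :: real assume N: "near_exponential N \<epsilon>" "\<epsilon> \<le> e" and x: "0 \<le> x"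
    interpret near_exponential N \<epsilon> by fact
    show "\<bar>N x - exp (- x)\<bar> \<le> 3620 * \<epsilon> * exp (- (x / 2))"
      using bootstrap_small[of x] e(2)[OF N] x by (auto simp: n_def)
  qed
qed

section \<open>The weak form of the coagulation equation\<close>

lemma integrable_pair_product:
  fixes f g :: "real \<Rightarrow> real"
  assumes f: "integrable lborel f" and g: "integrable lborel g"
  shows "integrable (lborel \<Otimes>\<^sub>M lborel) (\<lambda>(a, b). f a * g b)"
proof (rule lborel_pair.Fubini_integrable)
  have [measurable]: "f \<in> borel_measurable borel" "g \<in> borel_measurable borel"
    using f g by (auto dest: borel_measurable_integrable)
  show "(\<lambda>(a, b). f a * g b) \<in> borel_measurable (lborel \<Otimes>\<^sub>M lborel)" by measurable
  show "integrable lborel (\<lambda>x. \<integral>y. norm (case (x, y) of (a, b) \<Rightarrow> f a * g b) \<partial>lborel)"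
    using f by (simp add: abs_mult)
  show "AE x in lborel. integrable lborel (\<lambda>y. case (x, y) of (a, b) \<Rightarrow> f a * g b)"
    using g by simp
qed

text \<open>
  Open intervals make the indicator of \<open>x < y < u\<close> factor into one in \<open>y\<close> and one in \<open>u\<close>.
\<close>

lemma integral_open_interval_inverse_square:
  fixes x u :: real assumes "0 < x"
  shows "integrable lborel (\<lambda>y. indicator {x<..<u} y * (1 / y\<^sup>2))"
    and "(\<integral>y. indicator {x<..<u} y * (1 / y\<^sup>2) \<partial>lborel) = (if x < u then 1 / x - 1 / u else 0)"
proof -
  have "integrable lborel (\<lambda>y. indicator {x<..<u} y * (1 / y\<^sup>2)) \<and>
    (\<integral>y. indicator {x<..<u} y * (1 / y\<^sup>2) \<partial>lborel) = (if x < u then 1 / x - 1 / u else 0)"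
  proof (cases "x < u")
    case True
    have "has_bochner_integral lborel (\<lambda>y. (1 / y\<^sup>2) * indicator {x..u} y) (- (1 / u) - (- (1 / x)))"
      using True assms
      by (intro has_bochner_integral_FTC_Icc_real[where F="\<lambda>y. - (1 / y)"])
         (auto intro!: derivative_eq_intros continuous_intros simp: power2_eq_square)
    moreover have "AE y in lborel. (1 / y\<^sup>2) * indicator {x..u} y = indicator {x<..<u} y * (1 / y\<^sup>2)"
      using AE_lborel_singleton[of x] AE_lborel_singleton[of u] by eventually_elim (auto split: split_indicator)
    ultimately have "has_bochner_integral lborel (\<lambda>y. indicator {x<..<u} y * (1 / y\<^sup>2)) (- (1 / u) - (- (1 / x)))"
      by (subst has_bochner_integral_cong_AE[symmetric]) (auto dest: borel_measurable_has_bochner_integral)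
    then show ?thesis using True by (auto simp: has_bochner_integral_iff)
  qed simp
  then show "integrable lborel (\<lambda>y. indicator {x<..<u} y * (1 / y\<^sup>2))"
    "(\<integral>y. indicator {x<..<u} y * (1 / y\<^sup>2) \<partial>lborel) = (if x < u then 1 / x - 1 / u else 0)" by auto
qed

text \<open>
  A Borel representative \<open>H\<close> of a profile, vanishing off the positive half-line, and the perturbation \<open>w\<close> of the
  kernel, extended to the plane so that integrals need no restriction. The coagulation operator makes
  sense in this generality.
\<close>

locale coagulation_tail =
  fixes H :: "real \<Rightarrow> real" and w :: "real \<Rightarrow> real \<Rightarrow> real" and \<epsilon> :: real
  assumes H_meas[measurable]: "H \<in> borel_measurable borel"
    and H_nonneg: "\<And>x. 0 \<le> H x"
    and H_zero: "\<And>x. x \<le> 0 \<Longrightarrow> H x = 0"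
    and H_int: "integrable lborel H"
    and xH_int: "integrable lborel (\<lambda>x. x * H x)"
    and H_mass: "(\<integral>x. x * H x \<partial>lborel) = 1"
    and w_meas[measurable]: "(\<lambda>(a, b). w a b) \<in> borel_measurable (borel \<Otimes>\<^sub>M borel)"
    and w_sym: "\<And>a b. w a b = w b a"
    and w_bounds: "\<And>a b. 0 \<le> w a b" "\<And>a b. w a b \<le> 1"
    and eps: "0 \<le> \<epsilon>" "\<epsilon> \<le> 1"
begin

definition K :: "real \<Rightarrow> real \<Rightarrow> real" where "K a b = 2 + \<epsilon> * w a b"

definition C :: "real \<Rightarrow> real" where
  "C u = 1/2 * (\<integral>y. K (u - y) y * H (u - y) * H y \<partial>lborel) - H u * (\<integral>y. K u y * H y \<partial>lborel)"

text \<open>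
  The quadratic form \<open>\<integral>\<integral> f(a,b) H(a) H(b) da db\<close>. All consequences of the stationary equation are
  expressed by it.
\<close>

definition Q :: "(real \<Rightarrow> real \<Rightarrow> real) \<Rightarrow> real" where
  "Q f = (\<integral>(a, b). f a b * (H a * H b) \<partial>(lborel \<Otimes>\<^sub>M lborel))"

lemma w_meas'[measurable (raw)]:
  assumes "f \<in> borel_measurable M" "g \<in> borel_measurable M"
  shows "(\<lambda>x. w (f x) (g x)) \<in> borel_measurable M"
proof -
  have "(\<lambda>x. (f x, g x)) \<in> measurable M (borel \<Otimes>\<^sub>M borel)" using assms by measurable
  from measurable_compose[OF this w_meas] show ?thesis by simp
qed

lemma K_meas[measurable (raw)]:
  assumes "f \<in> borel_measurable M" "g \<in> borel_measurable M"
  shows "(\<lambda>x. K (f x) (g x)) \<in> borel_measurable M"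
  unfolding K_def using assms by measurable

lemma K_sym: "K a b = K b a" by (simp add: K_def w_sym)

lemma K_bounds: "2 \<le> K a b" "K a b \<le> 3"
proof -
  have "0 \<le> \<epsilon> * w a b" using eps w_bounds by (intro mult_nonneg_nonneg) auto
  moreover have "\<epsilon> * w a b \<le> 1 * 1" using eps w_bounds by (intro mult_mono) auto
  ultimately show "2 \<le> K a b" "K a b \<le> 3" by (auto simp: K_def)
qed

lemma abs_H_int: "integrable lborel (\<lambda>x. \<bar>x\<bar> * H x)"
proof -
  have "integrable lborel (\<lambda>x. \<bar>x * H x\<bar>)" using xH_int by (rule integrable_abs)
  then show ?thesis by (simp add: abs_mult H_nonneg)
qed

lemma Q_integrable:
  assumes [measurable]: "(\<lambda>(a, b). f a b) \<in> borel_measurable (lborel \<Otimes>\<^sub>M lborel)"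
    and b: "\<And>a b. \<bar>f a b\<bar> \<le> c * (1 + \<bar>a\<bar> + \<bar>b\<bar>)"
  shows "integrable (lborel \<Otimes>\<^sub>M lborel) (\<lambda>(a, b). f a b * (H a * H b))"
proof -
  have "integrable (lborel \<Otimes>\<^sub>M lborel) (\<lambda>p. c * ((case p of (a, b) \<Rightarrow> H a * H b) +
     (case p of (a, b) \<Rightarrow> (\<bar>a\<bar> * H a) * H b) + (case p of (a, b) \<Rightarrow> H a * (\<bar>b\<bar> * H b))))"
    by (intro integrable_mult_right Bochner_Integration.integrable_add integrable_pair_product H_int abs_H_int)
  then show ?thesis
  proof (rule Bochner_Integration.integrable_bound)
    show "(\<lambda>(a, b). f a b * (H a * H b)) \<in> borel_measurable (lborel \<Otimes>\<^sub>M lborel)" by measurable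
    have "\<bar>f a b * (H a * H b)\<bar> \<le> \<bar>c * (H a * H b + \<bar>a\<bar> * H a * H b + H a * (\<bar>b\<bar> * H b))\<bar>" for a b
    proof -
      have "\<bar>f a b * (H a * H b)\<bar> = \<bar>f a b\<bar> * (H a * H b)" by (simp add: abs_mult H_nonneg)
      also have "\<dots> \<le> (c * (1 + \<bar>a\<bar> + \<bar>b\<bar>)) * (H a * H b)"
        by (intro mult_right_mono b) (simp add: H_nonneg)
      also have "\<dots> = c * (H a * H b + \<bar>a\<bar> * H a * H b + H a * (\<bar>b\<bar> * H b))" by (simp add: algebra_simps)
      finally show ?thesis by simp
    qed
    then show "AE p in lborel \<Otimes>\<^sub>M lborel. norm (case p of (a, b) \<Rightarrow> f a b * (H a * H b)) \<le>
      norm (c * ((case p of (a, b) \<Rightarrow> H a * H b) + (case p of (a, b) \<Rightarrow> (\<bar>a\<bar> * H a) * H b) + (case p of (a, b) \<Rightarrow> H a * (\<bar>b\<bar> * H b))))"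
      by (intro AE_I2) (auto split: prod.split)
  qed
qed

lemma Q_integrable_bounded:
  assumes "(\<lambda>(a, b). f a b) \<in> borel_measurable (lborel \<Otimes>\<^sub>M lborel)"
    and b: "\<And>a b. \<bar>f a b\<bar> \<le> c"
  shows "integrable (lborel \<Otimes>\<^sub>M lborel) (\<lambda>(a, b). f a b * (H a * H b))"
proof (rule Q_integrable[OF assms(1)])
  fix a a' :: real
  have "0 \<le> c" using b[of 0 0] by auto
  then have "c * 1 \<le> c * (1 + \<bar>a\<bar> + \<bar>a'\<bar>)" by (intro mult_left_mono) auto
  with b[of a a'] show "\<bar>f a a'\<bar> \<le> c * (1 + \<bar>a\<bar> + \<bar>a'\<bar>)" by simp
qed

lemma Q_mono:
  assumes "integrable (lborel \<Otimes>\<^sub>M lborel) (\<lambda>(a, b). f a b * (H a * H b))"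
    "integrable (lborel \<Otimes>\<^sub>M lborel) (\<lambda>(a, b). g a b * (H a * H b))"
    and "\<And>a b. 0 < a \<Longrightarrow> 0 < b \<Longrightarrow> f a b \<le> g a b"
  shows "Q f \<le> Q g"
  unfolding Q_def
proof (rule integral_mono[OF assms(1,2)])
  fix p :: "real \<times> real"
  obtain a b where p: "p = (a, b)" by (cases p)
  show "(case p of (a, b) \<Rightarrow> f a b * (H a * H b)) \<le> (case p of (a, b) \<Rightarrow> g a b * (H a * H b))"
  proof (cases "0 < a \<and> 0 < b")
    case True
    then show ?thesis using assms(3) H_nonneg by (auto simp: p intro!: mult_right_mono)
  next
    case False
    then have "H a = 0 \<or> H b = 0" using H_zero by (auto simp: not_less)
    then show ?thesis by (auto simp: p)
  qed
qed

lemma Q_add: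
  assumes "integrable (lborel \<Otimes>\<^sub>M lborel) (\<lambda>(a, b). f a b * (H a * H b))"
    "integrable (lborel \<Otimes>\<^sub>M lborel) (\<lambda>(a, b). g a b * (H a * H b))"
  shows "Q (\<lambda>a b. f a b + g a b) = Q f + Q g"
proof -
  have "Q (\<lambda>a b. f a b + g a b) = (\<integral>p. (case p of (a, b) \<Rightarrow> f a b * (H a * H b)) + (case p of (a, b) \<Rightarrow> g a b * (H a * H b)) \<partial>(lborel \<Otimes>\<^sub>M lborel))"
    unfolding Q_def by (intro Bochner_Integration.integral_cong) (auto simp: distrib_right)
  then show ?thesis unfolding Q_def using assms by simp
qed

lemma Q_mult: "Q (\<lambda>a b. c * f a b) = c * Q f"
proof -
  have "Q (\<lambda>a b. c * f a b) = (\<integral>p. c * (case p of (a, b) \<Rightarrow> f a b * (H a * H b)) \<partial>(lborel \<Otimes>\<^sub>M lborel))"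
    unfolding Q_def by (intro Bochner_Integration.integral_cong) (auto simp: mult.assoc)
  then show ?thesis unfolding Q_def by simp
qed

lemma Q_diff:
  assumes "integrable (lborel \<Otimes>\<^sub>M lborel) (\<lambda>(a, b). f a b * (H a * H b))"
    "integrable (lborel \<Otimes>\<^sub>M lborel) (\<lambda>(a, b). g a b * (H a * H b))"
  shows "Q (\<lambda>a b. f a b - g a b) = Q f - Q g"
proof -
  have "Q (\<lambda>a b. f a b - g a b) = (\<integral>p. (case p of (a, b) \<Rightarrow> f a b * (H a * H b)) - (case p of (a, b) \<Rightarrow> g a b * (H a * H b)) \<partial>(lborel \<Otimes>\<^sub>M lborel))"
    unfolding Q_def by (intro Bochner_Integration.integral_cong) (auto simp: left_diff_distrib)
  also have "\<dots> = Q f - Q g" unfolding Q_def by (rule Bochner_Integration.integral_diff[OF assms])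
  finally show ?thesis .
qed

lemma Q_iterated:
  assumes "integrable (lborel \<Otimes>\<^sub>M lborel) (\<lambda>(a, b). f a b * (H a * H b))"
  shows "integrable lborel (\<lambda>a. \<integral>b. f a b * (H a * H b) \<partial>lborel)"
    and "(\<integral>a. (\<integral>b. f a b * (H a * H b) \<partial>lborel) \<partial>lborel) = Q f"
  using lborel_pair.integrable_fst'[OF assms] lborel_pair.integral_fst'[OF assms] by (simp_all add: Q_def)

lemma Q_swap:
  assumes "(\<lambda>(a, b). f a b) \<in> borel_measurable (lborel \<Otimes>\<^sub>M lborel)"
  shows "Q (\<lambda>a b. f b a) = Q f"
proof -
  have "(\<lambda>p. (case p of (a, b) \<Rightarrow> f a b * (H a * H b))) \<in> borel_measurable (lborel \<Otimes>\<^sub>M lborel)"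
    using assms by measurable
  from lborel_pair.integral_product_swap[OF this] show ?thesis
    unfolding Q_def by (simp add: case_prod_beta' mult.commute mult.left_commute)
qed

lemma Q_product:
  assumes "integrable lborel (\<lambda>a. f a * H a)" "integrable lborel (\<lambda>a. g a * H a)"
  shows "Q (\<lambda>a b. f a * g b) = (\<integral>a. f a * H a \<partial>lborel) * (\<integral>a. g a * H a \<partial>lborel)"
proof -
  have eq: "f a * g b * (H a * H b) = (f a * H a) * (g b * H b)" for a b by simp
  have "integrable (lborel \<Otimes>\<^sub>M lborel) (\<lambda>(a, b). f a * g b * (H a * H b))"
    unfolding eq using integrable_pair_product[OF assms] by simp
  from Q_iterated(2)[OF this] show ?thesis unfolding eq by simp
qed

text \<open>
  The usual weak form of coagulation. In the gain term the sum of the two colliding sizes is the new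
  variable; the loss term is symmetrized.
\<close>

lemma weak_form:
  assumes [measurable]: "\<phi> \<in> borel_measurable borel" and b: "\<And>u. \<bar>\<phi> u\<bar> \<le> c * (1 + \<bar>u\<bar>)"
  shows "integrable lborel (\<lambda>u. \<phi> u * C u)"
    and "(\<integral>u. \<phi> u * C u \<partial>lborel) = 1/2 * Q (\<lambda>a b. K a b * (\<phi> (a + b) - \<phi> a - \<phi> b))"
proof -
  have c: "0 \<le> c" using b[of 0] by simp
  have i: "integrable (lborel \<Otimes>\<^sub>M lborel) (\<lambda>(a, b). K a b * \<phi> (g a b) * (H a * H b))"
    if [measurable]: "(\<lambda>(a, b). g a b) \<in> borel_measurable (lborel \<Otimes>\<^sub>M lborel)" and g: "\<And>a b. \<bar>g a b\<bar> \<le> \<bar>a\<bar> + \<bar>b\<bar>" for g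
  proof (rule Q_integrable)
    show "(\<lambda>(a, b). K a b * \<phi> (g a b)) \<in> borel_measurable (lborel \<Otimes>\<^sub>M lborel)" by measurable
    fix a a' :: real
    have "\<bar>K a a' * \<phi> (g a a')\<bar> = K a a' * \<bar>\<phi> (g a a')\<bar>" using K_bounds[of a a'] by (simp add: abs_mult)
    also have "\<dots> \<le> 3 * (c * (1 + \<bar>g a a'\<bar>))" using K_bounds[of a a'] b[of "g a a'"] by (intro mult_mono) auto
    also have "\<dots> \<le> 3 * (c * (1 + \<bar>a\<bar> + \<bar>a'\<bar>))" using c g[of a a'] by (intro mult_left_mono) auto
    finally show "\<bar>K a a' * \<phi> (g a a')\<bar> \<le> 3 * c * (1 + \<bar>a\<bar> + \<bar>a'\<bar>)" by simp
  qed
  have i1: "integrable (lborel \<Otimes>\<^sub>M lborel) (\<lambda>(a, b). K a b * \<phi> (a + b) * (H a * H b))"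
   and i2: "integrable (lborel \<Otimes>\<^sub>M lborel) (\<lambda>(a, b). K a b * \<phi> a * (H a * H b))"
   and i3: "integrable (lborel \<Otimes>\<^sub>M lborel) (\<lambda>(a, b). K a b * \<phi> b * (H a * H b))"
    by (rule i; auto)+
  \<comment> \<open>The gain integrand: size \<open>u\<close> is produced from \<open>u - y\<close> and \<open>y\<close>.\<close>
  define h where "h y u = \<phi> u * (K (u - y) y * H (u - y) * H y)" for y u
  have h_shift: "h y (a + y) = K y a * \<phi> (y + a) * (H y * H a)" for y a
    by (simp add: h_def K_sym[of a y] add.commute)
  have shift: "(\<integral>u. f (u + y) \<partial>lborel) = (\<integral>u. f u \<partial>lborel)" for f :: "real \<Rightarrow> real" and y
    using lborel_integral_real_affine[of 1 f y] by (simp add: add.commute)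
  have shift_i: "integrable lborel (\<lambda>u. f (u + y)) \<longleftrightarrow> integrable lborel f" for f :: "real \<Rightarrow> real" and y
    using lborel_integrable_real_affine_iff[of 1 f y] by (simp add: add.commute)
  have hint: "integrable (lborel \<Otimes>\<^sub>M lborel) (\<lambda>(y, u). h y u)"
  proof (rule lborel_pair.Fubini_integrable)
    show "(\<lambda>(y, u). h y u) \<in> borel_measurable (lborel \<Otimes>\<^sub>M lborel)" unfolding h_def by measurable
    have "(\<integral>u. norm (h y u) \<partial>lborel) = (\<integral>a. norm (K y a * \<phi> (y + a) * (H y * H a)) \<partial>lborel)" for y
      using shift[of "\<lambda>u. norm (h y u)" y] by (simp add: h_shift)
    moreover have "integrable lborel (\<lambda>y. \<integral>a. norm (K y a * \<phi> (y + a) * (H y * H a)) \<partial>lborel)"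
      using lborel_pair.integrable_fst'[OF integrable_norm[OF i1]] by simp
    ultimately show "integrable lborel (\<lambda>y. \<integral>u. norm (case (y, u) of (y, u) \<Rightarrow> h y u) \<partial>lborel)" by simp
    have "AE y in lborel. integrable lborel (\<lambda>a. K y a * \<phi> (y + a) * (H y * H a))"
      using lborel_pair.AE_integrable_fst'[OF i1] by simp
    then show "AE y in lborel. integrable lborel (\<lambda>u. case (y, u) of (y, u) \<Rightarrow> h y u)"
    proof eventually_elim
      case (elim y)
      then show ?case using shift_i[of "h y" y] by (simp add: h_shift)
    qed
  qed
  have gain_i: "integrable lborel (\<lambda>u. \<integral>y. h y u \<partial>lborel)"
    using lborel_pair.integrable_snd[OF hint] by simp
  have "(\<integral>u. (\<integral>y. h y u \<partial>lborel) \<partial>lborel) = (\<integral>y. (\<integral>u. h y u \<partial>lborel) \<partial>lborel)"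
    using lborel_pair.Fubini_integral[OF hint] by simp
  also have "\<dots> = (\<integral>y. (\<integral>a. K y a * \<phi> (y + a) * (H y * H a) \<partial>lborel) \<partial>lborel)"
  proof -
    have "(\<integral>u. h y u \<partial>lborel) = (\<integral>a. K y a * \<phi> (y + a) * (H y * H a) \<partial>lborel)" for y
      using shift[of "h y" y] by (simp add: h_shift)
    then show ?thesis by simp
  qed
  also have "\<dots> = Q (\<lambda>a b. K a b * \<phi> (a + b))" by (rule Q_iterated[OF i1])
  finally have gain: "(\<integral>u. (\<integral>y. h y u \<partial>lborel) \<partial>lborel) = Q (\<lambda>a b. K a b * \<phi> (a + b))" .
  have eq: "\<phi> u * C u = 1/2 * (\<integral>y. h y u \<partial>lborel) - (\<integral>y. K u y * \<phi> u * (H u * H y) \<partial>lborel)" for u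
  proof -
    have "(\<integral>y. h y u \<partial>lborel) = \<phi> u * (\<integral>y. K (u - y) y * H (u - y) * H y \<partial>lborel)"
      unfolding h_def by simp
    moreover have "(\<integral>y. K u y * \<phi> u * (H u * H y) \<partial>lborel) = (\<integral>y. (\<phi> u * H u) * (K u y * H y) \<partial>lborel)"
      by (simp add: mult_ac)
    then have "(\<integral>y. K u y * \<phi> u * (H u * H y) \<partial>lborel) = (\<phi> u * H u) * (\<integral>y. K u y * H y \<partial>lborel)"
      by (simp only: integral_mult_right_zero)
    ultimately show ?thesis unfolding C_def by (simp add: algebra_simps)
  qed
  show "integrable lborel (\<lambda>u. \<phi> u * C u)"
    unfolding eq by (intro Bochner_Integration.integrable_diff integrable_mult_right gain_i Q_iterated(1)[OF i2])
  have "(\<integral>u. \<phi> u * C u \<partial>lborel) = 1/2 * Q (\<lambda>a b. K a b * \<phi> (a + b)) - Q (\<lambda>a b. K a b * \<phi> a)"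
    unfolding eq gain[symmetric] Q_iterated(2)[OF i2, symmetric]
    by (subst Bochner_Integration.integral_diff)
       (auto intro!: integrable_mult_right gain_i Q_iterated(1)[OF i2])
  also have "Q (\<lambda>a b. K a b * \<phi> a) = 1/2 * (Q (\<lambda>a b. K a b * \<phi> a) + Q (\<lambda>a b. K a b * \<phi> b))"
  proof -
    have "Q (\<lambda>a b. K b a * \<phi> a) = Q (\<lambda>a b. K a b * \<phi> b)" by (rule Q_swap) measurable
    moreover have "(\<lambda>a b. K b a * \<phi> a) = (\<lambda>a b. K a b * \<phi> a)" by (intro ext) (simp only: K_sym)
    ultimately show ?thesis by simp
  qed
  also have "1/2 * Q (\<lambda>a b. K a b * \<phi> (a + b)) - 1/2 * (Q (\<lambda>a b. K a b * \<phi> a) + Q (\<lambda>a b. K a b * \<phi> b))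
    = 1/2 * (Q (\<lambda>a b. K a b * \<phi> (a + b)) - (Q (\<lambda>a b. K a b * \<phi> a) + Q (\<lambda>a b. K a b * \<phi> b)))" by (simp add: field_simps)
  also have "Q (\<lambda>a b. K a b * \<phi> (a + b)) - (Q (\<lambda>a b. K a b * \<phi> a) + Q (\<lambda>a b. K a b * \<phi> b)) =
     Q (\<lambda>a b. K a b * \<phi> (a + b) - (K a b * \<phi> a + K a b * \<phi> b))"
  proof -
    have "integrable (lborel \<Otimes>\<^sub>M lborel) (\<lambda>(a, b). (K a b * \<phi> a + K a b * \<phi> b) * (H a * H b))"
      using Bochner_Integration.integrable_add[OF i2 i3] by (simp add: case_prod_beta' distrib_right)
    then show ?thesis by (simp only: Q_add[OF i2 i3, symmetric] Q_diff[OF i1])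
  qed
  also have "(\<lambda>a b. K a b * \<phi> (a + b) - (K a b * \<phi> a + K a b * \<phi> b)) = (\<lambda>a b. K a b * (\<phi> (a + b) - \<phi> a - \<phi> b))"
    by (simp add: fun_eq_iff algebra_simps)
  finally show "(\<integral>u. \<phi> u * C u \<partial>lborel) = 1/2 * Q (\<lambda>a b. K a b * (\<phi> (a + b) - \<phi> a - \<phi> b))" .
qed

lemma C_integrable: "integrable lborel C" "integrable lborel (\<lambda>u. u * C u)"
  using weak_form(1)[of "\<lambda>_. 1" 1] weak_form(1)[of "\<lambda>u. u" 1] by auto

end

section \<open>Tail and density of a stationary solution\<close>

text \<open>
  A stationary solution, with the differential equation \<open>(x\<^sup>2 H)' = - x C\<close> in integrated form.
\<close>

locale coagulation_profile = coagulation_tail +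
  assumes tail: "AE x in lborel. 0 < x \<longrightarrow> x\<^sup>2 * H x = (\<integral>u. indicator {x<..} u * (u * C u) \<partial>lborel)"
begin

definition N :: "real \<Rightarrow> real" where "N x = (\<integral>y. indicator {x<..} y * H y \<partial>lborel)"

text \<open>
  The weak form of the equation is used with the test functions \<open>u \<mapsto> max 0 (u - x)\<close> and the indicator of
  \<open>u > x\<close>; \<open>B\<close> and \<open>J\<close> are the resulting collision brackets \<open>\<phi>(a + b) - \<phi>(a) - \<phi>(b)\<close>.
\<close>

definition B :: "real \<Rightarrow> real \<Rightarrow> real \<Rightarrow> real" where
  "B x a b = max 0 (a + b - x) - max 0 (a - x) - max 0 (b - x)"

definition J :: "real \<Rightarrow> real \<Rightarrow> real \<Rightarrow> real" where
  "J x a b = indicator {x<..} (a + b) - indicator {x<..} a - indicator {x<..} b"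

lemma ind_H_int: "A \<in> sets borel \<Longrightarrow> integrable lborel (\<lambda>y. indicator A y * H y)"
  using integrable_mult_indicator[of A lborel H] H_int by simp

lemma N_nonneg: "0 \<le> N x"
  unfolding N_def by (intro integral_nonneg_AE AE_I2) (simp add: H_nonneg)

lemma N_dec: "x \<le> y \<Longrightarrow> N y \<le> N x"
  unfolding N_def
  by (intro integral_mono ind_H_int mult_right_mono H_nonneg) (auto split: split_indicator)

lemma N_nonpos: "x \<le> 0 \<Longrightarrow> N x = N 0"
  unfolding N_def
  by (intro Bochner_Integration.integral_cong) (auto simp: H_zero split: split_indicator)

lemma N_0: "N 0 = (\<integral>y. H y \<partial>lborel)"
  unfolding N_def
  by (intro Bochner_Integration.integral_cong) (auto simp: H_zero split: split_indicator)

text \<open>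
  \<open>H(y)\<close> is the integral of \<open>u C(u) / y\<^sup>2\<close> over \<open>u > y\<close>; integrating over \<open>y > x\<close> and exchanging
  the order of integration produces the factor \<open>u (1/x - 1/u) = (u - x) / x\<close>.
\<close>

lemma N_moment:
  assumes x: "0 < x"
  shows "x * N x = (\<integral>u. max 0 (u - x) * C u \<partial>lborel)"
proof -
  define \<kappa> where "\<kappa> u = (if x < u then 1 / x - 1 / u else 0)" for u :: real
  note op = integral_open_interval_inverse_square[OF x]
  have C_meas[measurable]: "C \<in> borel_measurable borel"
    using C_integrable(1) by (auto dest: borel_measurable_integrable)
  define p where "p u y = indicator {x<..<u} y * (1 / y\<^sup>2) * (u * C u)" for u y
  have pn: "(\<integral>y. norm (p u y) \<partial>lborel) = \<kappa> u * \<bar>u * C u\<bar>" for u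
  proof -
    have "norm (p u y) = indicator {x<..<u} y * (1 / y\<^sup>2) * \<bar>u * C u\<bar>" for y
      by (simp add: p_def abs_mult)
    then show ?thesis by (simp only: integral_mult_left_zero op(2) \<kappa>_def)
  qed
  have p1: "(\<integral>y. p u y \<partial>lborel) = \<kappa> u * (u * C u)" for u
    unfolding p_def by (simp only: integral_mult_left_zero op(2) \<kappa>_def)
  have k: "0 \<le> \<kappa> u" "\<kappa> u \<le> 1 / x" for u using x by (auto simp: \<kappa>_def field_simps)
  have [measurable]: "\<kappa> \<in> borel_measurable borel" unfolding \<kappa>_def by measurable
  have pi: "integrable (lborel \<Otimes>\<^sub>M lborel) (\<lambda>(u, y). p u y)"
  proof (rule lborel_pair.Fubini_integrable)
    have "(\<lambda>(u, y). p u y) = (\<lambda>(u, y). (if x < y \<and> y < u then 1 else 0) * (1 / y\<^sup>2) * (u * C u))"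
      by (auto simp: p_def fun_eq_iff split: split_indicator)
    then show "(\<lambda>(u, y). p u y) \<in> borel_measurable (lborel \<Otimes>\<^sub>M lborel)" by simp
    have "integrable lborel (\<lambda>u. \<kappa> u * \<bar>u * C u\<bar>)"
    proof (rule Bochner_Integration.integrable_bound)
      show "integrable lborel (\<lambda>u. 1 / x * \<bar>u * C u\<bar>)" using C_integrable(2) by auto
      have "\<kappa> u * \<bar>u * C u\<bar> \<le> 1 / x * \<bar>u * C u\<bar>" for u
        by (rule mult_right_mono[OF k(2)]) simp
      then show "AE u in lborel. norm (\<kappa> u * \<bar>u * C u\<bar>) \<le> norm (1 / x * \<bar>u * C u\<bar>)"
        using k x by (intro AE_I2) (simp add: abs_mult)
    qed measurable
    then show "integrable lborel (\<lambda>u. \<integral>y. norm (case (u, y) of (u, y) \<Rightarrow> p u y) \<partial>lborel)" by (simp only: prod.case pn)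
    show "AE u in lborel. integrable lborel (\<lambda>y. case (u, y) of (u, y) \<Rightarrow> p u y)"
      unfolding p_def prod.case by (intro AE_I2 integrable_mult_left op(1))
  qed
  have "N x = (\<integral>y. (\<integral>u. p u y \<partial>lborel) \<partial>lborel)"
    unfolding N_def
  proof (rule integral_cong_AE)
    show "(\<lambda>y. indicator {x<..} y * H y) \<in> borel_measurable lborel" by measurable
    show "(\<lambda>y. \<integral>u. p u y \<partial>lborel) \<in> borel_measurable lborel"
      using lborel_pair.integrable_snd[OF pi] by (auto dest: borel_measurable_integrable)
    show "AE y in lborel. indicator {x<..} y * H y = (\<integral>u. p u y \<partial>lborel)"
      using tail
    proof eventually_elim
      case (elim y)
      show ?case
      proof (cases "x < y")
        case True
        then have y: "0 < y" using x by simp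
        have "(\<integral>u. p u y \<partial>lborel) = (\<integral>u. (1 / y\<^sup>2) * (indicator {y<..} u * (u * C u)) \<partial>lborel)"
          using True by (intro Bochner_Integration.integral_cong) (auto simp: p_def split: split_indicator)
        also have "\<dots> = (1 / y\<^sup>2) * (y\<^sup>2 * H y)" using elim y by (simp only: integral_mult_right_zero)
        finally show ?thesis using True y by simp
      next
        case False
        then have "p u y = 0" for u by (simp add: p_def)
        then show ?thesis using False by simp
      qed
    qed
  qed
  also have "\<dots> = (\<integral>u. (\<integral>y. p u y \<partial>lborel) \<partial>lborel)"
    using lborel_pair.Fubini_integral[OF pi] by simp
  also have "\<dots> = (\<integral>u. 1 / x * (max 0 (u - x) * C u) \<partial>lborel)"
    unfolding p1
  proof (intro Bochner_Integration.integral_cong refl)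
    fix u
    show "\<kappa> u * (u * C u) = 1 / x * (max 0 (u - x) * C u)"
    proof (cases "x < u")
      case True
      then have "\<kappa> u * u = 1 / x * max 0 (u - x)" using x by (simp add: \<kappa>_def field_simps)
      then show ?thesis by (metis mult.assoc)
    qed (simp add: \<kappa>_def)
  qed
  also have "\<dots> = 1 / x * (\<integral>u. max 0 (u - x) * C u \<partial>lborel)" by simp
  finally show ?thesis using x by simp
qed

lemma B_meas[measurable]: "(\<lambda>(a, b). B x a b) \<in> borel_measurable (borel \<Otimes>\<^sub>M borel)"
  unfolding B_def by measurable

lemma J_meas[measurable]: "(\<lambda>(a, b). J x a b) \<in> borel_measurable (borel \<Otimes>\<^sub>M borel)"
  unfolding J_def by measurable

lemma J_bound: "\<bar>J x a b\<bar> \<le> 2"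
  by (auto simp: J_def split: split_indicator)

lemma B_bounds: assumes "0 < x" "0 < a" "0 < b" shows "0 \<le> B x a b" "B x a b \<le> x"
  using assms by (auto simp: B_def max_def)

lemma B_abs: "\<bar>B x a b\<bar> \<le> (3 + 3 * \<bar>x\<bar>) * (1 + \<bar>a\<bar> + \<bar>b\<bar>)"
proof -
  have "\<bar>B x a b\<bar> \<le> 2 * \<bar>a\<bar> + 2 * \<bar>b\<bar> + 3 * \<bar>x\<bar>" by (simp add: B_def max_def abs_if)
  moreover have "0 \<le> \<bar>a\<bar> * \<bar>x\<bar>" "0 \<le> \<bar>b\<bar> * \<bar>x\<bar>" by simp_all
  moreover have "(3 + 3 * \<bar>x\<bar>) * (1 + \<bar>a\<bar> + \<bar>b\<bar>) =
      3 + 3 * \<bar>a\<bar> + 3 * \<bar>b\<bar> + 3 * \<bar>x\<bar> + 3 * (\<bar>a\<bar> * \<bar>x\<bar>) + 3 * (\<bar>b\<bar> * \<bar>x\<bar>)"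
    by (simp add: algebra_simps)
  ultimately show ?thesis by linarith
qed

lemma B_int: "integrable (lborel \<Otimes>\<^sub>M lborel) (\<lambda>(a, b). B x a b * (H a * H b))"
  by (rule Q_integrable[OF _ B_abs]) simp

lemma KB_int: "integrable (lborel \<Otimes>\<^sub>M lborel) (\<lambda>(a, b). (K a b * B x a b) * (H a * H b))"
proof (rule Q_integrable)
  show "(\<lambda>(a, b). K a b * B x a b) \<in> borel_measurable (lborel \<Otimes>\<^sub>M lborel)"
    unfolding B_def by measurable
  fix a b
  have "\<bar>K a b * B x a b\<bar> = K a b * \<bar>B x a b\<bar>" using K_bounds[of a b] by (simp add: abs_mult)
  also have "\<dots> \<le> 3 * ((3 + 3 * \<bar>x\<bar>) * (1 + \<bar>a\<bar> + \<bar>b\<bar>))" using K_bounds[of a b] B_abs by (intro mult_mono) auto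
  finally show "\<bar>K a b * B x a b\<bar> \<le> 3 * (3 + 3 * \<bar>x\<bar>) * (1 + \<bar>a\<bar> + \<bar>b\<bar>)" by (simp only: mult.assoc)
qed

lemma tail_identity: assumes x: "0 < x" shows "x * N x = 1/2 * Q (\<lambda>a b. K a b * B x a b)"
proof -
  have "(\<integral>u. max 0 (u - x) * C u \<partial>lborel) = 1/2 * Q (\<lambda>a b. K a b * (max 0 (a + b - x) - max 0 (a - x) - max 0 (b - x)))"
    using x by (intro weak_form(2)[where c=1]) auto
  then show ?thesis using N_moment[OF x] by (simp add: B_def)
qed

text \<open>
  Splits \<open>u = (u - x) + x\<close> under the tail integral and applies the weak form to both parts.
\<close>

lemma density_identity: "AE x in lborel. 0 < x \<longrightarrow> x * H x = N x + 1/2 * Q (\<lambda>a b. K a b * J x a b)"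
  using tail
proof eventually_elim
  case (elim x)
  show ?case
  proof
    assume x: "0 < x"
    have b1: "\<bar>max 0 (u - x)\<bar> \<le> 1 * (1 + \<bar>u\<bar>)" for u using x by auto
    have b2: "\<bar>indicat_real {x<..} u\<bar> \<le> 1 * (1 + \<bar>u\<bar>)" for u by (auto split: split_indicator)
    have i1: "integrable lborel (\<lambda>u. max 0 (u - x) * C u)" and i2: "integrable lborel (\<lambda>u. indicator {x<..} u * C u)"
      by (rule weak_form(1)[OF _ b1], simp, rule weak_form(1)[OF _ b2], simp)
    have "(\<integral>u. indicator {x<..} u * C u \<partial>lborel) = 1/2 * Q (\<lambda>a b. K a b * J x a b)"
      unfolding J_def by (rule weak_form(2)[OF _ b2]) simp
    moreover have "x * (x * H x) = (\<integral>u. max 0 (u - x) * C u + x * (indicator {x<..} u * C u) \<partial>lborel)"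
    proof -
      have "x * (x * H x) = (\<integral>u. indicator {x<..} u * (u * C u) \<partial>lborel)"
        using elim x by (simp add: power2_eq_square)
      also have "\<dots> = (\<integral>u. max 0 (u - x) * C u + x * (indicator {x<..} u * C u) \<partial>lborel)"
        by (intro Bochner_Integration.integral_cong) (auto simp: algebra_simps split: split_indicator)
      finally show ?thesis .
    qed
    then have "x * (x * H x) = x * N x + x * (\<integral>u. indicator {x<..} u * C u \<partial>lborel)"
      using i1 i2 by (simp add: N_moment[OF x])
    ultimately have "x * (x * H x) = x * (N x + 1/2 * Q (\<lambda>a b. K a b * J x a b))" by (simp add: distrib_left)
    then show "x * H x = N x + 1/2 * Q (\<lambda>a b. K a b * J x a b)" using x by simp
  qed
qed

lemma N_sequentially_continuous:
  assumes u: "u \<longlonglongrightarrow> x"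
  shows "(\<lambda>i. N (u i)) \<longlonglongrightarrow> N x"
  unfolding N_def
proof (rule integral_dominated_convergence[where w=H])
  show "AE y in lborel. (\<lambda>i. indicator {u i<..} y * H y) \<longlonglongrightarrow> indicator {x<..} y * H y"
    using AE_lborel_singleton[of x]
  proof eventually_elim
    case (elim y)
    have "\<forall>\<^sub>F i in sequentially. indicator {u i<..} y * H y = indicator {x<..} y * H y"
    proof (cases "x < y")
      case True
      from order_tendstoD(2)[OF u this] show ?thesis by eventually_elim (use True in auto)
    next
      case False
      then have "y < x" using elim by simp
      from order_tendstoD(1)[OF u this] show ?thesis by eventually_elim (use False in auto)
    qed
    then show ?case by (rule tendsto_eventually)
  qed
qed (auto simp: H_int H_nonneg split: split_indicator)

lemma N_tendsto_0: "(\<lambda>i. N (1 / real (Suc i))) \<longlonglongrightarrow> N 0"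
  by (rule N_sequentially_continuous) real_asymp

lemma N_continuous: "continuous_on A N"
  by (rule continuous_on_sequentiallyI) (rule N_sequentially_continuous)

text \<open>
  The balance of particle numbers, as the limit \<open>x \<rightarrow> 0\<close> of the tail identity divided by \<open>x\<close>: the bracket
  \<open>B x a b\<close> equals \<open>x\<close> as soon as \<open>x \<le> min a b\<close> and never exceeds \<open>x\<close>.
\<close>

lemma N_0_identity: "N 0 = 1/2 * Q K"
proof -
  let ?x = "\<lambda>i. 1 / real (Suc i)"
  have lim: "(\<lambda>i. Q (\<lambda>a b. K a b * B (?x i) a b / ?x i)) \<longlonglongrightarrow> Q K"
    unfolding Q_def
  proof (rule integral_dominated_convergence[where w="\<lambda>(a, b). 3 * (H a * H b)"])
    show "integrable (lborel \<Otimes>\<^sub>M lborel) (\<lambda>(a, b). 3 * (H a * H b))"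
      by (rule Q_integrable_bounded[where c=3]) auto
    show "(\<lambda>(a, b). K a b * (H a * H b)) \<in> borel_measurable (lborel \<Otimes>\<^sub>M lborel)" by measurable
    show "(\<lambda>(a, b). K a b * B (?x i) a b / ?x i * (H a * H b)) \<in> borel_measurable (lborel \<Otimes>\<^sub>M lborel)" for i
      unfolding B_def by measurable
    show "AE p in lborel \<Otimes>\<^sub>M lborel. norm (case p of (a, b) \<Rightarrow> K a b * B (?x i) a b / ?x i * (H a * H b)) \<le> (case p of (a, b) \<Rightarrow> 3 * (H a * H b))" for i
    proof (rule AE_I2, clarsimp simp: abs_mult H_nonneg simp del: of_nat_Suc)
      fix a b :: real
      show "\<bar>K a b\<bar> * \<bar>B (?x i) a b\<bar> * real (Suc i) * (H a * H b) \<le> 3 * (H a * H b)"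
      proof (cases "0 < a \<and> 0 < b")
        case True
        then have "\<bar>B (?x i) a b\<bar> \<le> ?x i" using B_bounds[of "?x i" a b] by simp
        then have "\<bar>K a b\<bar> * \<bar>B (?x i) a b\<bar> * real (Suc i) \<le> 3 * ?x i * real (Suc i)"
          using K_bounds[of a b] by (intro mult_mono) auto
        also have "3 * ?x i * real (Suc i) = 3" by (simp del: of_nat_Suc)
        finally have "\<bar>K a b\<bar> * \<bar>B (?x i) a b\<bar> * real (Suc i) \<le> 3" .
        then show ?thesis by (intro mult_right_mono) (auto simp: H_nonneg)
      next
        case False
        then have "H a = 0 \<or> H b = 0" using H_zero by (auto simp: not_less)
        then show ?thesis by auto
      qed
    qed
    show "AE p in lborel \<Otimes>\<^sub>M lborel. (\<lambda>i. case p of (a, b) \<Rightarrow> K a b * B (?x i) a b / ?x i * (H a * H b)) \<longlonglongrightarrow> (case p of (a, b) \<Rightarrow> K a b * (H a * H b))"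
    proof (rule AE_I2, clarsimp simp del: of_nat_Suc)
      fix a b :: real
      show "(\<lambda>i. K a b * B (?x i) a b * real (Suc i) * (H a * H b)) \<longlonglongrightarrow> K a b * (H a * H b)"
      proof (cases "0 < a \<and> 0 < b")
        case True
        have "(\<lambda>i. ?x i) \<longlonglongrightarrow> 0" by real_asymp
        then have "\<forall>\<^sub>F i in sequentially. ?x i < min a b" using True by (intro order_tendstoD) auto
        then have "\<forall>\<^sub>F i in sequentially. K a b * B (?x i) a b * real (Suc i) * (H a * H b) = K a b * (H a * H b)"
        proof eventually_elim
          case (elim i)
          then have "B (?x i) a b = ?x i" using True by (auto simp: B_def max_def)
          then show ?case by simp
        qed
        then show ?thesis by (rule tendsto_eventually)
      next
        case False
        then have "H a = 0 \<or> H b = 0" using H_zero by (auto simp: not_less)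
        then show ?thesis by auto
      qed
    qed
  qed
  have eq: "1/2 * Q (\<lambda>a b. K a b * B (?x i) a b / ?x i) = N (?x i)" for i
  proof -
    have "Q (\<lambda>a b. K a b * B (?x i) a b / ?x i) = 1 / ?x i * Q (\<lambda>a b. K a b * B (?x i) a b)"
      unfolding Q_mult[symmetric] by (simp add: mult_ac)
    then have "1/2 * Q (\<lambda>a b. K a b * B (?x i) a b / ?x i) = 1 / ?x i * (1/2 * Q (\<lambda>a b. K a b * B (?x i) a b))"
      by (simp only: mult.left_commute)
    also have "\<dots> = 1 / ?x i * (?x i * N (?x i))" 
      by (simp only: tail_identity[of "?x i", symmetric] zero_less_divide_1_iff of_nat_0_less_iff zero_less_Suc)
    also have "\<dots> = N (?x i)" by (simp del: of_nat_Suc)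
    finally show ?thesis .
  qed
  from tendsto_mult_left[OF lim, of "1/2"] have "(\<lambda>i. N (?x i)) \<longlonglongrightarrow> 1/2 * Q K" by (simp only: eq)
  with N_tendsto_0 show ?thesis by (rule LIMSEQ_unique)
qed

end

section \<open>The tail belongs to the class\<close>

context coagulation_profile begin

lemma N_borel[measurable]: "N \<in> borel_measurable borel"
  by (intro borel_measurable_continuous_onI N_continuous)

lemma ennreal_N: "ennreal (N x) = (\<integral>\<^sup>+y. ennreal (H y) * indicator {x<..} y \<partial>lborel)"
proof -
  have "(\<integral>\<^sup>+y. ennreal (indicator {x<..} y * H y) \<partial>lborel) = ennreal (N x)"
    unfolding N_def by (intro nn_integral_eq_integral ind_H_int AE_I2) (auto simp: H_nonneg)
  then show ?thesis by (simp add: ennreal_mult H_nonneg mult.commute ennreal_indicator)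
qed

lemma N_mass: "(\<integral>\<^sup>+x. ennreal (N x) * indicator {0..} x \<partial>lborel) = 1"
proof -
  have "(\<integral>\<^sup>+x. ennreal (N x) * indicator {0..} x \<partial>lborel) =
     (\<integral>\<^sup>+x. (\<integral>\<^sup>+y. ennreal (H y) * (if 0 \<le> x \<and> x < y then 1 else 0) \<partial>lborel) \<partial>lborel)"
    unfolding ennreal_N by (subst nn_integral_multc[symmetric]) (auto intro!: nn_integral_cong split: split_indicator)
  also have "\<dots> = (\<integral>\<^sup>+y. (\<integral>\<^sup>+x. ennreal (H y) * (if 0 \<le> x \<and> x < y then 1 else 0) \<partial>lborel) \<partial>lborel)"
    by (rule lborel_pair.Fubini') measurable
  also have "\<dots> = (\<integral>\<^sup>+y. ennreal (y * H y) \<partial>lborel)"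
  proof (intro nn_integral_cong)
    fix y :: real
    have "(\<integral>\<^sup>+x. ennreal (H y) * (if 0 \<le> x \<and> x < y then 1 else 0) \<partial>lborel) =
      (\<integral>\<^sup>+x. ennreal (H y) * indicator {0..<y} x \<partial>lborel)"
      by (intro nn_integral_cong) (auto split: split_indicator)
    also have "\<dots> = ennreal (H y) * emeasure lborel {0..<y}" by (subst nn_integral_cmult_indicator) auto
    also have "\<dots> = ennreal (y * H y)"
      by (cases "0 \<le> y") (auto simp: H_zero ennreal_mult H_nonneg mult.commute)
    finally show "(\<integral>\<^sup>+x. ennreal (H y) * (if 0 \<le> x \<and> x < y then 1 else 0) \<partial>lborel) = ennreal (y * H y)" .
  qed
  also have "\<dots> = ennreal (\<integral>y. y * H y \<partial>lborel)"
  proof (intro nn_integral_eq_integral xH_int AE_I2)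
    fix y show "0 \<le> y * H y" using H_nonneg[of y] H_zero[of y] by (cases "0 \<le> y") auto
  qed
  finally show ?thesis by (simp add: H_mass)
qed

lemma Q_nn: 
  assumes i: "integrable (lborel \<Otimes>\<^sub>M lborel) (\<lambda>(a, b). f a b * (H a * H b))"
    and f: "\<And>a b. 0 < a \<Longrightarrow> 0 < b \<Longrightarrow> 0 \<le> f a b"
  shows "0 \<le> Q f" "ennreal (Q f) = (\<integral>\<^sup>+a. (\<integral>\<^sup>+b. ennreal (f a b * (H a * H b)) \<partial>lborel) \<partial>lborel)"
proof -
  have nn: "0 \<le> (case p of (a, b) \<Rightarrow> f a b * (H a * H b))" for p
  proof -
    obtain a b where p: "p = (a, b)" by (cases p)
    show ?thesis
    proof (cases "0 < a \<and> 0 < b")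
      case True
      then show ?thesis using f H_nonneg by (auto simp: p)
    next
      case False
      then have "H a = 0 \<or> H b = 0" using H_zero by (auto simp: not_less)
      then show ?thesis by (auto simp: p)
    qed
  qed
  show "0 \<le> Q f" unfolding Q_def by (intro integral_nonneg_AE AE_I2 nn)
  have "ennreal (Q f) = (\<integral>\<^sup>+p. ennreal (case p of (a, b) \<Rightarrow> f a b * (H a * H b)) \<partial>(lborel \<Otimes>\<^sub>M lborel))"
    unfolding Q_def by (rule nn_integral_eq_integral[OF i AE_I2[OF nn], symmetric])
  also have "\<dots> = (\<integral>\<^sup>+a. (\<integral>\<^sup>+b. ennreal (f a b * (H a * H b)) \<partial>lborel) \<partial>lborel)"
    using i by (subst lborel.nn_integral_fst[symmetric]) (auto dest: borel_measurable_integrable)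
  finally show "ennreal (Q f) = (\<integral>\<^sup>+a. (\<integral>\<^sup>+b. ennreal (f a b * (H a * H b)) \<partial>lborel) \<partial>lborel)" .
qed

text \<open>
  For positive \<open>a\<close> and \<open>b\<close> the bracket \<open>B x a b\<close> is the length of the set of \<open>y\<close> between \<open>0\<close> and \<open>x\<close> with \<open>x - y < a\<close>
  and \<open>y < b\<close>; integrating first over \<open>a\<close> and \<open>b\<close> gives \<open>N(x - y) N(y)\<close>.
\<close>

lemma conv_N: assumes x: "0 < x" shows "conv N N x = Q (B x)"
proof -
  let ?i = "\<lambda>y a b. (if 0 < y \<and> y < x \<and> x - y < a \<and> y < b then 1 else 0) :: ennreal"
  have c: "continuous_on {0..x} (\<lambda>y. N (x - y) * N y)"
    by (intro continuous_on_mult N_continuous continuous_on_compose2[OF N_continuous[of UNIV]] continuous_intros) auto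
  then have "((\<lambda>y. N (x - y) * N y) has_integral conv N N x) {0..x}"
    unfolding conv_def by (intro integrable_integral integrable_continuous_interval)
  then have "ennreal (conv N N x) = (\<integral>\<^sup>+y. ennreal (N (x - y) * N y) * indicator {0..x} y \<partial>lborel)"
    by (intro nn_integral_has_integral_lebesgue'[symmetric]) (auto intro!: mult_nonneg_nonneg N_nonneg)
  also have "\<dots> = (\<integral>\<^sup>+y. (\<integral>\<^sup>+a. (\<integral>\<^sup>+b. ennreal (H a * H b) * ?i y a b \<partial>lborel) \<partial>lborel) \<partial>lborel)"
  proof (rule nn_integral_cong_AE)
    show "AE y in lborel. ennreal (N (x - y) * N y) * indicator {0..x} y = (\<integral>\<^sup>+a. (\<integral>\<^sup>+b. ennreal (H a * H b) * ?i y a b \<partial>lborel) \<partial>lborel)"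
      using AE_lborel_singleton[of 0] AE_lborel_singleton[of x]
    proof eventually_elim
      case (elim y)
      have "(\<integral>\<^sup>+a. (\<integral>\<^sup>+b. ennreal (H a * H b) * ?i y a b \<partial>lborel) \<partial>lborel) =
        (\<integral>\<^sup>+a. (\<integral>\<^sup>+b. (ennreal (H a) * indicator {x-y<..} a * indicator {0<..<x} y) * (ennreal (H b) * indicator {y<..} b) \<partial>lborel) \<partial>lborel)"
        by (intro nn_integral_cong) (auto simp: ennreal_mult H_nonneg split: split_indicator)
      also have "\<dots> = (\<integral>\<^sup>+a. (ennreal (H a) * indicator {x-y<..} a) * (indicator {0<..<x} y * ennreal (N y)) \<partial>lborel)"
        by (subst nn_integral_cmult) (auto simp: ennreal_N mult_ac)
      also have "\<dots> = ennreal (N (x - y)) * (indicator {0<..<x} y * ennreal (N y))"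
        by (subst nn_integral_multc) (auto simp: ennreal_N)
      also have "\<dots> = ennreal (N (x - y) * N y) * indicator {0..x} y"
        using elim by (auto simp: ennreal_mult N_nonneg split: split_indicator)
      finally show ?case by simp
    qed
  qed
  also have "\<dots> = (\<integral>\<^sup>+a. (\<integral>\<^sup>+y. (\<integral>\<^sup>+b. ennreal (H a * H b) * ?i y a b \<partial>lborel) \<partial>lborel) \<partial>lborel)"
    by (rule lborel_pair.Fubini') measurable
  also have "\<dots> = (\<integral>\<^sup>+a. (\<integral>\<^sup>+b. (\<integral>\<^sup>+y. ennreal (H a * H b) * ?i y a b \<partial>lborel) \<partial>lborel) \<partial>lborel)"
    by (intro nn_integral_cong lborel_pair.Fubini') measurable
  also have "\<dots> = (\<integral>\<^sup>+a. (\<integral>\<^sup>+b. ennreal (B x a b * (H a * H b)) \<partial>lborel) \<partial>lborel)"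
  proof (intro nn_integral_cong)
    fix a b :: real
    show "(\<integral>\<^sup>+y. ennreal (H a * H b) * ?i y a b \<partial>lborel) = ennreal (B x a b * (H a * H b))"
    proof (cases "0 < a \<and> 0 < b")
      case True
      define l r where "l = max 0 (x - a)" and "r = min x b"
      have "(\<integral>\<^sup>+y. ennreal (H a * H b) * ?i y a b \<partial>lborel) = (\<integral>\<^sup>+y. ennreal (H a * H b) * indicator {l<..<r} y \<partial>lborel)"
        by (intro nn_integral_cong) (auto simp: l_def r_def split: split_indicator)
      also have "\<dots> = ennreal (H a * H b) * emeasure lborel {l<..<r}" by (subst nn_integral_cmult_indicator) auto
      also have "emeasure lborel {l<..<r} = ennreal (max 0 (r - l))"
        by (cases "l \<le> r") (auto simp: max_def)
      also have "max 0 (r - l) = B x a b"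
        using True x by (auto simp: l_def r_def B_def max_def min_def)
      also have "ennreal (H a * H b) * ennreal (B x a b) = ennreal (B x a b * (H a * H b))"
        using B_bounds[OF x, of a b] True by (subst ennreal_mult[symmetric]) (auto simp: H_nonneg mult.commute)
      finally show ?thesis .
    next
      case False
      then have "H a = 0 \<or> H b = 0" using H_zero by (auto simp: not_less)
      then show ?thesis by auto
    qed
  qed
  also have "\<dots> = ennreal (Q (B x))"
    using x by (intro Q_nn(2)[symmetric] B_int B_bounds)
  finally have "ennreal (conv N N x) = ennreal (Q (B x))" .
  moreover have "0 \<le> conv N N x"
    unfolding conv_def by (intro integral_nonneg integrable_continuous_interval c) (auto simp: N_nonneg)
  moreover have "0 \<le> Q (B x)" using x by (intro Q_nn(1) B_int B_bounds)
  ultimately show ?thesis by simp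
qed

text \<open>
  Since the bracket is nonnegative, bounding the kernel between \<open>2\<close> and \<open>2 + \<epsilon>\<close> in the tail identity
  suffices. Unit mass of the tail is unit first moment of the profile.
\<close>

lemma near_exponential_N: "near_exponential N \<epsilon>"
proof
  show "continuous_on {0..} N" by (rule N_continuous)
  show "(\<integral>\<^sup>+x. ennreal (N x) * indicator {0..} x \<partial>lborel) = 1" by (rule N_mass)
  have QB: "conv N N x \<le> x * N x \<and> x * N x \<le> (1 + \<epsilon> / 2) * conv N N x" if x: "0 < x" for x
  proof -
    have 1: "Q (\<lambda>a b. 2 * B x a b) \<le> Q (\<lambda>a b. K a b * B x a b)"
    proof (rule Q_mono)
      show "integrable (lborel \<Otimes>\<^sub>M lborel) (\<lambda>(a, b). 2 * B x a b * (H a * H b))"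
        using integrable_mult_right[OF B_int, of 2 x] by (simp add: case_prod_beta' mult.assoc)
      show "2 * B x a b \<le> K a b * B x a b" if "0 < a" "0 < b" for a b
        using K_bounds[of a b] B_bounds[OF x that] by (intro mult_right_mono) auto
    qed (rule KB_int)
    have 2: "Q (\<lambda>a b. K a b * B x a b) \<le> Q (\<lambda>a b. (2 + \<epsilon>) * B x a b)"
    proof (rule Q_mono)
      show "integrable (lborel \<Otimes>\<^sub>M lborel) (\<lambda>(a, b). (2 + \<epsilon>) * B x a b * (H a * H b))"
        using integrable_mult_right[OF B_int, of "2 + \<epsilon>" x] by (simp add: case_prod_beta' mult.assoc)
      have "K a b \<le> 2 + \<epsilon>" for a b
        using eps w_bounds[of a b] mult_left_mono[of "w a b" 1 \<epsilon>] by (simp add: K_def)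
      then show "K a b * B x a b \<le> (2 + \<epsilon>) * B x a b" if "0 < a" "0 < b" for a b
        using B_bounds[OF x that] by (intro mult_right_mono) auto
    qed (rule KB_int)
    show ?thesis
      using 1 2 unfolding Q_mult conv_N[OF x] tail_identity[OF x] by (simp add: field_simps)
  qed
  show "conv N N x \<le> x * N x" "x * N x \<le> (1 + \<epsilon> / 2) * conv N N x" if "0 \<le> x" for x
    using QB[of x] that by (cases "x = 0"; simp add: conv_def)+
qed (auto simp: N_dec N_nonneg eps)

sublocale NE: near_exponential N \<epsilon> by (rule near_exponential_N)

lemma N_le_1: "N x \<le> 1"
proof -
  have "N x \<le> N (min x 0)" by (rule N_dec) simp
  also have "\<dots> = N 0" by (rule N_nonpos) simp
  also have "\<dots> \<le> 1" by (rule NE.le_one) simp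
  finally show ?thesis .
qed

lemma N_le_N0: "N x \<le> N 0"
  using N_dec[of 0 x] N_nonpos[of x] by (cases "0 \<le> x") auto

text \<open>
  The convolution of the density with its tail. For \<open>H = exp (- x)\<close> it is \<open>x exp (- x)\<close>.
\<close>

definition HN :: "real \<Rightarrow> real" where
  "HN x = (\<integral>y. indicator {0..x} y * (H y * N (x - y)) \<partial>lborel)"

lemma ind_mass: "(\<integral>a. indicator {x<..} a * H a \<partial>lborel) = N x" by (simp add: N_def)

lemma Q_left: assumes "A \<in> sets borel" shows "Q (\<lambda>a b. indicator A a) = (\<integral>a. indicator A a * H a \<partial>lborel) * N 0"
  using Q_product[of "indicator A" "\<lambda>_. 1"] ind_H_int[OF assms] H_int by (simp add: N_0)

lemma Q_right: assumes "A \<in> sets borel" shows "Q (\<lambda>a b. indicator A b) = (\<integral>a. indicator A a * H a \<partial>lborel) * N 0"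
  using Q_product[of "\<lambda>_. 1" "indicator A"] ind_H_int[OF assms] H_int by (simp add: N_0 mult.commute)

lemma Q_int_ind:
  assumes "A \<in> sets borel"
  shows "integrable (lborel \<Otimes>\<^sub>M lborel) (\<lambda>(a, b). indicator A a * (H a * H b))"
    "integrable (lborel \<Otimes>\<^sub>M lborel) (\<lambda>(a, b). indicator A b * (H a * H b))"
    "integrable (lborel \<Otimes>\<^sub>M lborel) (\<lambda>(a, b). indicator A (a + b) * (H a * H b))"
proof -
  note [measurable] = assms
  show "integrable (lborel \<Otimes>\<^sub>M lborel) (\<lambda>(a, b). indicator A a * (H a * H b))"
    by (rule Q_integrable_bounded[where c=1]) (auto split: split_indicator)
  show "integrable (lborel \<Otimes>\<^sub>M lborel) (\<lambda>(a, b). indicator A b * (H a * H b))"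
    by (rule Q_integrable_bounded[where c=1]) (auto split: split_indicator)
  show "integrable (lborel \<Otimes>\<^sub>M lborel) (\<lambda>(a, b). indicator A (a + b) * (H a * H b))"
    by (rule Q_integrable_bounded[where c=1]) (auto split: split_indicator)
qed

lemma HN_int: "integrable lborel (\<lambda>y. indicator {0..x} y * (H y * N (x - y)))"
proof (rule Bochner_Integration.integrable_bound[OF H_int])
  show "AE y in lborel. norm (indicator {0..x} y * (H y * N (x - y))) \<le> norm (H y)"
    using N_nonneg N_le_1 H_nonneg by (intro AE_I2) (auto simp: abs_mult mult_left_le split: split_indicator)
qed measurable

lemma Q_sum_exceeds: assumes x: "0 < x" shows "Q (\<lambda>a b. indicator {x<..} (a + b)) = HN x + N 0 * N x"
proof -
  have "Q (\<lambda>a b. indicator {x<..} (a + b)) = (\<integral>a. (\<integral>b. indicator {x<..} (a + b) * (H a * H b) \<partial>lborel) \<partial>lborel)"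
    using Q_iterated(2)[OF Q_int_ind(3)] by simp
  also have "\<dots> = (\<integral>a. indicator {0..x} a * (H a * N (x - a)) + N 0 * (indicator {x<..} a * H a) \<partial>lborel)"
  proof (intro Bochner_Integration.integral_cong refl)
    fix a
    have "(\<integral>b. indicator {x<..} (a + b) * (H a * H b) \<partial>lborel) = (\<integral>b. H a * (indicator {x-a<..} b * H b) \<partial>lborel)"
      by (intro Bochner_Integration.integral_cong) (auto split: split_indicator)
    also have "\<dots> = H a * N (x - a)" by (simp add: N_def)
    also have "\<dots> = indicator {0..x} a * (H a * N (x - a)) + N 0 * (indicator {x<..} a * H a)"
      using N_nonpos[of "x - a"] H_zero[of a] x by (auto simp: not_le split: split_indicator)
    finally show "(\<integral>b. indicator {x<..} (a + b) * (H a * H b) \<partial>lborel) = indicator {0..x} a * (H a * N (x - a)) + N 0 * (indicator {x<..} a * H a)" .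
  qed
  also have "\<dots> = HN x + N 0 * N x"
    unfolding HN_def N_def[of x]
    by (subst Bochner_Integration.integral_add) (auto intro!: HN_int ind_H_int integrable_mult_right)
  finally show ?thesis .
qed

lemma w_int:
  assumes [measurable]: "(\<lambda>(a, b). f a b) \<in> borel_measurable (borel \<Otimes>\<^sub>M borel)" and f: "\<And>a b. \<bar>f a b\<bar> \<le> c"
  shows "integrable (lborel \<Otimes>\<^sub>M lborel) (\<lambda>(a, b). (w a b * f a b) * (H a * H b))"
proof (rule Q_integrable_bounded)
  show "(\<lambda>(a, b). w a b * f a b) \<in> borel_measurable (lborel \<Otimes>\<^sub>M lborel)" by measurable
  fix a b
  have "w a b * \<bar>f a b\<bar> \<le> 1 * c" using w_bounds f[of a b] by (intro mult_mono) auto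
  then show "\<bar>w a b * f a b\<bar> \<le> c" using w_bounds[of a b] by (simp add: abs_mult)
qed

lemma Q_J: assumes "0 < x" shows "Q (J x) = HN x - N 0 * N x"
proof -
  have A: "{x<..} \<in> sets borel" by simp
  note i = Q_int_ind[OF A]
  have i': "integrable (lborel \<Otimes>\<^sub>M lborel) (\<lambda>(a, b). (indicator {x<..} (a + b) - indicator {x<..} a) * (H a * H b))"
    using Bochner_Integration.integrable_diff[OF i(3) i(1)] by (simp add: case_prod_beta' left_diff_distrib)
  have "Q (J x) = Q (\<lambda>a b. indicator {x<..} (a + b) - indicator {x<..} a) - Q (\<lambda>a b. indicator {x<..} b)"
    unfolding Q_diff[OF i' i(2), symmetric] J_def ..
  also have "Q (\<lambda>a b. indicator {x<..} (a + b) - indicator {x<..} a) = Q (\<lambda>a b. indicator {x<..} (a + b)) - Q (\<lambda>a b. indicator {x<..} a)"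
    by (rule Q_diff[OF i(3) i(1)])
  finally show ?thesis
    using Q_left[OF A, unfolded ind_mass] Q_right[OF A, unfolded ind_mass] Q_sum_exceeds[OF assms]
    by (simp only:) simp
qed

lemma Q_K:
  assumes [measurable]: "(\<lambda>(a, b). f a b) \<in> borel_measurable (borel \<Otimes>\<^sub>M borel)" and f: "\<And>a b. \<bar>f a b\<bar> \<le> c"
  shows "1/2 * Q (\<lambda>a b. K a b * f a b) = Q f + \<epsilon>/2 * Q (\<lambda>a b. w a b * f a b)"
proof -
  have i: "integrable (lborel \<Otimes>\<^sub>M lborel) (\<lambda>(a, b). f a b * (H a * H b))"
    using f by (intro Q_integrable_bounded[where c=c]) auto
  have i1: "integrable (lborel \<Otimes>\<^sub>M lborel) (\<lambda>(a, b). 2 * f a b * (H a * H b))"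
    using integrable_mult_right[OF i, of 2] by (simp add: case_prod_beta' mult.assoc)
  have i2: "integrable (lborel \<Otimes>\<^sub>M lborel) (\<lambda>(a, b). \<epsilon> * (w a b * f a b) * (H a * H b))"
    using integrable_mult_right[OF w_int[OF assms], of \<epsilon>] by (simp add: case_prod_beta' mult.assoc)
  have "Q (\<lambda>a b. K a b * f a b) = Q (\<lambda>a b. 2 * f a b + \<epsilon> * (w a b * f a b))"
    by (simp add: K_def algebra_simps)
  also have "\<dots> = 2 * Q f + \<epsilon> * Q (\<lambda>a b. w a b * f a b)"
    unfolding Q_add[OF i1 i2] Q_mult ..
  finally show ?thesis by simp
qed

lemma N_0_bounds: "0 < N 0" "0 \<le> 1 - N 0" "1 - N 0 \<le> \<epsilon>/2"
  and N_0_w: "N 0 * (1 - N 0) = \<epsilon>/2 * Q (\<lambda>a b. w a b)"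
proof -
  show le: "0 \<le> 1 - N 0" using N_le_1[of 0] by simp
  show pos: "0 < N 0"
  proof (rule ccontr)
    assume "\<not> 0 < N 0"
    then have "N x = 0" for x using N_nonneg[of x] N_le_N0[of x] N_nonneg[of 0] by linarith
    then show False using N_mass by simp
  qed
  have m: "(\<lambda>(a, b). 1::real) \<in> borel_measurable (borel \<Otimes>\<^sub>M borel)" by simp
  have one: "Q (\<lambda>a b. 1) = N 0 * N 0" using Q_product[of "\<lambda>_. 1" "\<lambda>_. 1"] H_int by (simp add: N_0)
  have "N 0 = N 0 * N 0 + \<epsilon>/2 * Q (\<lambda>a b. w a b * 1)"
  proof -
    have k: "1/2 * Q (\<lambda>a b. K a b * 1) = N 0" using N_0_identity by simp
    show ?thesis using Q_K[OF m, of 1] unfolding k one by simp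
  qed
  then show *: "N 0 * (1 - N 0) = \<epsilon>/2 * Q (\<lambda>a b. w a b)" by (simp add: algebra_simps)
  have "Q (\<lambda>a b. w a b) \<le> Q (\<lambda>a b. 1)"
    using w_int[OF m, of 1] Q_integrable_bounded[of "\<lambda>a b. 1" 1] w_bounds by (intro Q_mono) auto
  then have "N 0 * (1 - N 0) \<le> \<epsilon>/2 * (N 0 * N 0)" unfolding * one using eps by (intro mult_left_mono) auto
  then have "N 0 * (1 - N 0) \<le> N 0 * (\<epsilon>/2 * N 0)" by (simp add: mult_ac)
  then have "1 - N 0 \<le> \<epsilon>/2 * N 0" using pos by simp
  also have "\<dots> \<le> \<epsilon>/2 * 1" using le eps by (intro mult_left_mono) auto
  finally show "1 - N 0 \<le> \<epsilon>/2" by simp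
qed

lemma compl_mass: "(\<integral>a. indicator {0..x} a * H a \<partial>lborel) = N 0 - N x"
proof -
  have "N 0 - N x = (\<integral>a. H a - indicator {x<..} a * H a \<partial>lborel)"
    unfolding N_0 N_def[of x] by (intro Bochner_Integration.integral_diff[symmetric] H_int ind_H_int) auto
  also have "\<dots> = (\<integral>a. indicator {0..x} a * H a \<partial>lborel)"
    using H_zero by (intro Bochner_Integration.integral_cong) (auto split: split_indicator)
  finally show ?thesis by simp
qed

text \<open>
  For the constant kernel \<open>2\<close> the density satisfies \<open>x H = H * N\<close> exactly. The first bound on the error is used
  near zero, the second one far away. They come from two ways of grouping the same terms: at infinity the
  collision bracket \<open>J\<close> itself is supported on large particles, whereas near zero it tends to \<open>-1\<close> and
  this limit cancels against \<open>N 0 (1 - N 0)\<close> by the balance of particle numbers.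
\<close>

lemma density_error:
  "AE x in lborel. 0 < x \<longrightarrow> \<bar>x * H x - HN x\<bar> \<le> 2 * \<epsilon> * (N 0 - N x) \<and> \<bar>x * H x - HN x\<bar> \<le> 2 * \<epsilon> * N (x / 2)"
  using density_identity
proof eventually_elim
  case (elim x)
  show ?case
  proof
    assume x: "0 < x"
    define T where "T = Q (\<lambda>a b. w a b * J x a b)"
    have "x * H x = N x + (HN x - N 0 * N x) + \<epsilon>/2 * T"
      using elim x Q_K[OF J_meas J_bound] Q_J[OF x] by (simp add: T_def)
    then have e: "x * H x - HN x = N x * (1 - N 0) + \<epsilon>/2 * T" by (simp add: algebra_simps)
    have wJ: "integrable (lborel \<Otimes>\<^sub>M lborel) (\<lambda>(a, b). (w a b * J x a b) * (H a * H b))"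
      by (rule w_int[OF J_meas J_bound])
    have wi: "integrable (lborel \<Otimes>\<^sub>M lborel) (\<lambda>(a, b). w a b * (H a * H b))"
      using w_int[of "\<lambda>a b. 1" 1] by simp
    have A: "{x/2<..} \<in> sets borel" "{..x} \<in> sets borel" by auto
    have U: "Q (\<lambda>a b. indicator A a + indicator A b) = 2 * N 0 * (\<integral>a. indicator A a * H a \<partial>lborel)"
      and Ui: "integrable (lborel \<Otimes>\<^sub>M lborel) (\<lambda>(a, b). (indicator A a + indicator A b) * (H a * H b))"
      if "A \<in> sets borel" for A
    proof -
      show "Q (\<lambda>a b. indicator A a + indicator A b) = 2 * N 0 * (\<integral>a. indicator A a * H a \<partial>lborel)"
        using Q_add[OF Q_int_ind(1,2)[OF that]] Q_left[OF that] Q_right[OF that] by simp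
      show "integrable (lborel \<Otimes>\<^sub>M lborel) (\<lambda>(a, b). (indicator A a + indicator A b) * (H a * H b))"
        using Bochner_Integration.integrable_add[OF Q_int_ind(1,2)[OF that]] by (simp add: case_prod_beta' distrib_right)
    qed
    have "T \<le> 2 * N 0 * N (x/2)" and "- T \<le> 2 * N 0 * N (x/2)"
    proof -
      have J: "\<bar>J x a b\<bar> \<le> indicator {x/2<..} a + indicator {x/2<..} b" if "0 < a" "0 < b" for a b
        using that by (auto simp: J_def split: split_indicator)
      have wJ': "\<bar>w a b * J x a b\<bar> \<le> indicator {x/2<..} a + indicator {x/2<..} b" if "0 < a" "0 < b" for a b
      proof -
        have "w a b * \<bar>J x a b\<bar> \<le> 1 * (indicator {x/2<..} a + indicator {x/2<..} b)"
          using w_bounds J[OF that] by (intro mult_mono) auto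
        then show ?thesis using w_bounds[of a b] by (simp add: abs_mult)
      qed
      have "T \<le> Q (\<lambda>a b. indicator {x/2<..} a + indicator {x/2<..} b)"
        unfolding T_def using wJ' by (intro Q_mono wJ Ui[OF A(1)]) (simp add: abs_le_iff)
      then show "T \<le> 2 * N 0 * N (x/2)" unfolding U[OF A(1)] ind_mass .
      have "(-1) * T \<le> Q (\<lambda>a b. indicator {x/2<..} a + indicator {x/2<..} b)"
        unfolding T_def Q_mult[symmetric]
      proof (intro Q_mono Ui[OF A(1)])
        show "integrable (lborel \<Otimes>\<^sub>M lborel) (\<lambda>(a, b). - 1 * (w a b * J x a b) * (H a * H b))"
          using integrable_mult_right[OF wJ, of "-1"] by (simp add: case_prod_beta' mult.assoc)
      qed (use wJ' in \<open>simp add: abs_le_iff\<close>)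
      then show "- T \<le> 2 * N 0 * N (x/2)" unfolding U[OF A(1)] ind_mass by simp
    qed
    moreover have "2 * N 0 * N (x/2) \<le> 2 * 1 * N (x/2)"
      using N_le_1[of 0] N_nonneg[of "x/2"] by (intro mult_right_mono mult_left_mono) auto
    ultimately have T2: "\<bar>T\<bar> \<le> 2 * N (x/2)" by (simp add: abs_le_iff)
    have "\<bar>x * H x - HN x\<bar> \<le> N x * (1 - N 0) + \<epsilon>/2 * \<bar>T\<bar>"
      unfolding e using N_0_bounds N_nonneg[of x] eps by (intro order_trans[OF abs_triangle_ineq]) (simp add: abs_mult)
    also have "\<dots> \<le> N (x/2) * (\<epsilon>/2) + \<epsilon>/2 * (2 * N (x/2))"
      using N_0_bounds T2 eps x N_nonneg by (intro add_mono mult_mono mult_left_mono N_dec) auto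
    also have "\<dots> = 3/2 * (\<epsilon> * N (x/2))" by simp
    also have "\<dots> \<le> 2 * (\<epsilon> * N (x/2))" using eps N_nonneg[of "x/2"] by (intro mult_right_mono) auto
    finally have far: "\<bar>x * H x - HN x\<bar> \<le> 2 * \<epsilon> * N (x/2)" by simp
    define D where "D = N 0 - N x"
    have D: "0 \<le> D" using N_le_N0[of x] by (simp add: D_def)
    have compl: "(\<integral>a. indicator {..x} a * H a \<partial>lborel) = D"
    proof -
      have "(\<integral>a. indicator {..x} a * H a \<partial>lborel) = (\<integral>a. indicator {0..x} a * H a \<partial>lborel)"
        using H_zero by (intro Bochner_Integration.integral_cong) (auto split: split_indicator)
      then show ?thesis by (simp add: compl_mass D_def)
    qed
    \<comment> \<open>Adding the balance of particle numbers replaces the bracket \<open>J\<close> by \<open>1 + J\<close>, which vanishes for large sizes.\<close>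
    define T' where "T' = Q (\<lambda>a b. w a b + w a b * J x a b)"
    have T': "T' = Q (\<lambda>a b. w a b) + T" unfolding T'_def T_def by (rule Q_add[OF wi wJ])
    have T'i: "integrable (lborel \<Otimes>\<^sub>M lborel) (\<lambda>(a, b). (w a b + w a b * J x a b) * (H a * H b))"
      using Bochner_Integration.integrable_add[OF wi wJ] by (simp add: case_prod_beta' distrib_right)
    have J1: "0 \<le> 1 + J x a b \<and> 1 + J x a b \<le> indicator {..x} a + indicator {..x} b" if "0 < a" "0 < b" for a b
      using that by (auto simp: J_def split: split_indicator)
    have "T' \<le> Q (\<lambda>a b. indicator {..x} a + indicator {..x} b)"
      unfolding T'_def
    proof (intro Q_mono T'i Ui A(2))
      fix a b :: real assume ab: "0 < a" "0 < b"
      have "w a b * (1 + J x a b) \<le> 1 * (indicator {..x} a + indicator {..x} b)"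
        using w_bounds J1[OF ab] by (intro mult_mono) auto
      then show "w a b + w a b * J x a b \<le> indicator {..x} a + indicator {..x} b" by (simp add: algebra_simps)
    qed
    also have "\<dots> = 2 * N 0 * D" using U[OF A(2)] compl by simp
    also have "\<dots> \<le> 2 * 1 * D" using N_le_1[of 0] D by (intro mult_right_mono mult_left_mono) auto
    finally have T'2: "T' \<le> 2 * D" by simp
    have T'0: "0 \<le> T'"
      unfolding T'_def
    proof (intro Q_nn(1) T'i)
      fix a b :: real assume ab: "0 < a" "0 < b"
      have "0 \<le> w a b * (1 + J x a b)" using w_bounds J1[OF ab] by (intro mult_nonneg_nonneg) auto
      then show "0 \<le> w a b + w a b * J x a b" by (simp add: algebra_simps)
    qed
    have "N x * (1 - N 0) + \<epsilon>/2 * T = N 0 * (1 - N 0) - D * (1 - N 0) + \<epsilon>/2 * T"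
      by (simp add: D_def algebra_simps)
    also have "\<dots> = \<epsilon>/2 * T' - D * (1 - N 0)" unfolding N_0_w T' by (simp add: algebra_simps)
    finally have e2: "x * H x - HN x = \<epsilon>/2 * T' - D * (1 - N 0)" using e by simp
    have "\<epsilon>/2 * T' \<le> \<epsilon>/2 * (2 * D)" using T'2 eps by (intro mult_left_mono) auto
    moreover have "0 \<le> \<epsilon>/2 * T'" using T'0 eps by simp
    moreover have "D * (1 - N 0) \<le> D * (\<epsilon>/2)" using D N_0_bounds by (intro mult_left_mono) auto
    moreover have "0 \<le> D * (1 - N 0)" using D N_0_bounds by simp
    moreover have "0 \<le> \<epsilon> * D" using eps D by simp
    ultimately have near: "\<bar>x * H x - HN x\<bar> \<le> 2 * \<epsilon> * D" unfolding e2 abs_le_iff by (intro conjI; simp add: algebra_simps)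
    show "\<bar>x * H x - HN x\<bar> \<le> 2 * \<epsilon> * (N 0 - N x) \<and> \<bar>x * H x - HN x\<bar> \<le> 2 * \<epsilon> * N (x / 2)"
      using near far by (simp add: D_def)
  qed
qed

end

section \<open>The deviation of the density\<close>

context coagulation_profile begin

lemma integral_exp_shift:
  fixes x m :: real
  assumes "0 \<le> m"
  shows "(\<integral>\<^sup>+s. ennreal (exp (- (x - s))) * indicator {0..<m} s \<partial>lborel) = ennreal (exp (- (x - m)) - exp (- x))"
proof -
  have "((\<lambda>s. exp (- (x - s))) has_integral (exp (- (x - m)) - exp (- (x - 0)))) {0..m}"
    using assms by (intro fundamental_theorem_of_calculus)
     (auto intro!: derivative_eq_intros simp: has_real_derivative_iff_has_vector_derivative[symmetric])
  then have "(\<integral>\<^sup>+s. ennreal (exp (- (x - s))) * indicator {0..m} s \<partial>lborel) = ennreal (exp (- (x - m)) - exp (- x))"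
    by (subst nn_integral_has_integral_lebesgue') auto
  moreover have "(\<integral>\<^sup>+s. ennreal (exp (- (x - s))) * indicator {0..m} s \<partial>lborel) =
     (\<integral>\<^sup>+s. ennreal (exp (- (x - s))) * indicator {0..<m} s \<partial>lborel)"
    by (rule nn_integral_cong_AE)
      (use AE_lborel_singleton[of m] in \<open>eventually_elim, auto split: split_indicator\<close>)
  ultimately show ?thesis by simp
qed

text \<open>
  The convolution of the density with \<open>exp (- x)\<close>.
\<close>

definition HE :: "real \<Rightarrow> real" where
  "HE x = (\<integral>y. indicator {0..x} y * (H y * exp (- (x - y))) \<partial>lborel)"

lemma HE_int: "integrable lborel (\<lambda>y. indicator {0..x} y * (H y * exp (- (x - y))))"
proof (rule Bochner_Integration.integrable_bound[OF H_int])
  show "AE y in lborel. norm (indicator {0..x} y * (H y * exp (- (x - y)))) \<le> norm (H y)"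
    using H_nonneg by (intro AE_I2) (auto simp: abs_mult mult_left_le split: split_indicator)
qed measurable

text \<open>
  An integration by parts that replaces the density by its tail: exchange the order of integration in the
  convolution of \<open>exp (- x)\<close> with the tail of \<open>H\<close>.
\<close>

lemma HE_eq: assumes x: "0 \<le> x" shows "conv (\<lambda>x. exp (- x)) N x = HE x + N x - N 0 * exp (- x)"
proof -
  \<comment> \<open>The inner integral over the points \<open>s\<close> below both \<open>x\<close> and \<open>y\<close>.\<close>
  define \<kappa> where "\<kappa> y = exp (- (x - min x y)) - exp (- x)" for y
  have c: "continuous_on {0..x} (\<lambda>s. exp (- (x - s)) * N s)" by (intro continuous_intros N_continuous)
  have "((\<lambda>s. exp (- (x - s)) * N s) has_integral conv (\<lambda>x. exp (- x)) N x) {0..x}"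
    unfolding conv_def by (intro integrable_integral integrable_continuous_interval c)
  then have "ennreal (conv (\<lambda>x. exp (- x)) N x) = (\<integral>\<^sup>+s. ennreal (exp (- (x - s)) * N s) * indicator {0..x} s \<partial>lborel)"
    by (intro nn_integral_has_integral_lebesgue'[symmetric]) (auto simp: N_nonneg)
  also have "\<dots> = (\<integral>\<^sup>+s. ennreal (exp (- (x - s)) * N s) * indicator {0..<x} s \<partial>lborel)"
    by (rule nn_integral_cong_AE)
      (use AE_lborel_singleton[of x] in \<open>eventually_elim, auto split: split_indicator\<close>)
  also have "\<dots> = (\<integral>\<^sup>+s. (\<integral>\<^sup>+y. ennreal (H y) * (ennreal (exp (- (x - s))) * (if 0 \<le> s \<and> s < x \<and> s < y then 1 else 0)) \<partial>lborel) \<partial>lborel)"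
  proof (intro nn_integral_cong)
    fix s
    have "ennreal (exp (- (x - s)) * N s) * indicator {0..<x} s = (ennreal (exp (- (x - s))) * indicator {0..<x} s) * (\<integral>\<^sup>+y. ennreal (H y) * indicator {s<..} y \<partial>lborel)"
      by (simp add: ennreal_mult N_nonneg ennreal_N[symmetric] mult_ac)
    also have "\<dots> = (\<integral>\<^sup>+y. (ennreal (exp (- (x - s))) * indicator {0..<x} s) * (ennreal (H y) * indicator {s<..} y) \<partial>lborel)"
      by (subst nn_integral_cmult) auto
    also have "\<dots> = (\<integral>\<^sup>+y. ennreal (H y) * (ennreal (exp (- (x - s))) * (if 0 \<le> s \<and> s < x \<and> s < y then 1 else 0)) \<partial>lborel)"
      by (intro nn_integral_cong) (auto simp: mult_ac split: split_indicator)
    finally show "ennreal (exp (- (x - s)) * N s) * indicator {0..<x} s = (\<integral>\<^sup>+y. ennreal (H y) * (ennreal (exp (- (x - s))) * (if 0 \<le> s \<and> s < x \<and> s < y then 1 else 0)) \<partial>lborel)" .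
  qed
  also have "\<dots> = (\<integral>\<^sup>+y. (\<integral>\<^sup>+s. ennreal (H y) * (ennreal (exp (- (x - s))) * (if 0 \<le> s \<and> s < x \<and> s < y then 1 else 0)) \<partial>lborel) \<partial>lborel)"
    by (rule lborel_pair.Fubini') measurable
  also have "\<dots> = (\<integral>\<^sup>+y. ennreal (H y * \<kappa> y) \<partial>lborel)"
  proof (intro nn_integral_cong)
    fix y
    show "(\<integral>\<^sup>+s. ennreal (H y) * (ennreal (exp (- (x - s))) * (if 0 \<le> s \<and> s < x \<and> s < y then 1 else 0)) \<partial>lborel) = ennreal (H y * \<kappa> y)"
    proof (cases "0 < y")
      case True
      have "(\<integral>\<^sup>+s. ennreal (H y) * (ennreal (exp (- (x - s))) * (if 0 \<le> s \<and> s < x \<and> s < y then 1 else 0)) \<partial>lborel)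
        = (\<integral>\<^sup>+s. ennreal (H y) * (ennreal (exp (- (x - s))) * indicator {0..<min x y} s) \<partial>lborel)"
        by (intro nn_integral_cong) (auto split: split_indicator)
      also have "\<dots> = ennreal (H y) * ennreal (\<kappa> y)"
        unfolding \<kappa>_def using integral_exp_shift[of "min x y" x] True x by (subst nn_integral_cmult) auto
      finally show ?thesis using True x by (simp add: ennreal_mult H_nonneg \<kappa>_def)
    qed (simp add: H_zero)
  qed
  also have "\<dots> = ennreal (\<integral>y. H y * \<kappa> y \<partial>lborel)"
  proof (intro nn_integral_eq_integral AE_I2)
    show "integrable lborel (\<lambda>y. H y * \<kappa> y)"
    proof (rule Bochner_Integration.integrable_bound[OF H_int])
      show "(\<lambda>y. H y * \<kappa> y) \<in> borel_measurable lborel" unfolding \<kappa>_def by measurable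
      have "\<bar>\<kappa> y\<bar> \<le> 1" if "0 < y" for y
      proof -
        have "exp (- x) \<le> exp (- (x - min x y))" "exp (- (x - min x y)) \<le> 1" "0 < exp (- x)" using that x by auto
        then show ?thesis unfolding \<kappa>_def by linarith
      qed
      then have "\<bar>H y * \<kappa> y\<bar> \<le> \<bar>H y\<bar>" for y
        using H_zero[of y] by (cases "0 < y") (auto simp: abs_mult mult_left_le)
      then show "AE y in lborel. norm (H y * \<kappa> y) \<le> norm (H y)" by simp
    qed
    fix y
    show "0 \<le> H y * \<kappa> y" using H_nonneg[of y] H_zero[of y] x by (cases "0 < y") (auto simp: \<kappa>_def)
  qed
  also have "(\<integral>y. H y * \<kappa> y \<partial>lborel) = (\<integral>y. (indicator {0..x} y * (H y * exp (- (x - y))) + indicator {x<..} y * H y) - exp (- x) * H y \<partial>lborel)"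
  proof (intro Bochner_Integration.integral_cong refl)
    fix y
    show "H y * \<kappa> y = (indicator {0..x} y * (H y * exp (- (x - y))) + indicator {x<..} y * H y) - exp (- x) * H y"
      using H_zero[of y] x by (auto simp: \<kappa>_def algebra_simps split: split_indicator)
  qed
  also have "\<dots> = HE x + N x - N 0 * exp (- x)"
  proof -
    have i: "integrable lborel (\<lambda>y. indicator {x<..} y * H y)" "integrable lborel (\<lambda>y. exp (- x) * H y)"
      by (intro ind_H_int integrable_mult_right H_int; simp)+
    show ?thesis
      unfolding Bochner_Integration.integral_diff[OF Bochner_Integration.integrable_add[OF HE_int i(1)] i(2)]
        Bochner_Integration.integral_add[OF HE_int i(1)] HE_def N_0 N_def[of x]
      by simp
  qed
  finally have "ennreal (conv (\<lambda>x. exp (- x)) N x) = ennreal (HE x + N x - N 0 * exp (- x))" .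
  moreover have "0 \<le> conv (\<lambda>x. exp (- x)) N x"
    unfolding conv_def by (intro integral_nonneg integrable_continuous_interval c) (auto simp: N_nonneg)
  moreover have "0 \<le> HE x + N x - N 0 * exp (- x)"
  proof -
    have "N 0 * exp (- x) - N x \<le> HE x"
    proof -
      have "(\<integral>y. exp (- x) * H y - indicator {x<..} y * H y \<partial>lborel) \<le> HE x"
        unfolding HE_def
      proof (rule integral_mono)
        show "integrable lborel (\<lambda>y. exp (- x) * H y - indicator {x<..} y * H y)"
          by (intro Bochner_Integration.integrable_diff ind_H_int integrable_mult_right H_int) auto
        fix y
        have "exp (- x) * H y \<le> exp (- (x - y)) * H y" if "0 \<le> y"
          using that by (intro mult_right_mono H_nonneg) auto
        moreover have "exp (- x) * H y \<le> 1 * H y" using x by (intro mult_right_mono H_nonneg) auto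
        ultimately show "exp (- x) * H y - indicator {x<..} y * H y \<le> indicator {0..x} y * (H y * exp (- (x - y)))"
          using H_zero[of y] x by (auto simp: mult.commute split: split_indicator)
      qed (rule HE_int)
      also have "(\<integral>y. exp (- x) * H y - indicator {x<..} y * H y \<partial>lborel) = N 0 * exp (- x) - N x"
        unfolding N_0 N_def[of x]
        by (subst Bochner_Integration.integral_diff) (auto intro!: ind_H_int integrable_mult_right H_int)
      finally show ?thesis .
    qed
    then show ?thesis by simp
  qed
  ultimately show ?thesis by simp
qed

text \<open>
  The convolution of the density with the deviation \<open>n\<close> of the tail.
\<close>

definition Hn :: "real \<Rightarrow> real" where
  "Hn x = (\<integral>y. indicator {0..x} y * (H y * NE.n (x - y)) \<partial>lborel)"

lemma Hn_int: "integrable lborel (\<lambda>y. indicator {0..x} y * (H y * NE.n (x - y)))"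
  and HN_eq: "HN x = HE x + Hn x"
proof -
  have eq: "indicator {0..x} y * (H y * NE.n (x - y)) = indicator {0..x} y * (H y * N (x - y)) - indicator {0..x} y * (H y * exp (- (x - y)))" for y
    by (simp add: NE.n_def algebra_simps)
  show "integrable lborel (\<lambda>y. indicator {0..x} y * (H y * NE.n (x - y)))"
    unfolding eq by (intro Bochner_Integration.integrable_diff HN_int HE_int)
  have "Hn x = HN x - HE x"
    unfolding Hn_def HN_def HE_def eq by (intro Bochner_Integration.integral_diff HN_int HE_int)
  then show "HN x = HE x + Hn x" by simp
qed

text \<open>
  Apart from the error term of the density equation, \<open>x (H - exp (- x))\<close> consists of terms that contain the
  deviation \<open>n\<close> of the tail, which is already known to be small: convolution with \<open>exp (- x)\<close> integrates \<open>H - exp (- x)\<close>.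
\<close>

lemma density_difference:
  assumes x: "0 \<le> x"
  shows "x * (H x - exp (- x)) = (x * H x - HN x) + Hn x + NE.n 0 * exp (- x) - NE.n x + NE.W x"
proof -
  have "HE x = N 0 * exp (- x) - N x + NE.W x + x * exp (- x)"
    using HE_eq[OF x] NE.W_eq[OF x] by simp
  then show ?thesis unfolding HN_eq NE.n_def by (simp add: algebra_simps)
qed

end

text \<open>
  The regime in which the stability of the tail applies.
\<close>

locale close_profile = coagulation_profile +
  fixes \<delta> :: real
  assumes close: "\<And>x. 0 \<le> x \<Longrightarrow> \<bar>NE.n x\<bar> \<le> \<delta> * exp (- (x / 2))"
    and eps_le: "\<epsilon> \<le> \<delta>" and small: "\<delta> \<le> 1/8"
begin

lemma delta: "0 \<le> \<delta>" using close[of 0] by simp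

lemma n_le: "0 \<le> x \<Longrightarrow> \<bar>NE.n x\<bar> \<le> \<delta>"
  using close[of x] delta mult_left_mono[of "exp (- (x/2))" 1 \<delta>] by simp

lemma Hn_near: "\<bar>Hn x\<bar> \<le> \<delta> * (N 0 - N x)"
proof -
  have "\<bar>Hn x\<bar> \<le> (\<integral>y. \<delta> * (indicator {0..x} y * H y) \<partial>lborel)"
    unfolding Hn_def
  proof (rule integral_abs_bound_integral[OF Hn_int])
    show "integrable lborel (\<lambda>y. \<delta> * (indicator {0..x} y * H y))" by (intro integrable_mult_right ind_H_int) auto
    fix y
    have "H y * \<bar>NE.n (x - y)\<bar> \<le> H y * \<delta>" if "y \<le> x" using that by (intro mult_left_mono n_le H_nonneg) auto
    then show "\<bar>indicator {0..x} y * (H y * NE.n (x - y))\<bar> \<le> \<delta> * (indicator {0..x} y * H y)"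
      by (auto simp: abs_mult H_nonneg mult.commute split: split_indicator)
  qed
  then show ?thesis by (simp add: compl_mass)
qed

lemma N_half: assumes "0 \<le> x" shows "N (x / 2) \<le> 20 * exp (- (x / 4))"
proof -
  have "N (x / 2) \<le> 20 * exp (- (3/5 * (x / 2)))" using assms by (intro NE.exp_bound) auto
  also have "\<dots> \<le> 20 * exp (- (x / 4))" using assms by simp
  finally show ?thesis .
qed

text \<open>
  Either \<open>y \<le> x/2\<close>, and then \<open>n(x - y)\<close> is small because its argument is large, or \<open>y > x/2\<close>, and then little mass
  of \<open>H\<close> is left.
\<close>

lemma Hn_far: assumes x: "0 \<le> x" shows "\<bar>Hn x\<bar> \<le> 21 * \<delta> * exp (- (x / 4))"
proof -
  have "\<bar>Hn x\<bar> \<le> (\<integral>y. \<delta> * (exp (- (x / 4)) * H y + indicator {x/2<..} y * H y) \<partial>lborel)"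
    unfolding Hn_def
  proof (rule integral_abs_bound_integral[OF Hn_int])
    show "integrable lborel (\<lambda>y. \<delta> * (exp (- (x / 4)) * H y + indicator {x/2<..} y * H y))"
      by (intro integrable_mult_right Bochner_Integration.integrable_add ind_H_int H_int) auto
    fix y
    have "\<bar>NE.n (x - y)\<bar> \<le> \<delta> * (exp (- (x / 4)) + indicator {x/2<..} y)" if y: "0 \<le> y" "y \<le> x"
    proof (cases "x/2 < y")
      case True
      have "\<delta> * 1 \<le> \<delta> * (exp (- (x / 4)) + 1)" using delta by (intro mult_left_mono) auto
      then show ?thesis using n_le[of "x - y"] y True by simp
    next
      case False
      have "\<bar>NE.n (x - y)\<bar> \<le> \<delta> * exp (- ((x - y) / 2))" using y by (intro close) auto
      also have "\<dots> \<le> \<delta> * exp (- (x / 4))" using False delta by (intro mult_left_mono) auto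
      finally show ?thesis using False by simp
    qed
    then have "H y * \<bar>NE.n (x - y)\<bar> \<le> H y * (\<delta> * (exp (- (x / 4)) + indicator {x/2<..} y))" if "0 \<le> y" "y \<le> x"
      using that by (intro mult_left_mono H_nonneg) auto
    moreover have "0 \<le> \<delta> * (exp (- (x / 4)) * H y + indicator {x/2<..} y * H y)"
      using delta H_nonneg by (intro mult_nonneg_nonneg add_nonneg_nonneg) auto
    ultimately show "\<bar>indicator {0..x} y * (H y * NE.n (x - y))\<bar> \<le> \<delta> * (exp (- (x / 4)) * H y + indicator {x/2<..} y * H y)"
      by (cases "y \<in> {0..x}") (auto simp: abs_mult H_nonneg algebra_simps)
  qed
  also have "\<dots> = \<delta> * (exp (- (x / 4)) * N 0 + N (x/2))"
    unfolding N_0 N_def[of "x/2"]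
    by (subst integral_mult_right_zero, subst Bochner_Integration.integral_add) (auto intro!: integrable_mult_right ind_H_int H_int)
  also have "\<dots> \<le> \<delta> * (exp (- (x / 4)) * 1 + 20 * exp (- (x / 4)))"
    using delta N_le_1[of 0] N_half[OF x] by (intro mult_left_mono add_mono) auto
  finally show ?thesis by simp
qed

lemma W_near: assumes x: "0 \<le> x" shows "\<bar>NE.W x\<bar> \<le> \<delta> * x"
  and W_far: "\<bar>NE.W x\<bar> \<le> 2 * \<delta> * exp (- (x / 2))"
proof -
  have W: "NE.W x = integral {0..x} (\<lambda>y. exp (- x) * (exp y * NE.n y))" by (simp add: NE.W_def NE.I_def)
  have i: "(\<lambda>y. exp (- x) * (exp y * NE.n y)) integrable_on {0..x}"
    by (intro integrable_continuous_interval continuous_intros NE.n_cont')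
  have b: "\<bar>exp (- x) * (exp y * NE.n y)\<bar> \<le> \<delta> * (exp (- x) * exp (y / 2))" if "y \<in> {0..x}" for y
  proof -
    have "\<bar>exp (- x) * (exp y * NE.n y)\<bar> = exp (- x) * exp y * \<bar>NE.n y\<bar>" by (simp add: abs_mult)
    also have "\<dots> \<le> exp (- x) * exp y * (\<delta> * exp (- (y / 2)))" using that by (intro mult_left_mono close) auto
    also have "\<dots> = \<delta> * (exp (- x) * (exp y * exp (- (y / 2))))" by simp
    also have "exp y * exp (- (y / 2)) = exp (y / 2)" by (simp add: exp_add[symmetric])
    finally show ?thesis .
  qed
  have "norm (NE.W x) \<le> integral {0..x} (\<lambda>y. \<delta>)"
    unfolding W
  proof (rule integral_norm_bound_integral[OF i])
    fix y assume y: "y \<in> {0..x}"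
    have "exp (- x) * exp (y / 2) \<le> 1" using y by (simp add: exp_add[symmetric])
    then have "\<delta> * (exp (- x) * exp (y / 2)) \<le> \<delta> * 1" using delta by (intro mult_left_mono) auto
    with b[OF y] show "norm (exp (- x) * (exp y * NE.n y)) \<le> \<delta>" by simp
  qed (rule integrable_const_ivl)
  then show "\<bar>NE.W x\<bar> \<le> \<delta> * x" using x by (simp add: mult.commute)
  have h: "((\<lambda>y. \<delta> * (exp (- x) * exp (y / 2))) has_integral (\<delta> * (exp (- x) * (2 * exp (x / 2))) - \<delta> * (exp (- x) * (2 * exp (0 / 2))))) {0..x}"
    using x by (intro fundamental_theorem_of_calculus)
     (auto intro!: derivative_eq_intros simp: has_real_derivative_iff_has_vector_derivative[symmetric])
  have "norm (NE.W x) \<le> integral {0..x} (\<lambda>y. \<delta> * (exp (- x) * exp (y / 2)))"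
    unfolding W using b by (intro integral_norm_bound_integral[OF i] has_integral_integrable[OF h]) auto
  also have "\<dots> = 2 * \<delta> * (exp (- x) * exp (x / 2)) - 2 * \<delta> * exp (- x)" using integral_unique[OF h] by simp
  also have "\<dots> \<le> 2 * \<delta> * (exp (- x) * exp (x / 2))" using delta by simp
  also have "exp (- x) * exp (x / 2) = exp (- (x / 2))" by (simp add: exp_add[symmetric])
  finally show "\<bar>NE.W x\<bar> \<le> 2 * \<delta> * exp (- (x / 2))" by simp
qed

text \<open>
  Sufficient away from zero; near zero the division by \<open>x\<close> would cost a logarithm.
\<close>

lemma far_bound: "AE x in lborel. 0 < x \<longrightarrow> \<bar>x * (H x - exp (- x))\<bar> \<le> 65 * \<delta> * exp (- (x / 4))"
  using density_error
proof eventually_elim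
  case (elim x)
  show ?case
  proof
    assume x: "0 < x"
    have e: "exp (- x) \<le> exp (- (x / 4))" "exp (- (x / 2)) \<le> exp (- (x / 4))" using x by auto
    have 1: "\<bar>x * H x - HN x\<bar> \<le> 40 * \<delta> * exp (- (x / 4))"
    proof -
      have "\<bar>x * H x - HN x\<bar> \<le> 2 * \<epsilon> * N (x / 2)" using elim x by auto
      also have "\<dots> \<le> 2 * \<delta> * (20 * exp (- (x / 4)))"
        using eps_le eps delta x N_nonneg by (intro mult_mono N_half) auto
      finally show ?thesis by simp
    qed
    have 2: "\<bar>NE.n 0 * exp (- x)\<bar> \<le> \<delta> * exp (- (x / 4))"
      unfolding abs_mult using n_le[of 0] e delta by (intro mult_mono) auto
    have 3: "\<bar>NE.n x\<bar> \<le> \<delta> * exp (- (x / 4))"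
      using close[of x] x mult_left_mono[OF e(2) delta] by simp
    have 4: "\<bar>NE.W x\<bar> \<le> 2 * \<delta> * exp (- (x / 4))"
      using W_far[of x] x mult_left_mono[OF e(2), of "2 * \<delta>"] delta by simp
    show "\<bar>x * (H x - exp (- x))\<bar> \<le> 65 * \<delta> * exp (- (x / 4))"
      unfolding density_difference[OF less_imp_le[OF x]] using 1 2 3 4 Hn_far[of x] x by linarith
  qed
qed

text \<open>
  With \<open>d(x) = n(0) - n(x)\<close>, the integral of \<open>g = H - exp (- x)\<close> from \<open>0\<close> to \<open>x\<close>, this is \<open>x g - d = x\<^sup>2 (d/x)'\<close>.
\<close>

definition q :: "real \<Rightarrow> real" where "q x = x * (H x - exp (- x)) - (NE.n 0 - NE.n x)"

text \<open>
  Every term of \<open>q\<close> carries a factor \<open>x\<close> or \<open>D = N 0 - N x\<close>. The latter is at most \<open>2 x H\<close>: the convolution of \<open>H\<close> with its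
  tail is at least \<open>N x\<close> times \<open>D\<close>, and up to a small error it equals \<open>x H\<close>.
\<close>

lemma near_bound: "AE x in lborel. 0 < x \<longrightarrow> x \<le> 1/8 \<longrightarrow> \<bar>q x\<bar> \<le> \<delta> * (6 * H x + 2) * x"
  using density_error
proof eventually_elim
  case (elim x)
  show ?case
  proof (intro impI)
    assume x: "0 < x" "x \<le> 1/8"
    define D where "D = N 0 - N x"
    have D0: "0 \<le> D" using N_le_N0[of x] by (simp add: D_def)
    have 1: "\<bar>x * H x - HN x\<bar> \<le> 2 * \<epsilon> * D" using elim x by (simp add: D_def)
    have "N x * D = (\<integral>y. N x * (indicator {0..x} y * H y) \<partial>lborel)" by (simp add: compl_mass D_def)
    also have "\<dots> \<le> HN x"
      unfolding HN_def
    proof (rule integral_mono[OF _ HN_int])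
      show "integrable lborel (\<lambda>y. N x * (indicator {0..x} y * H y))" by (intro integrable_mult_right ind_H_int) auto
      fix y
      have "N x * H y \<le> N (x - y) * H y" if "0 \<le> y" using that by (intro mult_right_mono N_dec H_nonneg) auto
      then show "N x * (indicator {0..x} y * H y) \<le> indicator {0..x} y * (H y * N (x - y))"
        by (auto simp: mult_ac split: split_indicator)
    qed
    finally have HN: "N x * D \<le> HN x" .
    have "1 - x \<le> exp (- x)" using exp_ge_add_one_self[of "- x"] by simp
    then have "3/4 \<le> N x" using n_le[of x] x small by (auto simp: NE.n_def abs_le_iff)
    then have "3/4 * D \<le> N x * D" using D0 by (rule mult_right_mono)
    moreover have "2 * \<epsilon> * D \<le> 2 * (1/8) * D" using eps_le small D0 by (intro mult_right_mono) auto
    ultimately have D: "D \<le> 2 * (x * H x)" using HN 1 by (simp add: abs_le_iff)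
    have "NE.n 0 * exp (- x) - NE.n 0 = - (NE.n 0 * (1 - exp (- x)))" by (simp add: algebra_simps)
    moreover have "\<bar>NE.n 0 * (1 - exp (- x))\<bar> \<le> \<delta> * x"
      unfolding abs_mult using n_le[of 0] delta x \<open>1 - x \<le> exp (- x)\<close> by (intro mult_mono) auto
    moreover have "q x = (x * H x - HN x) + Hn x + (NE.n 0 * exp (- x) - NE.n 0) + NE.W x"
      unfolding q_def using x by (subst density_difference) auto
    moreover have "2 * \<epsilon> * D \<le> 2 * \<delta> * D" using eps_le D0 by (intro mult_right_mono) auto
    ultimately have "\<bar>q x\<bar> \<le> 2 * \<delta> * D + \<delta> * D + \<delta> * x + \<delta> * x"
      using 1 Hn_near[of x, folded D_def] W_near[of x] x by linarith
    also have "\<dots> = 3 * \<delta> * D + 2 * \<delta> * x" by simp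
    also have "\<dots> \<le> 3 * \<delta> * (2 * (x * H x)) + 2 * \<delta> * x" using D delta by (intro add_mono mult_left_mono) auto
    finally show "\<bar>q x\<bar> \<le> \<delta> * (6 * H x + 2) * x" by (simp add: algebra_simps)
  qed
qed

end

section \<open>Integrability of the deviation near zero\<close>

context coagulation_profile begin

text \<open>
  The deviation of the density, and below its primitive \<open>d\<close> vanishing at zero.
\<close>

definition g :: "real \<Rightarrow> real" where "g x = H x - exp (- x)"

definition d :: "real \<Rightarrow> real" where "d x = NE.n 0 - NE.n x"

lemma g_meas[measurable]: "g \<in> borel_measurable borel"
  unfolding g_def by measurable

lemma n_meas[measurable]: "NE.n \<in> borel_measurable borel"
  unfolding NE.n_def by measurable

lemma d_meas[measurable]: "d \<in> borel_measurable borel"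
  unfolding d_def by measurable

lemma ind_exp_int:
  fixes x b :: real
  assumes "0 \<le> x" "x \<le> b"
  shows "integrable lborel (\<lambda>u. indicator {x<..<b} u * exp (- u))"
    and "(\<integral>u. indicator {x<..<b} u * exp (- u) \<partial>lborel) = exp (- x) - exp (- b)"
proof -
  have "has_bochner_integral lborel (\<lambda>u. exp (- u) * indicator {x..b} u) (- exp (- b) - (- exp (- x)))"
    using assms by (intro has_bochner_integral_FTC_Icc_real[where F="\<lambda>y. - exp (- y)"])
      (auto intro!: derivative_eq_intros continuous_intros)
  moreover have "AE u in lborel. exp (- u) * indicator {x..b} u = indicator {x<..<b} u * exp (- u)"
    using AE_lborel_singleton[of x] AE_lborel_singleton[of b] by eventually_elim (auto split: split_indicator)
  ultimately have "has_bochner_integral lborel (\<lambda>u. indicator {x<..<b} u * exp (- u)) (- exp (- b) - (- exp (- x)))"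
    by (subst has_bochner_integral_cong_AE[symmetric]) (auto dest: borel_measurable_has_bochner_integral)
  then show "integrable lborel (\<lambda>u. indicator {x<..<b} u * exp (- u))"
    "(\<integral>u. indicator {x<..<b} u * exp (- u) \<partial>lborel) = exp (- x) - exp (- b)"
    by (auto simp: has_bochner_integral_iff)
qed

lemma ind_g_int:
  assumes "0 \<le> x" "x \<le> b"
  shows "integrable lborel (\<lambda>u. indicator {x<..<b} u * g u)"
    and "(\<integral>u. indicator {x<..<b} u * g u \<partial>lborel) = d b - d x"
proof -
  have eq: "indicator {x<..<b} u * g u = indicator {x<..<b} u * H u - indicator {x<..<b} u * exp (- u)" for u
    by (simp add: g_def algebra_simps)
  have A: "{x<..<b} \<in> sets borel" by simp
  show "integrable lborel (\<lambda>u. indicator {x<..<b} u * g u)"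
    unfolding eq by (intro Bochner_Integration.integrable_diff ind_H_int[OF A] ind_exp_int assms)
  have "N x - N b = (\<integral>u. indicator {x<..} u * H u - indicator {b<..} u * H u \<partial>lborel)"
    unfolding N_def by (intro Bochner_Integration.integral_diff[symmetric] ind_H_int) auto
  also have "\<dots> = (\<integral>u. indicator {x<..<b} u * H u \<partial>lborel)"
  proof (rule integral_cong_AE)
    show "AE u in lborel. indicator {x<..} u * H u - indicator {b<..} u * H u = indicator {x<..<b} u * H u"
      using AE_lborel_singleton[of b] by eventually_elim (use assms in \<open>auto split: split_indicator\<close>)
  qed measurable
  finally have N: "(\<integral>u. indicator {x<..<b} u * H u \<partial>lborel) = N x - N b" by simp
  have "(\<integral>u. indicator {x<..<b} u * g u \<partial>lborel) = N x - N b - (exp (- x) - exp (- b))"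
    unfolding eq N[symmetric] ind_exp_int(2)[OF assms, symmetric]
    by (intro Bochner_Integration.integral_diff ind_H_int[OF A] ind_exp_int assms)
  then show "(\<integral>u. indicator {x<..<b} u * g u \<partial>lborel) = d b - d x" by (simp add: d_def NE.n_def)
qed

text \<open>
  The fundamental theorem of calculus for \<open>d/x\<close>, whose derivative is \<open>(x g - d) / x\<^sup>2\<close> almost everywhere only;
  it is obtained by writing \<open>d\<close> as an integral and exchanging the order of integration.
\<close>

lemma quotient_identity:
  assumes x: "0 < x" "x < b"
  shows "integrable lborel (\<lambda>y. indicator {x<..<b} y * ((y * g y - d y) / y\<^sup>2))"
    and "(\<integral>y. indicator {x<..<b} y * ((y * g y - d y) / y\<^sup>2) \<partial>lborel) = d b / b - d x / x"
proof -
  note gi = ind_g_int[of x b]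
  note op = integral_open_interval_inverse_square
  define p where "p u y = indicator {x<..<b} u * g u * (indicator {u<..<b} y * (1 / y\<^sup>2))" for u y
  have pm: "(\<lambda>(u, y). p u y) \<in> borel_measurable (lborel \<Otimes>\<^sub>M lborel)"
  proof -
    have "(\<lambda>(u, y). p u y) = (\<lambda>(u, y). indicator {x<..<b} u * g u * ((if u < y \<and> y < b then 1 else 0) * (1 / y\<^sup>2)))"
      by (auto simp: p_def fun_eq_iff split: split_indicator)
    then show ?thesis by simp
  qed
  have pi: "integrable (lborel \<Otimes>\<^sub>M lborel) (\<lambda>(u, y). p u y)"
  proof (rule Bochner_Integration.integrable_bound[OF _ pm])
    have "integrable lborel (\<lambda>y. 1 / x\<^sup>2 * indicator {x<..<b} y)" using x by simp
    from integrable_pair_product[OF gi(1) this]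
    show "integrable (lborel \<Otimes>\<^sub>M lborel) (\<lambda>(u, y). indicator {x<..<b} u * g u * (1 / x\<^sup>2 * indicator {x<..<b} y))"
      using x by simp
    have "\<bar>p u y\<bar> \<le> \<bar>indicator {x<..<b} u * g u * (1 / x\<^sup>2 * indicator {x<..<b} y)\<bar>" for u y
    proof (cases "x < u \<and> u < y \<and> y < b")
      case True
      then have "1 / y\<^sup>2 \<le> 1 / x\<^sup>2" using x by (intro divide_left_mono power_mono mult_pos_pos) auto
      then have "\<bar>g u\<bar> * (1 / y\<^sup>2) \<le> \<bar>g u\<bar> * (1 / x\<^sup>2)" by (intro mult_left_mono) auto
      then show ?thesis using True by (simp add: p_def abs_mult)
    qed (auto simp: p_def split: split_indicator)
    then show "AE q in lborel \<Otimes>\<^sub>M lborel. norm (case q of (u, y) \<Rightarrow> p u y) \<le> norm (case q of (u, y) \<Rightarrow> indicator {x<..<b} u * g u * (1 / x\<^sup>2 * indicator {x<..<b} y))"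
      by (intro AE_I2) (auto split: prod.split)
  qed
  have inner_y: "(\<integral>y. p u y \<partial>lborel) = indicator {x<..<b} u * (g u * (1 / u - 1 / b))" for u
  proof (cases "x < u \<and> u < b")
    case True
    then have "0 < u" using x by simp
    have "(\<integral>y. p u y \<partial>lborel) = indicator {x<..<b} u * g u * (if u < b then 1 / u - 1 / b else 0)"
      unfolding p_def by (simp only: integral_mult_right_zero op(2)[OF \<open>0 < u\<close>])
    then show ?thesis using True by simp
  qed (auto simp: p_def)
  have inner_u: "(\<integral>u. p u y \<partial>lborel) = indicator {x<..<b} y * ((d y - d x) / y\<^sup>2)" for y
  proof (cases "x < y \<and> y < b")
    case True
    have "(\<integral>u. p u y \<partial>lborel) = (\<integral>u. (1 / y\<^sup>2) * (indicator {x<..<y} u * g u) \<partial>lborel)"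
      using True by (intro Bochner_Integration.integral_cong) (auto simp: p_def split: split_indicator)
    also have "\<dots> = 1 / y\<^sup>2 * (d y - d x)"
      using ind_g_int(2)[of x y] True x by (simp only: integral_mult_right_zero) simp
    finally show ?thesis using True by simp
  next
    case False
    then have "p u y = 0" for u by (auto simp: p_def split: split_indicator)
    then show ?thesis using False by auto
  qed
  have i1: "integrable lborel (\<lambda>y. indicator {x<..<b} y * ((d y - d x) / y\<^sup>2))"
    using lborel_pair.integrable_snd[OF pi] unfolding inner_u .
  have i2: "integrable lborel (\<lambda>y. indicator {x<..<b} y * (g y * (1 / y)))"
  proof (rule Bochner_Integration.integrable_bound)
    show "integrable lborel (\<lambda>y. 1 / x * (indicator {x<..<b} y * g y))" using gi(1) x by (intro integrable_mult_right) auto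
    have "\<bar>g y\<bar> * (1 / y) \<le> \<bar>g y\<bar> * (1 / x)" if "x < y" for y
      using that x by (intro mult_left_mono divide_left_mono) auto
    then show "AE y in lborel. norm (indicator {x<..<b} y * (g y * (1 / y))) \<le> norm (1 / x * (indicator {x<..<b} y * g y))"
      using x by (intro AE_I2) (auto simp: abs_mult split: split_indicator)
  qed measurable
  have i3: "integrable lborel (\<lambda>y. d x * (indicator {x<..<b} y * (1 / y\<^sup>2)))"
    using op(1)[OF x(1)] by (rule integrable_mult_right)
  have swap: "(\<integral>y. indicator {x<..<b} y * ((d y - d x) / y\<^sup>2) \<partial>lborel) =
      (\<integral>u. indicator {x<..<b} u * (g u * (1 / u - 1 / b)) \<partial>lborel)"
    using lborel_pair.Fubini_integral[OF pi] unfolding inner_u inner_y .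
  have eq: "indicator {x<..<b} y * ((y * g y - d y) / y\<^sup>2) =
    indicator {x<..<b} y * (g y * (1 / y)) - (indicator {x<..<b} y * ((d y - d x) / y\<^sup>2) + d x * (indicator {x<..<b} y * (1 / y\<^sup>2)))" for y
    using x by (auto simp: diff_divide_distrib power2_eq_square split: split_indicator)
  show "integrable lborel (\<lambda>y. indicator {x<..<b} y * ((y * g y - d y) / y\<^sup>2))"
    unfolding eq by (intro Bochner_Integration.integrable_diff Bochner_Integration.integrable_add i1 i2 i3)
  have "(\<integral>u. indicator {x<..<b} u * (g u * (1 / u - 1 / b)) \<partial>lborel) =
     (\<integral>u. indicator {x<..<b} u * (g u * (1 / u)) - 1 / b * (indicator {x<..<b} u * g u) \<partial>lborel)"
    by (intro Bochner_Integration.integral_cong) (auto simp: algebra_simps)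
  also have "\<dots> = (\<integral>u. indicator {x<..<b} u * (g u * (1 / u)) \<partial>lborel) - 1 / b * (d b - d x)"
  proof -
    have "integrable lborel (\<lambda>u. 1 / b * (indicator {x<..<b} u * g u))" using gi(1) x by (intro integrable_mult_right) auto
    from Bochner_Integration.integral_diff[OF i2 this] show ?thesis using gi(2) x by simp
  qed
  finally have s: "(\<integral>y. indicator {x<..<b} y * ((d y - d x) / y\<^sup>2) \<partial>lborel) =
    (\<integral>u. indicator {x<..<b} u * (g u * (1 / u)) \<partial>lborel) - 1 / b * (d b - d x)" using swap by simp
  have "(\<integral>y. indicator {x<..<b} y * ((y * g y - d y) / y\<^sup>2) \<partial>lborel) =
     (\<integral>u. indicator {x<..<b} u * (g u * (1 / u)) \<partial>lborel) -
     ((\<integral>y. indicator {x<..<b} y * ((d y - d x) / y\<^sup>2) \<partial>lborel) + (\<integral>y. d x * (indicator {x<..<b} y * (1 / y\<^sup>2)) \<partial>lborel))"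
    unfolding eq
    by (simp only: Bochner_Integration.integral_diff[OF i2 Bochner_Integration.integrable_add[OF i1 i3]] Bochner_Integration.integral_add[OF i1 i3])
  also have "(\<integral>y. d x * (indicator {x<..<b} y * (1 / y\<^sup>2)) \<partial>lborel) = d x * (1 / x - 1 / b)"
    using op(2)[OF x(1), of b] x by (simp only: integral_mult_right_zero) simp
  finally show "(\<integral>y. indicator {x<..<b} y * ((y * g y - d y) / y\<^sup>2) \<partial>lborel) = d b / b - d x / x"
    unfolding s
  proof -
    have alg: "X - ((X - 1 / b * (u - v)) + v * (1 / x - 1 / b)) = u / b - v / x" for X u v :: real
      by (simp add: algebra_simps diff_divide_distrib)
    assume "(\<integral>y. indicator {x<..<b} y * ((y * g y - d y) / y\<^sup>2) \<partial>lborel) =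
      (\<integral>u. indicator {x<..<b} u * (g u * (1 / u)) \<partial>lborel) -
      ((\<integral>u. indicator {x<..<b} u * (g u * (1 / u)) \<partial>lborel) - 1 / b * (d b - d x) + d x * (1 / x - 1 / b))"
    then show ?thesis by (simp only: alg)
  qed
qed

end

context close_profile begin

lemma q_eq: "q x = x * g x - d x" by (simp add: q_def g_def d_def)

lemma q_meas[measurable]: "q \<in> borel_measurable borel"
  unfolding q_eq[abs_def] by measurable

text \<open>
  By the previous bound the quotient is at most \<open>\<delta> (6 H + 2)\<close>, and \<open>H\<close> has mass at most one.
\<close>

lemma q_integral: "(\<integral>\<^sup>+y. ennreal (\<bar>q y\<bar> / y) * indicator {0<..<1/8} y \<partial>lborel) \<le> ennreal (7 * \<delta>)"
proof -
  have "(\<integral>\<^sup>+y. ennreal (\<bar>q y\<bar> / y) * indicator {0<..<1/8} y \<partial>lborel) \<le>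
     (\<integral>\<^sup>+y. ennreal (6 * \<delta> * H y + 2 * \<delta> * indicator {0<..<1/8} y) \<partial>lborel)"
  proof (rule nn_integral_mono_AE)
    show "AE y in lborel. ennreal (\<bar>q y\<bar> / y) * indicator {0<..<1/8} y \<le> ennreal (6 * \<delta> * H y + 2 * \<delta> * indicator {0<..<1/8} y)"
      using near_bound
    proof eventually_elim
      case (elim y)
      show ?case
      proof (cases "0 < y \<and> y < 1/8")
        case True
        then have "\<bar>q y\<bar> / y \<le> \<delta> * (6 * H y + 2)" using elim by (simp add: pos_divide_le_eq)
        then show ?thesis using True by (auto intro!: ennreal_leI simp: algebra_simps)
      qed auto
    qed
  qed
  also have "\<dots> = ennreal (\<integral>y. 6 * \<delta> * H y + 2 * \<delta> * indicator {0<..<1/8} y \<partial>lborel)"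
    using delta by (intro nn_integral_eq_integral AE_I2)
      (auto intro!: Bochner_Integration.integrable_add integrable_mult_right H_int add_nonneg_nonneg mult_nonneg_nonneg H_nonneg)
  also have "(\<integral>y. 6 * \<delta> * H y + 2 * \<delta> * indicator {0<..<1/8} y \<partial>lborel) = 6 * \<delta> * N 0 + 2 * \<delta> * (1/8)"
    by (subst Bochner_Integration.integral_add) (auto intro!: integrable_mult_right H_int simp: N_0)
  also have "\<dots> \<le> 7 * \<delta>"
    using mult_left_mono[of "N 0" 1 "6 * \<delta>"] N_le_1[of 0] delta by simp
  finally show ?thesis by (simp add: ennreal_leI)
qed

lemma d_quotient_le:
  assumes x: "0 < x" "x < 1/8"
  shows "ennreal (\<bar>d x\<bar> / x) \<le> ennreal (16 * \<delta>) + (\<integral>\<^sup>+y. ennreal (\<bar>q y\<bar> / y\<^sup>2) * indicator {x<..<1/8} y \<partial>lborel)"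
proof -
  note qi = quotient_identity[OF x, folded q_eq]
  have "d x / x = d (1/8) / (1/8) - (\<integral>y. indicator {x<..<1/8} y * (q y / y\<^sup>2) \<partial>lborel)" using qi(2) by simp
  then have "\<bar>d x\<bar> / x \<le> 8 * \<bar>d (1/8)\<bar> + \<bar>\<integral>y. indicator {x<..<1/8} y * (q y / y\<^sup>2) \<partial>lborel\<bar>"
    using x by (simp add: abs_if split: if_splits)
  also have "\<dots> \<le> 16 * \<delta> + \<bar>\<integral>y. indicator {x<..<1/8} y * (q y / y\<^sup>2) \<partial>lborel\<bar>"
    using n_le[of 0] n_le[of "1/8"] by (simp add: d_def)
  finally have "ennreal (\<bar>d x\<bar> / x) \<le> ennreal (16 * \<delta> + \<bar>\<integral>y. indicator {x<..<1/8} y * (q y / y\<^sup>2) \<partial>lborel\<bar>)"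
    by (rule ennreal_leI)
  also have "\<dots> = ennreal (16 * \<delta>) + ennreal (norm (\<integral>y. indicator {x<..<1/8} y * (q y / y\<^sup>2) \<partial>lborel))"
    using delta by (subst ennreal_plus) auto
  also have "ennreal (norm (\<integral>y. indicator {x<..<1/8} y * (q y / y\<^sup>2) \<partial>lborel)) \<le> (\<integral>\<^sup>+y. norm (indicator {x<..<1/8} y * (q y / y\<^sup>2)) \<partial>lborel)"
    by (rule integral_norm_bound_ennreal[OF qi(1)])
  also have "(\<integral>\<^sup>+y. norm (indicator {x<..<1/8} y * (q y / y\<^sup>2)) \<partial>lborel) = (\<integral>\<^sup>+y. ennreal (\<bar>q y\<bar> / y\<^sup>2) * indicator {x<..<1/8} y \<partial>lborel)"
    by (intro nn_integral_cong) (auto simp: abs_mult split: split_indicator)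
  finally show ?thesis by (simp add: add_left_mono)
qed

text \<open>
  From \<open>g = d/x + q/x\<close>. The second term is integrable, and integrating the bound on \<open>d/x\<close> over \<open>x\<close>
  turns \<open>\<bar>q\<bar> / y\<^sup>2\<close> into \<open>\<bar>q\<bar> / y\<close> once more.
\<close>

lemma near_integral: "(\<integral>\<^sup>+x. ennreal \<bar>g x\<bar> * indicator {0<..<1/8} x \<partial>lborel) \<le> ennreal (16 * \<delta>)"
proof -
  let ?T = "\<lambda>x. \<integral>\<^sup>+y. ennreal (\<bar>q y\<bar> / y\<^sup>2) * indicator {x<..<1/8} y \<partial>lborel"
  let ?R = "\<integral>\<^sup>+y. ennreal (\<bar>q y\<bar> / y) * indicator {0<..<1/8} y \<partial>lborel"
  have T: "?T x = (\<integral>\<^sup>+y. ennreal (\<bar>q y\<bar> / y\<^sup>2) * (if x < y \<and> y < 1/8 then 1 else 0) \<partial>lborel)" for x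
    by (intro nn_integral_cong) (auto split: split_indicator)
  have [measurable]: "?T \<in> borel_measurable lborel" unfolding T by measurable
  have "(\<integral>\<^sup>+x. ennreal \<bar>g x\<bar> * indicator {0<..<1/8} x \<partial>lborel) \<le>
    (\<integral>\<^sup>+x. (ennreal (16 * \<delta>) * indicator {0<..<1/8} x + ?T x * indicator {0<..<1/8} x) + ennreal (\<bar>q x\<bar> / x) * indicator {0<..<1/8} x \<partial>lborel)"
  proof (intro nn_integral_mono)
    fix x :: real
    show "ennreal \<bar>g x\<bar> * indicator {0<..<1/8} x \<le> (ennreal (16 * \<delta>) * indicator {0<..<1/8} x + ?T x * indicator {0<..<1/8} x) + ennreal (\<bar>q x\<bar> / x) * indicator {0<..<1/8} x"
    proof (cases "0 < x \<and> x < 1/8")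
      case True
      have "x * g x = d x + q x" by (simp add: q_eq)
      then have "g x = d x / x + q x / x" using True by (simp add: field_simps)
      then have "\<bar>g x\<bar> \<le> \<bar>d x\<bar> / x + \<bar>q x\<bar> / x" using True abs_triangle_ineq[of "d x / x" "q x / x"] by simp
      then have "ennreal \<bar>g x\<bar> \<le> ennreal (\<bar>d x\<bar> / x + \<bar>q x\<bar> / x)" by (rule ennreal_leI)
      also have "\<dots> = ennreal (\<bar>d x\<bar> / x) + ennreal (\<bar>q x\<bar> / x)" using True by (intro ennreal_plus) auto
      also have "\<dots> \<le> (ennreal (16 * \<delta>) + ?T x) + ennreal (\<bar>q x\<bar> / x)"
        using True by (intro add_right_mono d_quotient_le) auto
      finally show ?thesis using True by simp
    qed auto
  qed
  also have "\<dots> = ennreal (16 * \<delta>) * emeasure lborel {0<..<1/8::real} + (\<integral>\<^sup>+x. ?T x * indicator {0<..<1/8} x \<partial>lborel) + ?R"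
    by (subst nn_integral_add, measurable, subst nn_integral_add, measurable, subst nn_integral_cmult_indicator, auto)
  also have "(\<integral>\<^sup>+x. ?T x * indicator {0<..<1/8} x \<partial>lborel) = ?R"
  proof -
    have "(\<integral>\<^sup>+x. ?T x * indicator {0<..<1/8} x \<partial>lborel) = 
       (\<integral>\<^sup>+x. (\<integral>\<^sup>+y. ennreal (\<bar>q y\<bar> / y\<^sup>2) * (if 0 < x \<and> x < y \<and> y < 1/8 then 1 else 0) \<partial>lborel) \<partial>lborel)"
      unfolding T by (subst nn_integral_multc[symmetric]) (auto intro!: nn_integral_cong split: split_indicator)
    also have "\<dots> = (\<integral>\<^sup>+y. (\<integral>\<^sup>+x. ennreal (\<bar>q y\<bar> / y\<^sup>2) * (if 0 < x \<and> x < y \<and> y < 1/8 then 1 else 0) \<partial>lborel) \<partial>lborel)"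
      by (rule lborel_pair.Fubini') measurable
    also have "\<dots> = ?R"
    proof (intro nn_integral_cong)
      fix y :: real
      show "(\<integral>\<^sup>+x. ennreal (\<bar>q y\<bar> / y\<^sup>2) * (if 0 < x \<and> x < y \<and> y < 1/8 then 1 else 0) \<partial>lborel) = ennreal (\<bar>q y\<bar> / y) * indicator {0<..<1/8} y"
      proof (cases "0 < y \<and> y < 1/8")
        case True
        have "(\<integral>\<^sup>+x. ennreal (\<bar>q y\<bar> / y\<^sup>2) * (if 0 < x \<and> x < y \<and> y < 1/8 then 1 else 0) \<partial>lborel)
          = (\<integral>\<^sup>+x. ennreal (\<bar>q y\<bar> / y\<^sup>2) * indicator {0<..<y} x \<partial>lborel)"
          using True by (intro nn_integral_cong) (auto split: split_indicator)
        also have "\<dots> = ennreal (\<bar>q y\<bar> / y\<^sup>2) * ennreal y" using True by (subst nn_integral_cmult_indicator) auto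
        also have "\<dots> = ennreal (\<bar>q y\<bar> / y)"
          using True by (subst ennreal_mult[symmetric]) (auto simp: power2_eq_square)
        finally show ?thesis using True by simp
      next
        case False
        then have "(if 0 < x \<and> x < y \<and> y < 1/8 then 1 else 0) = (0::ennreal)" for x by auto
        then show ?thesis using False by simp
      qed
    qed
    finally show ?thesis .
  qed
  also have "ennreal (16 * \<delta>) * emeasure lborel {0<..<1/8::real} + ?R + ?R \<le> ennreal (16 * \<delta>) * ennreal (1/8) + ennreal (7 * \<delta>) + ennreal (7 * \<delta>)"
    by (intro add_mono q_integral) auto
  also have "\<dots> = ennreal (16 * \<delta>)"
    using delta by (simp add: ennreal_mult[symmetric] ennreal_plus[symmetric] del: ennreal_plus)
  finally show ?thesis .
qed

end

section \<open>Stability in weighted spaces\<close>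

text \<open>
  The tangent to the logarithm at \<open>8 (k + 1)\<close>.
\<close>

lemma powr_le_exp:
  fixes k :: real
  assumes "0 \<le> k"
  shows "\<exists>A\<ge>0. \<forall>x\<ge>0. (1 + x) powr k \<le> A * exp (x / 8)"
proof -
  define c where "c = 8 * (k + 1)"
  have c: "0 < c" using assms by (simp add: c_def)
  have "(1 + x) powr k \<le> exp (k * ln c) * exp 1 * exp (x / 8)" if x: "0 \<le> x" for x
  proof -
    have "ln ((1 + x) / c) \<le> (1 + x) / c - 1" using x c by (intro ln_le_minus_one) auto
    then have "ln (1 + x) \<le> ln c + (1 + x) / c" using x c by (simp add: ln_div)
    then have "k * ln (1 + x) \<le> k * (ln c + (1 + x) / c)" using assms by (rule mult_left_mono)
    also have "\<dots> = k * ln c + k / c * (1 + x)" by (simp add: distrib_left add_divide_distrib)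
    also have "k / c * (1 + x) \<le> 1 / 8 * (1 + x)"
      using x c assms by (intro mult_right_mono) (auto simp: c_def field_simps)
    also have "\<dots> \<le> 1 + x / 8" using x by simp
    finally have "exp (k * ln (1 + x)) \<le> exp (k * ln c + (1 + x / 8))" by simp
    then show ?thesis using x by (simp add: powr_def exp_add mult_ac)
  qed
  then show ?thesis by (intro exI[of _ "exp (k * ln c) * exp 1"]) auto
qed

lemma nn_integral_exp_eighth:
  "(\<integral>\<^sup>+x. ennreal (c * exp (- (x / 8))) * indicator {0<..} x \<partial>lborel) = ennreal (8 * c)" if "0 \<le> c" for c :: real
proof -
  have "((\<lambda>x::real. exp (- (1/8) * x)) has_integral exp (- (1/8) * 0) / (1/8)) {0..}"
    by (rule has_integral_exp_minus_to_infinity) simp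
  from has_integral_mult_right[OF this, of c]
  have "(\<integral>\<^sup>+x. ennreal (c * exp (- (1/8) * x)) * indicator {0..} x \<partial>lborel) = ennreal (c * (exp (- (1/8) * 0) / (1/8)))"
    using that by (intro nn_integral_has_integral_lebesgue') auto
  moreover have "(\<integral>\<^sup>+x. ennreal (c * exp (- (1/8) * x)) * indicator {0..} x \<partial>lborel) =
    (\<integral>\<^sup>+x. ennreal (c * exp (- (x / 8))) * indicator {0<..} x \<partial>lborel)"
    by (rule nn_integral_cong_AE)
       (use AE_lborel_singleton[of 0] in \<open>eventually_elim, auto split: split_indicator\<close>)
  ultimately show ?thesis by (simp add: mult.commute)
qed

context coagulation_profile begin

text \<open>
  The layer-cake formula reduces this to the exponential moment of the tail.
\<close>

lemma exp_moment_H: "(\<integral>\<^sup>+x. ennreal (exp (x / 8) * H x) \<partial>lborel) \<le> ennreal 11"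
proof -
  have "(\<integral>\<^sup>+x. ennreal (exp (x / 8) * H x) \<partial>lborel) \<le>
    (\<integral>\<^sup>+x. ennreal (H x) + (\<integral>\<^sup>+s. ennreal (H x) * (ennreal (exp (3/5 * s)) * (if 0 \<le> s \<and> s < x then 1 else 0)) \<partial>lborel) \<partial>lborel)"
  proof (intro nn_integral_mono)
    fix x
    show "ennreal (exp (x / 8) * H x) \<le> ennreal (H x) + (\<integral>\<^sup>+s. ennreal (H x) * (ennreal (exp (3/5 * s)) * (if 0 \<le> s \<and> s < x then 1 else 0)) \<partial>lborel)"
    proof (cases "0 < x")
      case True
      have h: "((\<lambda>s. 1/8 * exp (s / 8)) has_integral (exp (x / 8) - exp (0 / 8))) {0..x}"
        using True by (intro fundamental_theorem_of_calculus)
         (auto intro!: derivative_eq_intros simp: has_real_derivative_iff_has_vector_derivative[symmetric])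
      have "ennreal (exp (x / 8) - 1) = (\<integral>\<^sup>+s. ennreal (1/8 * exp (s / 8)) * indicator {0..x} s \<partial>lborel)"
        using nn_integral_has_integral_lebesgue'[OF _ h] by simp
      also have "\<dots> \<le> (\<integral>\<^sup>+s. ennreal (exp (3/5 * s)) * (if 0 \<le> s \<and> s < x then 1 else 0) \<partial>lborel)"
      proof (rule nn_integral_mono_AE)
        show "AE s in lborel. ennreal (1/8 * exp (s / 8)) * indicator {0..x} s \<le> ennreal (exp (3/5 * s)) * (if 0 \<le> s \<and> s < x then 1 else 0)"
          using AE_lborel_singleton[of x]
        proof eventually_elim
          case (elim s)
          have "1/8 * exp (s / 8) \<le> exp (3/5 * s)" if "0 \<le> s"
          proof -
            have "1/8 * exp (s / 8) \<le> 1 * exp (3/5 * s)" using that by (intro mult_mono) auto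
            then show ?thesis by simp
          qed
          then show ?case using elim by (auto intro!: ennreal_leI split: split_indicator)
        qed
      qed
      finally have 1: "ennreal (exp (x / 8) - 1) \<le> (\<integral>\<^sup>+s. ennreal (exp (3/5 * s)) * (if 0 \<le> s \<and> s < x then 1 else 0) \<partial>lborel)" .
      have "ennreal (exp (x / 8) * H x) = ennreal (H x) + ennreal (H x) * ennreal (exp (x / 8) - 1)"
      proof -
        have "exp (x / 8) * H x = H x + H x * (exp (x / 8) - 1)" by (simp add: algebra_simps)
        moreover have "0 \<le> exp (x / 8) - 1" using True by simp
        ultimately show ?thesis using H_nonneg[of x] by (simp only: ennreal_plus ennreal_mult mult_nonneg_nonneg)
      qed
      also have "\<dots> \<le> ennreal (H x) + ennreal (H x) * (\<integral>\<^sup>+s. ennreal (exp (3/5 * s)) * (if 0 \<le> s \<and> s < x then 1 else 0) \<partial>lborel)"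
        using 1 by (intro add_left_mono mult_left_mono) auto
      finally show ?thesis by (subst nn_integral_cmult) auto
    qed (simp add: H_zero)
  qed
  also have "\<dots> = (\<integral>\<^sup>+x. ennreal (H x) \<partial>lborel) + (\<integral>\<^sup>+x. (\<integral>\<^sup>+s. ennreal (H x) * (ennreal (exp (3/5 * s)) * (if 0 \<le> s \<and> s < x then 1 else 0)) \<partial>lborel) \<partial>lborel)"
    by (rule nn_integral_add) measurable
  also have "(\<integral>\<^sup>+x. ennreal (H x) \<partial>lborel) = ennreal (N 0)"
    unfolding N_0 by (intro nn_integral_eq_integral H_int AE_I2 H_nonneg)
  also have "(\<integral>\<^sup>+x. (\<integral>\<^sup>+s. ennreal (H x) * (ennreal (exp (3/5 * s)) * (if 0 \<le> s \<and> s < x then 1 else 0)) \<partial>lborel) \<partial>lborel)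
    = (\<integral>\<^sup>+s. (\<integral>\<^sup>+x. ennreal (H x) * (ennreal (exp (3/5 * s)) * (if 0 \<le> s \<and> s < x then 1 else 0)) \<partial>lborel) \<partial>lborel)"
    by (rule lborel_pair.Fubini') measurable
  also have "\<dots> = (\<integral>\<^sup>+s. ennreal (exp (3/5 * s)) * NE.Ne s \<partial>lborel)"
  proof (intro nn_integral_cong)
    fix s
    have "(\<integral>\<^sup>+x. ennreal (H x) * (ennreal (exp (3/5 * s)) * (if 0 \<le> s \<and> s < x then 1 else 0)) \<partial>lborel) =
      (\<integral>\<^sup>+x. (ennreal (exp (3/5 * s)) * indicator {0..} s) * (ennreal (H x) * indicator {s<..} x) \<partial>lborel)"
      by (intro nn_integral_cong) (auto simp: mult_ac split: split_indicator)
    also have "\<dots> = (ennreal (exp (3/5 * s)) * indicator {0..} s) * ennreal (N s)"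
      unfolding ennreal_N by (subst nn_integral_cmult) auto
    finally show "(\<integral>\<^sup>+x. ennreal (H x) * (ennreal (exp (3/5 * s)) * (if 0 \<le> s \<and> s < x then 1 else 0)) \<partial>lborel) = ennreal (exp (3/5 * s)) * NE.Ne s"
      by (simp add: NE.Ne_def mult_ac)
  qed
  also have "ennreal (N 0) + \<dots> \<le> ennreal 1 + 10"
    using N_le_1 by (intro add_mono NE.exp_moment ennreal_leI)
  also have "\<dots> = ennreal 11" by simp
  finally show ?thesis .
qed

text \<open>
  A bound that does not see \<open>\<epsilon>\<close>, for use when \<open>\<epsilon>\<close> is bounded below.
\<close>

lemma crude_bound:
  assumes A: "0 \<le> A" "\<And>x. 0 \<le> x \<Longrightarrow> (1 + x) powr k \<le> A * exp (x / 8)"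
  shows "(\<integral>\<^sup>+x. ennreal (\<bar>H x - exp (- x)\<bar> * (1 + x) powr k) * indicator {0<..} x \<partial>lborel) \<le> ennreal (19 * A)"
proof -
  have "(\<integral>\<^sup>+x. ennreal (\<bar>H x - exp (- x)\<bar> * (1 + x) powr k) * indicator {0<..} x \<partial>lborel)
    \<le> (\<integral>\<^sup>+x. ennreal A * ennreal (exp (x / 8) * H x) + ennreal (A * exp (- (x / 8))) * indicator {0<..} x \<partial>lborel)"
  proof (intro nn_integral_mono)
    fix x :: real
    show "ennreal (\<bar>H x - exp (- x)\<bar> * (1 + x) powr k) * indicator {0<..} x \<le> ennreal A * ennreal (exp (x / 8) * H x) + ennreal (A * exp (- (x / 8))) * indicator {0<..} x"
    proof (cases "0 < x")
      case True
      have "\<bar>H x - exp (- x)\<bar> * (1 + x) powr k \<le> (H x + exp (- x)) * (A * exp (x / 8))"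
        using True H_nonneg[of x] by (intro mult_mono A) (auto simp: abs_le_iff intro: add_nonneg_nonneg)
      also have "\<dots> = A * (exp (x / 8) * H x) + A * (exp (- x) * exp (x / 8))" by (simp add: algebra_simps)
      also have "exp (- x) * exp (x / 8) \<le> exp (- (x / 8))" using True by (simp add: exp_add[symmetric])
      finally have "\<bar>H x - exp (- x)\<bar> * (1 + x) powr k \<le> A * (exp (x / 8) * H x) + A * exp (- (x / 8))"
        using A(1) by (simp add: mult_left_mono)
      then have "ennreal (\<bar>H x - exp (- x)\<bar> * (1 + x) powr k) \<le> ennreal (A * (exp (x / 8) * H x) + A * exp (- (x / 8)))"
        by (rule ennreal_leI)
      also have "\<dots> = ennreal A * ennreal (exp (x / 8) * H x) + ennreal (A * exp (- (x / 8)))"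
        using A(1) H_nonneg[of x] by (simp add: ennreal_mult)
      finally show ?thesis using True by simp
    qed auto
  qed
  also have "\<dots> = ennreal A * (\<integral>\<^sup>+x. ennreal (exp (x / 8) * H x) \<partial>lborel) + ennreal (8 * A)"
    by (subst nn_integral_add, measurable, subst nn_integral_cmult, measurable, subst nn_integral_exp_eighth[OF A(1)], simp)
  also have "\<dots> \<le> ennreal A * ennreal 11 + ennreal (8 * A)"
    by (intro add_right_mono mult_left_mono exp_moment_H) auto
  also have "\<dots> = ennreal (A * 11 + 8 * A)"
    using A(1) by (subst ennreal_mult[symmetric], simp, simp, subst ennreal_plus[symmetric], auto)
  also have "A * 11 + 8 * A = 19 * A" by simp
  finally show ?thesis .
qed

end

context close_profile begin

lemma sharp_bound:
  assumes A: "0 \<le> A" "\<And>x. 0 \<le> x \<Longrightarrow> (1 + x) powr k \<le> A * exp (x / 8)" and k: "0 \<le> k"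
  shows "(\<integral>\<^sup>+x. ennreal (\<bar>H x - exp (- x)\<bar> * (1 + x) powr k) * indicator {0<..} x \<partial>lborel) \<le> ennreal (4192 * A * \<delta>)"
proof -
  have "(\<integral>\<^sup>+x. ennreal (\<bar>H x - exp (- x)\<bar> * (1 + x) powr k) * indicator {0<..} x \<partial>lborel)
    \<le> (\<integral>\<^sup>+x. ennreal (2 * A) * (ennreal \<bar>g x\<bar> * indicator {0<..<1/8} x) + ennreal (520 * \<delta> * A * exp (- (x / 8))) * indicator {0<..} x \<partial>lborel)"
  proof (rule nn_integral_mono_AE)
    show "AE x in lborel. ennreal (\<bar>H x - exp (- x)\<bar> * (1 + x) powr k) * indicator {0<..} x \<le>
      ennreal (2 * A) * (ennreal \<bar>g x\<bar> * indicator {0<..<1/8} x) + ennreal (520 * \<delta> * A * exp (- (x / 8))) * indicator {0<..} x"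
      using far_bound
    proof eventually_elim
      case (elim x)
      consider "x \<le> 0" | "0 < x" "x < 1/8" | "1/8 \<le> x" by linarith
      then show ?case
      proof cases
        case 2
        have "exp (x / 8) \<le> exp (1/2)" using 2 by simp
        also have "exp (1/2) \<le> (2::real)" by (rule exp_half_le2)
        finally have "A * exp (x / 8) \<le> A * 2" using A(1) by (rule mult_left_mono)
        then have "(1 + x) powr k \<le> 2 * A" using A(2)[of x] 2 by simp
        then have "\<bar>H x - exp (- x)\<bar> * (1 + x) powr k \<le> \<bar>g x\<bar> * (2 * A)"
          unfolding g_def by (intro mult_left_mono) auto
        then have "ennreal (\<bar>H x - exp (- x)\<bar> * (1 + x) powr k) \<le> ennreal (2 * A * \<bar>g x\<bar>)"
          by (intro ennreal_leI) (simp add: mult.commute)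
        also have "\<dots> = ennreal (2 * A) * ennreal \<bar>g x\<bar>" using A(1) by (intro ennreal_mult) auto
        finally show ?thesis using 2 by (simp add: add_increasing2)
      next
        case 3
        have "1/8 * \<bar>H x - exp (- x)\<bar> \<le> x * \<bar>H x - exp (- x)\<bar>" using 3 by (intro mult_right_mono) auto
        also have "\<dots> \<le> 65 * \<delta> * exp (- (x / 4))" using elim 3 by (simp add: abs_mult)
        finally have "\<bar>H x - exp (- x)\<bar> \<le> 520 * \<delta> * exp (- (x / 4))" by simp
        then have "\<bar>H x - exp (- x)\<bar> * (1 + x) powr k \<le> 520 * \<delta> * exp (- (x / 4)) * (A * exp (x / 8))"
          using 3 delta by (intro mult_mono A) auto
        also have "\<dots> = 520 * \<delta> * A * (exp (- (x / 4)) * exp (x / 8))" by simp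
        also have "exp (- (x / 4)) * exp (x / 8) = exp (- (x / 8))" by (simp add: exp_add[symmetric])
        finally have "ennreal (\<bar>H x - exp (- x)\<bar> * (1 + x) powr k) \<le> ennreal (520 * \<delta> * A * exp (- (x / 8)))"
          by (rule ennreal_leI)
        then show ?thesis using 3 by simp
      qed auto
    qed
  qed
  also have "\<dots> = ennreal (2 * A) * (\<integral>\<^sup>+x. ennreal \<bar>g x\<bar> * indicator {0<..<1/8} x \<partial>lborel) + ennreal (8 * (520 * \<delta> * A))"
    using A(1) delta by (subst nn_integral_add, measurable, subst nn_integral_cmult, measurable, subst nn_integral_exp_eighth, auto)
  also have "\<dots> \<le> ennreal (2 * A) * ennreal (16 * \<delta>) + ennreal (8 * (520 * \<delta> * A))"
    by (intro add_right_mono mult_left_mono near_integral) auto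
  also have "\<dots> = ennreal (2 * A * (16 * \<delta>) + 8 * (520 * \<delta> * A))"
    using A(1) delta by (subst ennreal_mult[symmetric], simp, simp, subst ennreal_plus[symmetric], auto)
  also have "2 * A * (16 * \<delta>) + 8 * (520 * \<delta> * A) = 4192 * A * \<delta>" by simp
  finally show ?thesis .
qed

end

text \<open>
  The constant combines the linear regime with the regime where \<open>\<epsilon>\<close> exceeds the threshold \<open>e'\<close> and
  \<open>19 A \<le> (19 A / e') \<epsilon>\<close>.
\<close>

theorem profile_stability:
  fixes k :: real
  assumes k: "0 \<le> k"
  shows "\<exists>D\<ge>0. \<forall>H w \<epsilon>. coagulation_profile H w \<epsilon> \<longrightarrow>
    (\<integral>\<^sup>+x. ennreal (\<bar>H x - exp (- x)\<bar> * (1 + x) powr k) * indicator {0<..} x \<partial>lborel) \<le> ennreal (D * \<epsilon>)"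
proof -
  obtain A where A: "0 \<le> A" "\<And>x. 0 \<le> x \<Longrightarrow> (1 + x) powr k \<le> A * exp (x / 8)"
    using powr_le_exp[OF k] by auto
  obtain e where e: "e > 0" "\<And>N \<epsilon> x. near_exponential N \<epsilon> \<Longrightarrow> \<epsilon> \<le> e \<Longrightarrow> 0 \<le> x \<Longrightarrow> \<bar>N x - exp (- x)\<bar> \<le> 3620 * \<epsilon> * exp (- (x / 2))"
    using near_exponential_stable by blast
  \<comment> \<open>The second bound makes \<open>\<delta> = 3620 \<epsilon>\<close> at most \<open>1/8\<close>.\<close>
  define e' where "e' = min e (1 / (8 * 3620))"
  have e': "0 < e'" "e' \<le> e" "e' \<le> 1 / (8 * 3620)" using e by (auto simp: e'_def)
  define D where "D = 4192 * A * 3620 + 19 * A / e'"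
  have D: "0 \<le> D" "4192 * A * 3620 \<le> D" "19 * A / e' \<le> D" using A e' by (auto simp: D_def)
  show ?thesis
  proof (intro exI[of _ D] conjI D(1) allI impI)
    fix H w \<epsilon> assume "coagulation_profile H w \<epsilon>"
    then interpret coagulation_profile H w \<epsilon> .
    show "(\<integral>\<^sup>+x. ennreal (\<bar>H x - exp (- x)\<bar> * (1 + x) powr k) * indicator {0<..} x \<partial>lborel) \<le> ennreal (D * \<epsilon>)"
    proof (cases "\<epsilon> \<le> e'")
      case True
      interpret close_profile H w \<epsilon> "3620 * \<epsilon>"
      proof
        show "\<bar>NE.n x\<bar> \<le> 3620 * \<epsilon> * exp (- (x / 2))" if "0 \<le> x" for x
          unfolding NE.n_def using True e' that by (intro e(2) near_exponential_N) auto
      qed (use True e' eps in auto)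
      note sharp_bound[OF A k]
      also have "ennreal (4192 * A * (3620 * \<epsilon>)) \<le> ennreal (D * \<epsilon>)"
        using mult_right_mono[OF D(2) eps(1)] by (intro ennreal_leI) simp
      finally show ?thesis .
    next
      case False
      note crude_bound[OF A]
      also have "ennreal (19 * A) \<le> ennreal (D * \<epsilon>)"
      proof (rule ennreal_leI)
        have "19 * A = 19 * A / e' * e'" using e' by simp
        also have "\<dots> \<le> D * \<epsilon>" using D e' False A by (intro mult_mono) auto
        finally show "19 * A \<le> D * \<epsilon>" .
      qed
      finally show ?thesis .
    qed
  qed
qed

section \<open>From mild to integrated solutions\<close>

text \<open>
  Passage from Lebesgue measurable data to Borel representatives.
\<close>

lemma integral_lebesgue_eq_lborel:
  fixes f h :: "real \<Rightarrow> real"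
  assumes h: "h \<in> borel_measurable borel" and ae: "AE x in lborel. f x = h x"
  shows "integral\<^sup>L lebesgue f = integral\<^sup>L lborel h"
proof -
  have hl: "h \<in> borel_measurable lebesgue" using h by (intro measurable_completion) simp
  have ae': "AE x in lebesgue. h x = f x" using ae by (auto simp: AE_completion_iff)
  then have "f \<in> borel_measurable lebesgue" using hl borel_measurable_AE by blast
  then have "integral\<^sup>L lebesgue f = integral\<^sup>L lebesgue h"
    using hl ae' by (intro integral_cong_AE) auto
  also have "\<dots> = integral\<^sup>L lborel h" using h by (intro integral_completion) simp
  finally show ?thesis .
qed

lemma AE_affine:
  fixes c t :: real
  assumes c: "c \<noteq> 0" and ae: "AE x in lborel. P x"
  shows "AE x in lborel. P (t + c * x)"
proof -
  obtain Z where Z: "{x. \<not> P x} \<subseteq> Z" "emeasure lborel Z = 0" "Z \<in> sets lborel"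
    using AE_E[OF ae] by auto
  have "AE x in lborel. x \<notin> Z" using Z by (intro AE_not_in) (auto simp: null_sets_def)
  then have "AE x in lborel. t + c * x \<notin> Z"
    by (rule AE_borel_affine[OF c, rotated]) (use Z in measurable)
  then show ?thesis by eventually_elim (use Z in blast)
qed

text \<open>
  The orbit \<open>s \<mapsto> exp (t - s) x\<close> of a fixed point under dilations is a diffeomorphism onto its image, so it
  meets a null set only for a null set of times. Its negative is increasing, as the substitution rule requires.
\<close>

lemma AE_exponential:
  fixes x t :: real
  assumes x: "0 < x" and t: "0 \<le> t" and ae: "AE y in lborel. P y"
  shows "AE s in lborel. 0 \<le> s \<longrightarrow> s \<le> t \<longrightarrow> P (exp (t - s) * x)"
proof -
  obtain Z where Z: "{x. \<not> P x} \<subseteq> Z" "emeasure lborel Z = 0" "Z \<in> sets lborel"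
    using AE_E[OF ae] by auto
  have Zb[measurable]: "Z \<in> sets borel" using Z by simp
  define gm where "gm s = - (exp (t - s) * x)" for s
  have gd: "(gm has_real_derivative exp (t - s) * x) (at s)" for s
    unfolding gm_def by (auto intro!: derivative_eq_intros)
  have [measurable]: "(\<lambda>y::real. indicator Z (- y) :: real) \<in> borel_measurable borel" by measurable
  have "(\<integral>\<^sup>+s. ennreal (indicator Z (- gm s) * (exp (t - s) * x) * indicator {0..t} s) \<partial>lborel) =
    (\<integral>\<^sup>+y. ennreal (indicator Z (- y) * indicator {gm 0..gm t} y) \<partial>lborel)"
    by (rule nn_integral_substitution[symmetric, OF _ gd])
       (auto simp: t x set_borel_measurable_def intro!: continuous_intros less_imp_le)
  also have "\<dots> = (\<integral>\<^sup>+(y::real). 0 \<partial>lborel)"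
  proof (rule nn_integral_cong_AE)
    have "AE y in lborel. y \<notin> Z" using Z by (intro AE_not_in) (auto simp: null_sets_def)
    from AE_affine[OF _ this, of "-1" 0] have "AE y in lborel. - y \<notin> Z" by simp
    then show "AE y in lborel. ennreal (indicator Z (- y) * indicator {gm 0..gm t} y) = 0" by eventually_elim simp
  qed
  finally have "(\<integral>\<^sup>+s. ennreal (indicator Z (- gm s) * (exp (t - s) * x) * indicator {0..t} s) \<partial>lborel) = 0" by simp
  then have "AE s in lborel. ennreal (indicator Z (- gm s) * (exp (t - s) * x) * indicator {0..t} s) = 0"
    by (subst (asm) nn_integral_0_iff_AE) (auto simp: gm_def)
  then show ?thesis
  proof eventually_elim
    case (elim s)
    show ?case
    proof (intro impI)
      assume s: "0 \<le> s" "s \<le> t"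
      then have "indicator Z (- gm s) * (exp (t - s) * x) \<le> 0" using elim by (simp add: ennreal_eq_0_iff)
      then have "indicat_real Z (- gm s) = 0" using x by (auto simp: mult_le_0_iff zero_le_mult_iff split: split_indicator_asm)
      then have "exp (t - s) * x \<notin> Z" by (auto simp: gm_def split: split_indicator_asm)
      then show "P (exp (t - s) * x)" using Z by blast
    qed
  qed
qed

text \<open>
  The substitution \<open>u = exp (t - s) x\<close> turns the Duhamel integral into an integral over sizes.
\<close>

lemma integral_dilation:
  fixes C :: "real \<Rightarrow> real"
  assumes C[measurable]: "C \<in> borel_measurable borel" and Ci: "integrable lborel (\<lambda>u. u * C u)" and x: "0 < x" and t: "0 \<le> t"
  shows "(\<integral>s. indicator {0..t} s * (exp (2 * (t - s)) * C (exp (t - s) * x)) \<partial>lborel) =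
    1 / x\<^sup>2 * (\<integral>u. indicator {x..exp t * x} u * (u * C u) \<partial>lborel)"
proof -
  define gm where "gm s = - (exp (t - s) * x)" for s
  have gd: "(gm has_real_derivative exp (t - s) * x) (at s)" for s
    unfolding gm_def by (auto intro!: derivative_eq_intros)
  define f where "f y = (1 / x\<^sup>2) * (- y * C (- y))" for y
  have "integrable lborel (\<lambda>y. - y * C (- y))"
    using lborel_integrable_real_affine_iff[of "-1" "\<lambda>u. u * C u" 0] Ci by simp
  then have "integrable lborel f" unfolding f_def by (rule integrable_mult_right)
  then have fi: "set_integrable lborel {gm 0..gm t} f"
    unfolding set_integrable_def by (intro integrable_mult_indicator) auto
  have "(LBINT s. f (gm s) * (exp (t - s) * x) * indicator {0..t} s) = (LBINT y. f y * indicator {gm 0..gm t} y)"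
    by (rule integral_substitution(2)[symmetric, OF fi gd]) (auto simp: t x intro!: continuous_intros less_imp_le)
  moreover have "f (gm s) * (exp (t - s) * x) * indicator {0..t} s = indicator {0..t} s * (exp (2 * (t - s)) * C (exp (t - s) * x))" for s
  proof -
    have "exp (2 * (t - s)) = exp (t - s) * exp (t - s)" by (simp add: exp_add[symmetric])
    then show ?thesis using x by (simp add: f_def gm_def power2_eq_square)
  qed
  moreover have "(LBINT y. f y * indicator {gm 0..gm t} y) = (LBINT u. f (- u) * indicator {gm 0..gm t} (- u))"
    using lborel_integral_real_affine[of "-1" "\<lambda>y. f y * indicator {gm 0..gm t} y" 0] by simp
  moreover have "f (- u) * indicator {gm 0..gm t} (- u) = 1 / x\<^sup>2 * (indicator {x..exp t * x} u * (u * C u))" for u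
    by (auto simp: f_def gm_def split: split_indicator)
  ultimately show ?thesis by simp
qed

lemma tail_integral_tendsto_0:
  fixes f :: "real \<Rightarrow> real"
  assumes f: "integrable lborel f"
  shows "((\<lambda>X. \<integral>x. indicator {X<..} x * f x \<partial>lborel) \<longlongrightarrow> 0) at_top"
proof -
  have "((\<lambda>X. (\<integral>x. f x \<partial>lborel) - (\<integral>x. indicator {..X} x *\<^sub>R f x \<partial>lborel)) \<longlongrightarrow> (\<integral>x. f x \<partial>lborel) - (\<integral>x. f x \<partial>lborel)) at_top"
    by (intro tendsto_intros tendsto_integral_at_top) (auto simp: f)
  moreover have "(\<integral>x. f x \<partial>lborel) - (\<integral>x. indicator {..X} x *\<^sub>R f x \<partial>lborel) = (\<integral>x. indicator {X<..} x * f x \<partial>lborel)" for X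
  proof -
    have "integrable lborel (\<lambda>x. indicator {..X} x *\<^sub>R f x)" by (rule integrable_mult_indicator[OF _ f]) simp
    from Bochner_Integration.integral_diff[OF f this, symmetric]
    have "(\<integral>x. f x \<partial>lborel) - (\<integral>x. indicator {..X} x *\<^sub>R f x \<partial>lborel) = (\<integral>x. f x - indicator {..X} x *\<^sub>R f x \<partial>lborel)" .
    also have "\<dots> = (\<integral>x. indicator {X<..} x * f x \<partial>lborel)"
      by (intro Bochner_Integration.integral_cong) (auto split: split_indicator)
    finally show ?thesis .
  qed
  ultimately show ?thesis by simp
qed

text \<open>
  Let \<open>L = x\<^sup>2 H - T\<close>. If \<open>L(x) = L(2\<^sup>m x)\<close> for all \<open>m\<close>, the integral of \<open>\<bar>L\<bar> / x\<close> over a compact interval equals that over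
  its dilate by \<open>2\<^sup>m\<close>, which tends to zero since \<open>x H\<close> is integrable and \<open>T\<close> decays. Hence \<open>L\<close> vanishes.
\<close>

lemma scaling_invariant_zero:
  fixes H T :: "real \<Rightarrow> real"
  assumes [measurable]: "H \<in> borel_measurable borel" "T \<in> borel_measurable borel"
    and H0: "\<And>x. 0 \<le> H x" and Hi: "integrable lborel (\<lambda>x. x * H x)"
    and T: "\<And>x. 0 < x \<Longrightarrow> \<bar>T x\<bar> \<le> \<tau> x" and \<tau>: "\<And>x y. 0 < x \<Longrightarrow> x \<le> y \<Longrightarrow> \<tau> y \<le> \<tau> x" "(\<tau> \<longlongrightarrow> 0) at_top"
    and inv: "\<And>m::nat. AE x in lborel. 0 < x \<longrightarrow> x\<^sup>2 * H x - T x = (2^m * x)\<^sup>2 * H (2^m * x) - T (2^m * x)"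
  shows "AE x in lborel. 0 < x \<longrightarrow> x\<^sup>2 * H x = T x"
proof -
  have main: "AE x in lborel. a \<le> x \<longrightarrow> x \<le> b \<longrightarrow> x\<^sup>2 * H x = T x" if a: "0 < a" and ab: "a \<le> b" for a b
  proof -
    define f where "f x = indicator {a..b} x * (\<bar>x\<^sup>2 * H x - T x\<bar> / x)" for x :: real
    have [measurable]: "f \<in> borel_measurable borel" unfolding f_def by measurable
    define R where "R X = (\<integral>y. indicator {X<..} y * (y * H y) \<partial>lborel)" for X
    have R: "(R \<longlongrightarrow> 0) at_top" unfolding R_def by (rule tail_integral_tendsto_0[OF Hi])
    \<comment> \<open>The half accounts for the strict inequality in the indicator of the tail.\<close>
    have pw: "filterlim (\<lambda>m::nat. 2^m * a / 2) at_top sequentially" "filterlim (\<lambda>m::nat. 2^m * a) at_top sequentially"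
      using a by real_asymp+
    have le: "(\<integral>\<^sup>+x. ennreal (f x) \<partial>lborel) \<le> ennreal (R (2^m * a / 2) + \<tau> (2^m * a) / a * (b - a))" for m :: nat
    proof -
      let ?c = "2^m :: real"
      have c: "0 < ?c" by simp
      have t0: "0 \<le> \<tau> (?c * a)" using T[of "?c * a"] a by (smt (verit) c mult_pos_pos)
      have int: "integrable lborel (\<lambda>y. indicator {?c * a / 2<..} y * (y * H y))"
        using integrable_mult_indicator[OF _ Hi, of "{?c * a / 2<..}"] by simp
      have "(\<integral>\<^sup>+x. ennreal (f x) \<partial>lborel) \<le>
        (\<integral>\<^sup>+x. ennreal ?c * ennreal (indicator {?c * a / 2<..} (?c * x) * ((?c * x) * H (?c * x))) + ennreal (\<tau> (?c * a) / a) * indicator {a..b} x \<partial>lborel)"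
      proof (rule nn_integral_mono_AE)
        show "AE x in lborel. ennreal (f x) \<le> ennreal ?c * ennreal (indicator {?c * a / 2<..} (?c * x) * ((?c * x) * H (?c * x))) + ennreal (\<tau> (?c * a) / a) * indicator {a..b} x"
          using inv[of m]
        proof eventually_elim
          case (elim x)
          show ?case
          proof (cases "a \<le> x \<and> x \<le> b")
            case True
            then have x: "0 < x" using a by simp
            have cx: "?c * a / 2 < ?c * x" using True a c by (auto simp: field_simps)
            have "\<bar>x\<^sup>2 * H x - T x\<bar> \<le> \<bar>(?c * x)\<^sup>2 * H (?c * x)\<bar> + \<bar>T (?c * x)\<bar>"
              using elim x by (metis abs_triangle_ineq4)
            also have "\<bar>T (?c * x)\<bar> \<le> \<tau> (?c * x)" using x by (intro T) auto
            also have "\<tau> (?c * x) \<le> \<tau> (?c * a)" using True a by (intro \<tau>) auto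
            finally have "\<bar>x\<^sup>2 * H x - T x\<bar> / x \<le> ((?c * x)\<^sup>2 * H (?c * x) + \<tau> (?c * a)) / x"
              using x H0 by (intro divide_right_mono) auto
            also have "\<dots> = ?c * ((?c * x) * H (?c * x)) + \<tau> (?c * a) / x"
              using x by (simp add: add_divide_distrib power2_eq_square)
            also have "\<dots> \<le> ?c * ((?c * x) * H (?c * x)) + \<tau> (?c * a) / a"
              using True a t0 by (intro add_left_mono divide_left_mono) auto
            finally have "f x \<le> ?c * ((?c * x) * H (?c * x)) + \<tau> (?c * a) / a" using True by (simp add: f_def)
            then have "ennreal (f x) \<le> ennreal (?c * ((?c * x) * H (?c * x)) + \<tau> (?c * a) / a)" by (rule ennreal_leI)
            also have "\<dots> = ennreal ?c * ennreal ((?c * x) * H (?c * x)) + ennreal (\<tau> (?c * a) / a)"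
              using x H0[of "?c * x"] t0 a by (subst ennreal_plus) (auto simp: ennreal_mult)
            finally show ?thesis using True cx by simp
          next
            case False then show ?thesis by (auto simp: f_def)
          qed
        qed
      qed
      also have "\<dots> = ennreal ?c * (\<integral>\<^sup>+x. ennreal (indicator {?c * a / 2<..} (?c * x) * ((?c * x) * H (?c * x))) \<partial>lborel) + ennreal (\<tau> (?c * a) / a) * ennreal (b - a)"
        using ab by (subst nn_integral_add, measurable, subst nn_integral_cmult, measurable, subst nn_integral_cmult_indicator, auto)
      also have "ennreal ?c * (\<integral>\<^sup>+x. ennreal (indicator {?c * a / 2<..} (?c * x) * ((?c * x) * H (?c * x))) \<partial>lborel) =
        (\<integral>\<^sup>+y. ennreal (indicator {?c * a / 2<..} y * (y * H y)) \<partial>lborel)"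
        by (subst nn_integral_real_affine[where c="?c" and t=0, of "\<lambda>y. ennreal (indicator {?c * a / 2<..} y * (y * H y))"]) auto
      also have "\<dots> = ennreal (R (?c * a / 2))"
        unfolding R_def
      proof (intro nn_integral_eq_integral int AE_I2)
        fix y
        have "0 < y" if "?c * a / 2 < y" using that a c by (smt (verit) divide_pos_pos mult_pos_pos)
        then show "0 \<le> indicator {?c * a / 2<..} y * (y * H y)" using H0[of y] by (auto split: split_indicator)
      qed
      also have "ennreal (R (?c * a / 2)) + ennreal (\<tau> (?c * a) / a) * ennreal (b - a) = ennreal (R (?c * a / 2) + \<tau> (?c * a) / a * (b - a))"
      proof -
        have "0 \<le> R (?c * a / 2)"
          unfolding R_def
        proof (intro integral_nonneg_AE AE_I2)
          fix y
          have "0 < y" if "?c * a / 2 < y" using that a c by (smt (verit) divide_pos_pos mult_pos_pos)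
          then show "0 \<le> indicator {?c * a / 2<..} y * (y * H y)" using H0[of y] by (auto split: split_indicator)
        qed
        then show ?thesis using t0 a ab by (subst ennreal_mult[symmetric], simp, simp, subst ennreal_plus[symmetric], auto)
      qed
      finally show ?thesis .
    qed
    have "(\<lambda>m::nat. ennreal (R (2^m * a / 2) + \<tau> (2^m * a) / a * (b - a))) \<longlonglongrightarrow> ennreal (0 + 0 / a * (b - a))"
      using a by (intro tendsto_ennrealI tendsto_intros filterlim_compose[OF R pw(1)] filterlim_compose[OF \<tau>(2) pw(2)]) auto
    then have "(\<integral>\<^sup>+x. ennreal (f x) \<partial>lborel) \<le> ennreal (0 + 0 / a * (b - a))"
      using le by (intro LIMSEQ_le_const) auto
    then have "AE x in lborel. ennreal (f x) = 0"
      by (subst nn_integral_0_iff_AE[symmetric]) auto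
    then show ?thesis
    proof eventually_elim
      case (elim x)
      show ?case
      proof (intro impI)
        assume "a \<le> x" "x \<le> b"
        then have "\<bar>x\<^sup>2 * H x - T x\<bar> / x \<le> 0" "0 < x" using elim a by (auto simp: f_def ennreal_eq_0_iff)
        then show "x\<^sup>2 * H x = T x" by (simp add: divide_le_0_iff)
      qed
    qed
  qed
  have "AE x in lborel. \<forall>j::nat. 1 / real (Suc j) \<le> x \<longrightarrow> x \<le> real (Suc j) \<longrightarrow> x\<^sup>2 * H x = T x"
    unfolding AE_all_countable
  proof
    fix j :: nat
    have "1 / real (Suc j) \<le> 1" by simp
    also have "1 \<le> real (Suc j)" by simp
    finally show "AE x in lborel. 1 / real (Suc j) \<le> x \<longrightarrow> x \<le> real (Suc j) \<longrightarrow> x\<^sup>2 * H x = T x"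
      by (intro main) auto
  qed
  then show ?thesis
  proof eventually_elim
    case (elim x)
    show ?case
    proof
      assume x: "0 < x"
      obtain j where j: "max x (1 / x) < real j" using reals_Archimedean2 by blast
      then have "x \<le> real (Suc j)" "1 / x \<le> real (Suc j)" by auto
      then have "1 / real (Suc j) \<le> x" using x by (simp add: field_simps)
      then show "x\<^sup>2 * H x = T x" using elim \<open>x \<le> real (Suc j)\<close> by blast
    qed
  qed
qed

text \<open>
  For \<open>t = m ln 2\<close> the mild equation states that \<open>x\<^sup>2 H - \<integral>\<^sub>x\<^sup>\<infinity> u C(u) du\<close> is invariant under dilation by
  \<open>2\<^sup>m\<close>, so this quantity is zero, which is the integrated stationary equation.
\<close>

lemma profile_representative:
  assumes W: "continuous_on ({0<..} \<times> {0<..}) (\<lambda>(x, y). W x y)"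
    and W_sym: "\<forall>x>0. \<forall>y>0. W x y = W y x"
    and W_bounds: "\<forall>x>0. \<forall>y>0. 0 \<le> W x y \<and> W x y \<le> 1"
    and eps: "0 \<le> \<epsilon>" "\<epsilon> \<le> 1"
    and profile: "self_similar_profile (\<lambda>x y. 2 + \<epsilon> * W x y) G"
  obtains H w where "coagulation_profile H w \<epsilon>" "AE x in lborel. 0 < x \<longrightarrow> G x = H x"
proof -
  define KW where "KW x y = 2 + \<epsilon> * W x y" for x y :: real
  define w where "w a b = (if 0 < a \<and> 0 < b then W a b else 0)" for a b :: real
  have "(\<lambda>p. indicator ({0<..} \<times> {0<..}) p *\<^sub>R (\<lambda>(x, y). W x y) p) \<in> borel_measurable borel"
    by (rule borel_measurable_continuous_on_indicator[OF _ W])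
       (intro borel_open open_Times open_greaterThan)
  moreover have "(\<lambda>p. indicator ({0<..} \<times> {0<..}) p *\<^sub>R (\<lambda>(x, y). W x y) p) = (\<lambda>(a, b). w a b)"
    by (auto simp: w_def fun_eq_iff split: split_indicator)
  ultimately have w_meas: "(\<lambda>(a, b). w a b) \<in> borel_measurable (borel \<Otimes>\<^sub>M borel)"
    by (simp add: borel_prod)
  have G: "in_L1 1 G" "AE x in lebesgue. x > 0 \<longrightarrow> G x \<ge> 0" "(LINT x:{0<..}|lebesgue. x * G x) = 1"
    "stationary_mild_solution KW G"
    using profile by (auto simp: self_similar_profile_def KW_def[abs_def])
  have Gm: "(\<lambda>x. indicator {0<..} x *\<^sub>R G x) \<in> borel_measurable lebesgue"
    using G(1) by (simp add: in_L1_def set_borel_measurable_def)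
  obtain g0 where g0: "g0 \<in> borel_measurable lborel" "AE x in lborel. indicator {0<..} x *\<^sub>R G x = g0 x"
    using completion_ex_borel_measurable_real[OF Gm] by auto
  define H where "H x = indicator {0<..} x * max 0 (g0 x)" for x
  have Hm[measurable]: "H \<in> borel_measurable borel" unfolding H_def using g0(1) by measurable
  have H0: "0 \<le> H x" for x by (simp add: H_def)
  have Hz: "H x = 0" if "x \<le> 0" for x using that by (simp add: H_def)
  have GH: "AE x in lborel. 0 < x \<longrightarrow> G x = H x"
    using g0(2) G(2)[unfolded AE_completion_iff] by eventually_elim (auto simp: H_def)
  have L1: "(\<integral>\<^sup>+x. ennreal (H x * (1 + \<bar>x\<bar>)) \<partial>lborel) < \<infinity>"
  proof -
    have "(\<integral>\<^sup>+x. ennreal (H x * (1 + \<bar>x\<bar>)) \<partial>lborel) = (\<integral>\<^sup>+x\<in>{0<..}. ennreal (\<bar>G x\<bar> * (1 + x) powr 1) \<partial>lborel)"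
      by (rule nn_integral_cong_AE)
        (use GH in \<open>eventually_elim, auto simp: H0 Hz split: split_indicator\<close>)
    also have "\<dots> = L1_norm 1 G" by (simp add: L1_norm_def nn_integral_completion)
    finally show ?thesis using G(1) by (simp add: in_L1_def)
  qed
  have i: "integrable lborel (\<lambda>x. H x * (1 + \<bar>x\<bar>))"
    using L1 by (intro integrableI_nonneg) (auto simp: H0)
  have Hi: "integrable lborel H" and xHi: "integrable lborel (\<lambda>x. x * H x)"
  proof -
    have "\<bar>H x\<bar> \<le> \<bar>H x * (1 + \<bar>x\<bar>)\<bar>" "\<bar>x * H x\<bar> \<le> \<bar>H x * (1 + \<bar>x\<bar>)\<bar>" for x
      using H0[of x] by (simp_all add: abs_mult distrib_left mult.commute)
    then show "integrable lborel H" "integrable lborel (\<lambda>x. x * H x)"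
      by (auto intro!: Bochner_Integration.integrable_bound[OF i])
  qed
  have mass: "(\<integral>x. x * H x \<partial>lborel) = 1"
  proof -
    have "(LINT x:{0<..}|lebesgue. x * G x) = (\<integral>x. x * H x \<partial>lborel)"
      unfolding set_lebesgue_integral_def
    proof (rule integral_lebesgue_eq_lborel)
      show "AE x in lborel. indicator {0<..} x *\<^sub>R (x * G x) = x * H x"
        using GH by eventually_elim (auto simp: Hz split: split_indicator)
    qed measurable
    then show ?thesis using G(3) by simp
  qed
  interpret coagulation_tail H w \<epsilon>
  proof
    show "w a b = w b a" "0 \<le> w a b" "w a b \<le> 1" for a b
      using W_sym W_bounds by (auto simp: w_def)
  qed (use H0 Hz Hi xHi mass w_meas eps in auto)
  have Cm[measurable]: "C \<in> borel_measurable borel"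
    using C_integrable(1) by (auto dest: borel_measurable_integrable)
  have KWK: "KW a b = K a b" if "0 < a" "0 < b" for a b using that by (simp add: KW_def K_def w_def)
  have coag: "coag KW G u = C u" if u: "0 < u" "G u = H u" for u
  proof -
    have "(LINT y:{0<..<u}|lebesgue. KW (u - y) y * G (u - y) * G y) = (\<integral>y. K (u - y) y * H (u - y) * H y \<partial>lborel)"
      unfolding set_lebesgue_integral_def
    proof (rule integral_lebesgue_eq_lborel)
      have "AE y in lborel. 0 < u + -1 * y \<longrightarrow> G (u + -1 * y) = H (u + -1 * y)"
        by (rule AE_affine[OF _ GH]) simp
      with GH show "AE y in lborel. indicator {0<..<u} y *\<^sub>R (KW (u - y) y * G (u - y) * G y) = K (u - y) y * H (u - y) * H y"
      proof eventually_elim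
        case (elim y)
        show ?case
        proof (cases "0 < y \<and> y < u")
          case True then show ?thesis using elim KWK[of "u - y" y] by simp
        next
          case False
          then have "H (u - y) = 0 \<or> H y = 0" using Hz by (auto simp: not_less)
          then show ?thesis using False by auto
        qed
      qed
    qed measurable
    moreover have "(LINT y:{0<..}|lebesgue. KW u y * G y) = (\<integral>y. K u y * H y \<partial>lborel)"
      unfolding set_lebesgue_integral_def
    proof (rule integral_lebesgue_eq_lborel)
      show "AE y in lborel. indicator {0<..} y *\<^sub>R (KW u y * G y) = K u y * H y"
        using GH by eventually_elim (use u KWK[of u] Hz in \<open>auto split: split_indicator\<close>)
    qed measurable
    ultimately show ?thesis using u(2) by (simp add: coag_def C_def)
  qed
  have coag_AE: "AE u in lborel. 0 < u \<longrightarrow> coag KW G u = C u"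
    using GH by eventually_elim (use coag in auto)
  have duhamel: "(LINT s:{0..t}|lebesgue. dilation (t - s) (coag KW G) x) =
      1 / x\<^sup>2 * (\<integral>u. indicator {x..exp t * x} u * (u * C u) \<partial>lborel)" if x: "0 < x" and t: "0 \<le> t" for x t
  proof -
    have "(LINT s:{0..t}|lebesgue. dilation (t - s) (coag KW G) x) =
       (\<integral>s. indicator {0..t} s * (exp (2 * (t - s)) * C (exp (t - s) * x)) \<partial>lborel)"
      unfolding set_lebesgue_integral_def
    proof (rule integral_lebesgue_eq_lborel)
      show "AE s in lborel. indicator {0..t} s *\<^sub>R dilation (t - s) (coag KW G) x = indicator {0..t} s * (exp (2 * (t - s)) * C (exp (t - s) * x))"
        using AE_exponential[OF x t coag_AE]
        by eventually_elim (use x in \<open>auto simp: dilation_def split: split_indicator\<close>)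
    qed measurable
    also have "\<dots> = 1 / x\<^sup>2 * (\<integral>u. indicator {x..exp t * x} u * (u * C u) \<partial>lborel)"
      by (rule integral_dilation[OF Cm C_integrable(2) x t])
    finally show ?thesis .
  qed
  define T where "T x = (\<integral>u. indicator {x<..} u * (u * C u) \<partial>lborel)" for x
  \<comment> \<open>A decreasing majorant of \<open>\<bar>T\<bar>\<close> that tends to zero at infinity.\<close>
  define \<tau> where "\<tau> x = (\<integral>u. indicator {x<..} u * \<bar>u * C u\<bar> \<partial>lborel)" for x
  have uCi: "integrable lborel (\<lambda>u. indicator A u * (u * C u))" "integrable lborel (\<lambda>u. indicator A u * \<bar>u * C u\<bar>)" if "A \<in> sets borel" for A
    using integrable_mult_indicator[of A lborel "\<lambda>u. u * C u"] integrable_mult_indicator[of A lborel "\<lambda>u. \<bar>u * C u\<bar>"] that C_integrable(2)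
    by auto
  have inv: "AE x in lborel. 0 < x \<longrightarrow> x\<^sup>2 * H x - T x = (2^m * x)\<^sup>2 * H (2^m * x) - T (2^m * x)" for m :: nat
  proof -
    define t where "t = real m * ln 2"
    have t: "0 \<le> t" by (simp add: t_def)
    have et: "exp t = 2^m" by (simp add: t_def exp_of_nat_mult)
    have e2: "exp (2 * t) = (2^m)\<^sup>2" unfolding et[symmetric] by (simp add: power2_eq_square exp_add[symmetric])
    have "AE x in lborel. x > 0 \<longrightarrow> G x = dilation t G x + (LINT s:{0..t}|lebesgue. dilation (t - s) (coag KW G) x)"
      using G(4) t by (simp add: stationary_mild_solution_def AE_completion_iff)
    moreover have "AE x in lborel. 0 < 0 + 2^m * x \<longrightarrow> G (0 + 2^m * x) = H (0 + 2^m * x)"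
      by (rule AE_affine[OF _ GH]) simp
    ultimately show ?thesis using GH AE_lborel_singleton[of 0]
    proof eventually_elim
      case (elim x)
      show ?case
      proof
        assume x: "0 < x"
        have "H x = (2^m)\<^sup>2 * H (2^m * x) + 1 / x\<^sup>2 * (\<integral>u. indicator {x..2^m * x} u * (u * C u) \<partial>lborel)"
          using elim x duhamel[OF x t] by (simp add: dilation_def et e2)
        then have "x\<^sup>2 * H x = (2^m * x)\<^sup>2 * H (2^m * x) + (\<integral>u. indicator {x..2^m * x} u * (u * C u) \<partial>lborel)"
          using x by (simp add: field_simps)
        also have "(\<integral>u. indicator {x..2^m * x} u * (u * C u) \<partial>lborel) = T x - T (2^m * x)"
        proof -
          have "x * 1 \<le> x * 2^m" using x by (intro mult_left_mono) auto
          then have le: "x \<le> 2^m * x" by (simp add: mult.commute)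
          have "T x - T (2^m * x) = (\<integral>u. indicator {x<..} u * (u * C u) - indicator {2^m * x<..} u * (u * C u) \<partial>lborel)"
            unfolding T_def by (intro Bochner_Integration.integral_diff[symmetric] uCi) auto
          also have "\<dots> = (\<integral>u. indicator {x..2^m * x} u * (u * C u) \<partial>lborel)"
          proof (rule integral_cong_AE)
            show "AE u in lborel. indicator {x<..} u * (u * C u) - indicator {2^m * x<..} u * (u * C u) = indicator {x..2^m * x} u * (u * C u)"
              using AE_lborel_singleton[of x] by eventually_elim (use le in \<open>auto split: split_indicator\<close>)
          qed measurable
          finally show ?thesis by simp
        qed
        finally show "x\<^sup>2 * H x - T x = (2^m * x)\<^sup>2 * H (2^m * x) - T (2^m * x)" by simp
      qed
    qed
  qed
  have T_meas: "T \<in> borel_measurable borel"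
  proof -
    have "T = (\<lambda>x. \<integral>u. (if x < u then 1 else 0) * (u * C u) \<partial>lborel)"
      unfolding T_def by (intro ext Bochner_Integration.integral_cong) (auto split: split_indicator)
    then show ?thesis by simp
  qed
  have "AE x in lborel. 0 < x \<longrightarrow> x\<^sup>2 * H x = T x"
  proof (rule scaling_invariant_zero[OF Hm T_meas H0 xHi _ _ _ inv, where \<tau>=\<tau>])
    show "\<bar>T x\<bar> \<le> \<tau> x" for x
      unfolding T_def \<tau>_def by (rule integral_abs_bound_integral[OF uCi]) (auto simp: abs_mult)
    show "\<tau> y \<le> \<tau> x" if "x \<le> y" for x y
      unfolding \<tau>_def using that by (intro integral_mono uCi mult_right_mono) (auto split: split_indicator)
    show "(\<tau> \<longlongrightarrow> 0) at_top"
      unfolding \<tau>_def using C_integrable(2) by (intro tail_integral_tendsto_0) auto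
  qed
  then have "coagulation_profile H w \<epsilon>"
    by unfold_locales (simp add: T_def)
  then show thesis using GH by (rule that)
qed

theorem corollary7p3:
  fixes k :: real
  assumes "k \<ge> 0"
  shows "\<exists>D\<ge>0. \<forall>(W :: real \<Rightarrow> real \<Rightarrow> real) (\<epsilon> :: real) (G :: real \<Rightarrow> real).
    continuous_on ({0<..} \<times> {0<..}) (\<lambda>(x, y). W x y) \<longrightarrow>
    (\<forall>x>0. \<forall>y>0. W x y = W y x) \<longrightarrow>
    (\<forall>x>0. \<forall>y>0. 0 \<le> W x y \<and> W x y \<le> 1) \<longrightarrow>
    (\<forall>x>0. \<forall>y>0. \<forall>l>0. W (l * x) (l * y) = W x y) \<longrightarrow>
    0 \<le> \<epsilon> \<longrightarrow> \<epsilon> \<le> 1 \<longrightarrow>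
    self_similar_profile (\<lambda>x y. 2 + \<epsilon> * W x y) G \<longrightarrow>
    L1_norm k (\<lambda>x. G x - exp (- x)) \<le> ennreal (D * \<epsilon>)"
proof -
  obtain D where D: "D \<ge> 0" "\<And>H w \<epsilon>. coagulation_profile H w \<epsilon> \<Longrightarrow>
    (\<integral>\<^sup>+x. ennreal (\<bar>H x - exp (- x)\<bar> * (1 + x) powr k) * indicator {0<..} x \<partial>lborel) \<le> ennreal (D * \<epsilon>)"
    using profile_stability[OF assms] by blast
  show ?thesis
  proof (intro exI[of _ D] conjI D(1) allI impI)
    fix W :: "real \<Rightarrow> real \<Rightarrow> real" and \<epsilon> :: real and G :: "real \<Rightarrow> real"
    assume "continuous_on ({0<..} \<times> {0<..}) (\<lambda>(x, y). W x y)"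
      "\<forall>x>0. \<forall>y>0. W x y = W y x" "\<forall>x>0. \<forall>y>0. 0 \<le> W x y \<and> W x y \<le> 1"
      "0 \<le> \<epsilon>" "\<epsilon> \<le> 1" "self_similar_profile (\<lambda>x y. 2 + \<epsilon> * W x y) G"
    then obtain H w where H: "coagulation_profile H w \<epsilon>" "AE x in lborel. 0 < x \<longrightarrow> G x = H x"
      by (rule profile_representative)
    have "L1_norm k (\<lambda>x. G x - exp (- x)) = (\<integral>\<^sup>+x. ennreal (\<bar>H x - exp (- x)\<bar> * (1 + x) powr k) * indicator {0<..} x \<partial>lborel)"
      unfolding L1_norm_def nn_integral_completion
      by (rule nn_integral_cong_AE) (use H(2) in \<open>eventually_elim, auto split: split_indicator\<close>)
    then show "L1_norm k (\<lambda>x. G x - exp (- x)) \<le> ennreal (D * \<epsilon>)" using D(2)[OF H(1)] by simp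
  qed
qed

end
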